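(* The gregarious model structure $\mathrm{DblCat}_{\mathrm{greg}}$ is left proper.
   Context: **Double categories.** All double categories are small and strict (internal categories in $\mathrm{Cat}$): they have objects, horizontal morphisms, vertical morphisms, and squares, each square having a top and a bottom horizontal morphism and a left and a right vertical morphism. $\mathrm{DblCat}$ is the category of double categories and double functors. $\alpha\vert\beta$ is the horizontal composite ($\alpha$ to the left of $\beta$), $\frac{\alpha}{\beta}$ the vertical composite ($\alpha$ above $\beta$); $e_f$ is the vertical identity square at a horizontal morphism $f$, $\mathrm{id}_u$ the horizontal identity square at a vertical morphism $u$. A double functor is a *canonical trivial fibration* if it is surjective on objects, full on horizontal morphisms, full on vertical morphisms, and fully faithful on squares (bijective on squares with any given boundary in the source). **Gregarious notions.** For a double category $\mathbb A$, $\mathbf H\mathbb A$ is its underlying horizontal 2-category (objects, horizontal morphisms, and as 2-morphisms the squares whose left and right sides are identities), and $\mathbf V\mathbb A$ its underlying vertical 2-category (defined with the two directions exchanged). A *companion pair* $(f,u,\varphi,\psi)$ in $\mathbb A$ consists of a horizontal morphism $f\colon A\to B$, a vertical morphism $u$ from $A$ to $B$, a square $\varphi$ with top $f$, left $u$, bottom and right identities at $B$, and a square $\psi$ with top and left identities at $A$, bottom $f$, right $u$, such that $\psi\vert\varphi=e_f$ and $\frac{\psi}{\varphi}=\mathrm{id}_u$. $\mathbf R\mathbb A$ is the 2-category with the objects of $\mathbb A$, companion pairs as morphisms (with the evident pasting composition), and as 2-morphisms $(f,u,\varphi,\psi)\Rightarrow(f',u',\varphi',\psi')$ the squares of $\mathbb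 A$ with top $f$, bottom $f'$ and identity left and right sides. A *gregarious equivalence* is a companion pair that is an equivalence in $\mathbf R\mathbb A$. A double functor $F\colon\mathbb A\to\mathbb B$ is a *gregarious double equivalence* if: (g1) for every object $B\in\mathbb B$ there are an object $A\in\mathbb A$ and a gregarious equivalence $FA\to B$ in $\mathbb B$; (g2), (g3) the 2-functors $\mathbf HF$ and $\mathbf VF$ are essentially full on morphisms (every morphism $FA\to FC$ is 2-isomorphic to $Ff$ for some $f\colon A\to C$); (g4) $F$ is fully faithful on squares. The *gregarious model structure* $\mathrm{DblCat}_{\mathrm{greg}}$ (known to exist) is the model structure on $\mathrm{DblCat}$ with the gregarious double equivalences as weak equivalences and the canonical trivial fibrations as trivial fibrations. *)

theory Defs
  imports "HOL-Library.FuncSet"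
begin

section \<open>Categories and functors\<close>

record ('o, 'm) category =
  Ob  :: "'o set"
  Ar  :: "'m set"
  Dm  :: "'m \<Rightarrow> 'o"
  Cd  :: "'m \<Rightarrow> 'o"
  Idn :: "'o \<Rightarrow> 'm"
  Cmp :: "'m \<Rightarrow> 'm \<Rightarrow> 'm"

text \<open>Composition is written in diagrammatic order: \<^term>\<open>Cmp C f g\<close> is \<open>f\<close> followed by \<open>g\<close>.\<close>

definition category :: "('o, 'm) category \<Rightarrow> bool" where
  "category C \<longleftrightarrow>
     (\<forall>f\<in>Ar C. Dm C f \<in> Ob C \<and> Cd C f \<in> Ob C) \<and>
     (\<forall>a\<in>Ob C. Idn C a \<in> Ar C \<and> Dm C (Idn C a) = a \<and> Cd C (Idn C a) = a) \<and>
     (\<forall>f\<in>Ar C. \<forall>g\<in>Ar C. Cd C f = Dm C g \<longrightarrow>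
        Cmp C f g \<in> Ar C \<and> Dm C (Cmp C f g) = Dm C f \<and> Cd C (Cmp C f g) = Cd C g) \<and>
     (\<forall>f\<in>Ar C. Cmp C (Idn C (Dm C f)) f = f \<and> Cmp C f (Idn C (Cd C f)) = f) \<and>
     (\<forall>f\<in>Ar C. \<forall>g\<in>Ar C. \<forall>h\<in>Ar C. Cd C f = Dm C g \<longrightarrow> Cd C g = Dm C h \<longrightarrow>
        Cmp C (Cmp C f g) h = Cmp C f (Cmp C g h))"

definition hom :: "('o, 'm) category \<Rightarrow> 'o \<Rightarrow> 'o \<Rightarrow> 'm set" where
  "hom C a b = {f \<in> Ar C. Dm C f = a \<and> Cd C f = b}"

definition isomorphic_in :: "('o, 'm) category \<Rightarrow> 'o \<Rightarrow> 'o \<Rightarrow> bool" where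
  "isomorphic_in C a b \<longleftrightarrow>
     (\<exists>f\<in>hom C a b. \<exists>g\<in>hom C b a. Cmp C f g = Idn C a \<and> Cmp C g f = Idn C b)"

definition is_functor ::
  "('o, 'm) category \<Rightarrow> ('p, 'n) category \<Rightarrow> ('o \<Rightarrow> 'p) \<Rightarrow> ('m \<Rightarrow> 'n) \<Rightarrow> bool" where
  "is_functor C D Fo Fm \<longleftrightarrow>
     (\<forall>a\<in>Ob C. Fo a \<in> Ob D) \<and>
     (\<forall>f\<in>Ar C. Fm f \<in> Ar D \<and> Dm D (Fm f) = Fo (Dm C f) \<and> Cd D (Fm f) = Fo (Cd C f)) \<and>
     (\<forall>a\<in>Ob C. Fm (Idn C a) = Idn D (Fo a)) \<and>
     (\<forall>f\<in>Ar C. \<forall>g\<in>Ar C. Cd C f = Dm C g \<longrightarrow> Fm (Cmp C f g) = Cmp D (Fm f) (Fm g))"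


section \<open>Model structures on a category\<close>

record 'm model =
  Weq :: "'m set"
  Cof :: "'m set"
  Fib :: "'m set"

definition lifts_against :: "('o, 'm) category \<Rightarrow> 'm \<Rightarrow> 'm \<Rightarrow> bool" where
  "lifts_against C i p \<longleftrightarrow>
     (\<forall>u\<in>hom C (Dm C i) (Dm C p). \<forall>v\<in>hom C (Cd C i) (Cd C p). Cmp C u p = Cmp C i v \<longrightarrow>
        (\<exists>h\<in>hom C (Cd C i) (Dm C p). Cmp C i h = u \<and> Cmp C h p = v))"

definition retract_of :: "('o, 'm) category \<Rightarrow> 'm \<Rightarrow> 'm \<Rightarrow> bool" where
  "retract_of C f g \<longleftrightarrow>
     (\<exists>s\<in>hom C (Dm C f) (Dm C g). \<exists>r\<in>hom C (Dm C g) (Dm C f).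
      \<exists>s'\<in>hom C (Cd C f) (Cd C g). \<exists>r'\<in>hom C (Cd C g) (Cd C f).
        Cmp C s g = Cmp C f s' \<and> Cmp C r f = Cmp C g r' \<and>
        Cmp C s r = Idn C (Dm C f) \<and> Cmp C s' r' = Idn C (Cd C f))"

text \<open>Quillen's axioms for the three classes: two-out-of-three, retracts, lifting,
  factorization.  Existence of limits and colimits is a property of the underlying category
  and is not part of the structure.\<close>

definition model_structure :: "('o, 'm) category \<Rightarrow> 'm model \<Rightarrow> bool" where
  "model_structure C M \<longleftrightarrow>
     Weq M \<subseteq> Ar C \<and> Cof M \<subseteq> Ar C \<and> Fib M \<subseteq> Ar C \<and>
     (\<forall>f\<in>Ar C. \<forall>g\<in>Ar C. Cd C f = Dm C g \<longrightarrow>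
        (f \<in> Weq M \<and> g \<in> Weq M \<longrightarrow> Cmp C f g \<in> Weq M) \<and>
        (f \<in> Weq M \<and> Cmp C f g \<in> Weq M \<longrightarrow> g \<in> Weq M) \<and>
        (g \<in> Weq M \<and> Cmp C f g \<in> Weq M \<longrightarrow> f \<in> Weq M)) \<and>
     (\<forall>X\<in>{Weq M, Cof M, Fib M}. \<forall>f\<in>Ar C. \<forall>g\<in>X. retract_of C f g \<longrightarrow> f \<in> X) \<and>
     (\<forall>i\<in>Cof M. \<forall>p\<in>Fib M. i \<in> Weq M \<or> p \<in> Weq M \<longrightarrow> lifts_against C i p) \<and>
     (\<forall>f\<in>Ar C.
        (\<exists>i\<in>Cof M. \<exists>p\<in>Fib M \<inter> Weq M. Cd C i = Dm C p \<and> f = Cmp C i p) \<and>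
        (\<exists>i\<in>Cof M \<inter> Weq M. \<exists>p\<in>Fib M. Cd C i = Dm C p \<and> f = Cmp C i p))"

text \<open>The square with sides \<open>f : A \<rightarrow> B\<close>, \<open>i : A \<rightarrow> C\<close>, \<open>f' : C \<rightarrow> D\<close>, \<open>i' : B \<rightarrow> D\<close> is a
  pushout; \<open>f'\<close> is the pushout of \<open>f\<close> along \<open>i\<close>.\<close>

definition is_pushout :: "('o, 'm) category \<Rightarrow> 'm \<Rightarrow> 'm \<Rightarrow> 'm \<Rightarrow> 'm \<Rightarrow> bool" where
  "is_pushout C f i f' i' \<longleftrightarrow>
     f \<in> Ar C \<and> i \<in> Ar C \<and> f' \<in> Ar C \<and> i' \<in> Ar C \<and>
     Dm C f = Dm C i \<and> Cd C i = Dm C f' \<and> Cd C f = Dm C i' \<and> Cd C f' = Cd C i' \<and>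
     Cmp C f i' = Cmp C i f' \<and>
     (\<forall>T\<in>Ob C. \<forall>b\<in>hom C (Cd C f) T. \<forall>c\<in>hom C (Cd C i) T. Cmp C f b = Cmp C i c \<longrightarrow>
        (\<exists>!d. d \<in> hom C (Cd C f') T \<and> Cmp C i' d = b \<and> Cmp C f' d = c))"

definition left_proper :: "('o, 'm) category \<Rightarrow> 'm model \<Rightarrow> bool" where
  "left_proper C M \<longleftrightarrow>
     (\<forall>f i f' i'. f \<in> Weq M \<longrightarrow> i \<in> Cof M \<longrightarrow> is_pushout C f i f' i' \<longrightarrow> f' \<in> Weq M)"


section \<open>Double categories\<close>

text \<open>
  A double category is given by four categories: objects and horizontal morphisms
  (\<open>HC\<close>), objects and vertical morphisms (\<open>VC\<close>), vertical morphisms and squares under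
  horizontal composition (\<open>HS\<close>), horizontal morphisms and squares under vertical composition
  (\<open>VS\<close>).  Thus a square \<open>\<alpha>\<close> has left and right sides \<open>Dm (HS A) \<alpha>\<close>, \<open>Cd (HS A) \<alpha>\<close>
  and top and bottom sides \<open>Dm (VS A) \<alpha>\<close>, \<open>Cd (VS A) \<alpha>\<close>.
  All cells are drawn from one type \<open>'u\<close>, which plays the role of the universe of small sets.
\<close>

record 'u dblcat =
  HC :: "('u, 'u) category"
  VC :: "('u, 'u) category"
  HS :: "('u, 'u) category"
  VS :: "('u, 'u) category"

abbreviation Sq :: "'u dblcat \<Rightarrow> 'u set" where "Sq A \<equiv> Ar (HS A)"
abbreviation lft :: "'u dblcat \<Rightarrow> 'u \<Rightarrow> 'u" where "lft A \<equiv> Dm (HS A)"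
abbreviation rgt :: "'u dblcat \<Rightarrow> 'u \<Rightarrow> 'u" where "rgt A \<equiv> Cd (HS A)"
abbreviation tp :: "'u dblcat \<Rightarrow> 'u \<Rightarrow> 'u" where "tp A \<equiv> Dm (VS A)"
abbreviation bt :: "'u dblcat \<Rightarrow> 'u \<Rightarrow> 'u" where "bt A \<equiv> Cd (VS A)"

text \<open>\<open>beside A \<alpha> \<beta>\<close> is \<open>\<alpha>|\<beta>\<close>, \<open>above A \<alpha> \<beta>\<close> is \<open>\<alpha>/\<beta>\<close>, \<open>esq A f\<close> is \<open>e\<^sub>f\<close> and
  \<open>idsq A u\<close> is \<open>id\<^sub>u\<close>.\<close>

abbreviation beside :: "'u dblcat \<Rightarrow> 'u \<Rightarrow> 'u \<Rightarrow> 'u" where "beside A \<equiv> Cmp (HS A)"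
abbreviation above :: "'u dblcat \<Rightarrow> 'u \<Rightarrow> 'u \<Rightarrow> 'u" where "above A \<equiv> Cmp (VS A)"
abbreviation esq :: "'u dblcat \<Rightarrow> 'u \<Rightarrow> 'u" where "esq A \<equiv> Idn (VS A)"
abbreviation idsq :: "'u dblcat \<Rightarrow> 'u \<Rightarrow> 'u" where "idsq A \<equiv> Idn (HS A)"

text \<open>The internal category in \<open>Cat\<close> has \<^term>\<open>VC A\<close> as its category of objects and \<^term>\<open>VS A\<close>
  as its category of morphisms.  The three functor conditions are functoriality of source,
  target and identities; the remaining ones are functoriality of composition.\<close>

definition double_category :: "'u dblcat \<Rightarrow> bool" where
  "double_category A \<longleftrightarrow>
     category (HC A) \<and> category (VC A) \<and> category (HS A) \<and> category (VS A) \<and>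
     Ob (VC A) = Ob (HC A) \<and> Ob (HS A) = Ar (VC A) \<and> Ob (VS A) = Ar (HC A) \<and>
     Ar (VS A) = Ar (HS A) \<and>
     is_functor (VS A) (VC A) (Dm (HC A)) (lft A) \<and>
     is_functor (VS A) (VC A) (Cd (HC A)) (rgt A) \<and>
     is_functor (VC A) (VS A) (Idn (HC A)) (idsq A) \<and>
     (\<forall>\<alpha>\<in>Sq A. \<forall>\<beta>\<in>Sq A. rgt A \<alpha> = lft A \<beta> \<longrightarrow>
        tp A (beside A \<alpha> \<beta>) = Cmp (HC A) (tp A \<alpha>) (tp A \<beta>) \<and>
        bt A (beside A \<alpha> \<beta>) = Cmp (HC A) (bt A \<alpha>) (bt A \<beta>)) \<and>
     (\<forall>f\<in>Ar (HC A). \<forall>g\<in>Ar (HC A). Cd (HC A) f = Dm (HC A) g \<longrightarrow>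
        esq A (Cmp (HC A) f g) = beside A (esq A f) (esq A g)) \<and>
     (\<forall>\<alpha>\<in>Sq A. \<forall>\<beta>\<in>Sq A. \<forall>\<gamma>\<in>Sq A. \<forall>\<delta>\<in>Sq A.
        rgt A \<alpha> = lft A \<beta> \<longrightarrow> rgt A \<gamma> = lft A \<delta> \<longrightarrow>
        bt A \<alpha> = tp A \<gamma> \<longrightarrow> bt A \<beta> = tp A \<delta> \<longrightarrow>
        above A (beside A \<alpha> \<beta>) (beside A \<gamma> \<delta>) = beside A (above A \<alpha> \<gamma>) (above A \<beta> \<delta>))"

text \<open>Exchange of the two directions.\<close>

definition transpose :: "'u dblcat \<Rightarrow> 'u dblcat" where
  "transpose A = \<lparr> HC = VC A, VC = HC A, HS = VS A, VS = HS A \<rparr>"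

text \<open>Squares with top \<open>f\<close>, bottom \<open>g\<close>, left side \<open>u\<close> and right side \<open>v\<close>.\<close>

definition squares :: "'u dblcat \<Rightarrow> 'u \<Rightarrow> 'u \<Rightarrow> 'u \<Rightarrow> 'u \<Rightarrow> 'u set" where
  "squares A f g u v = {\<alpha> \<in> Sq A. tp A \<alpha> = f \<and> bt A \<alpha> = g \<and> lft A \<alpha> = u \<and> rgt A \<alpha> = v}"


section \<open>Double functors and the category of double categories\<close>

record 'u dblfun =
  Src :: "'u dblcat"
  Tgt :: "'u dblcat"
  FO :: "'u \<Rightarrow> 'u"
  FH :: "'u \<Rightarrow> 'u"
  FV :: "'u \<Rightarrow> 'u"
  FS :: "'u \<Rightarrow> 'u"

text \<open>Extensionality makes equality of double functors agree with equality on cells.\<close>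

definition double_functor :: "'u dblfun \<Rightarrow> bool" where
  "double_functor F \<longleftrightarrow>
     double_category (Src F) \<and> double_category (Tgt F) \<and>
     FO F \<in> extensional (Ob (HC (Src F))) \<and> FH F \<in> extensional (Ar (HC (Src F))) \<and>
     FV F \<in> extensional (Ar (VC (Src F))) \<and> FS F \<in> extensional (Sq (Src F)) \<and>
     is_functor (HC (Src F)) (HC (Tgt F)) (FO F) (FH F) \<and>
     is_functor (VC (Src F)) (VC (Tgt F)) (FO F) (FV F) \<and>
     is_functor (HS (Src F)) (HS (Tgt F)) (FV F) (FS F) \<and>
     is_functor (VS (Src F)) (VS (Tgt F)) (FH F) (FS F)"

definition dblfun_id :: "'u dblcat \<Rightarrow> 'u dblfun" where
  "dblfun_id A = \<lparr> Src = A, Tgt = A,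
     FO = (\<lambda>x\<in>Ob (HC A). x), FH = (\<lambda>x\<in>Ar (HC A). x),
     FV = (\<lambda>x\<in>Ar (VC A). x), FS = (\<lambda>x\<in>Sq A. x) \<rparr>"

definition dblfun_comp :: "'u dblfun \<Rightarrow> 'u dblfun \<Rightarrow> 'u dblfun" where
  "dblfun_comp F G = \<lparr> Src = Src F, Tgt = Tgt G,
     FO = compose (Ob (HC (Src F))) (FO G) (FO F), FH = compose (Ar (HC (Src F))) (FH G) (FH F),
     FV = compose (Ar (VC (Src F))) (FV G) (FV F), FS = compose (Sq (Src F)) (FS G) (FS F) \<rparr>"

definition DblCat :: "('u dblcat, 'u dblfun) category" where
  "DblCat = \<lparr> Ob = {A. double_category A}, Ar = {F. double_functor F},
     Dm = Src, Cd = Tgt, Idn = dblfun_id, Cmp = dblfun_comp \<rparr>"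

definition fully_faithful_on_squares :: "'u dblfun \<Rightarrow> bool" where
  "fully_faithful_on_squares F \<longleftrightarrow>
     (\<forall>X\<in>Ob (HC (Src F)). \<forall>Y\<in>Ob (HC (Src F)). \<forall>X'\<in>Ob (HC (Src F)). \<forall>Y'\<in>Ob (HC (Src F)).
      \<forall>f\<in>hom (HC (Src F)) X Y. \<forall>g\<in>hom (HC (Src F)) X' Y'.
      \<forall>u\<in>hom (VC (Src F)) X X'. \<forall>v\<in>hom (VC (Src F)) Y Y'.
        bij_betw (FS F) (squares (Src F) f g u v)
          (squares (Tgt F) (FH F f) (FH F g) (FV F u) (FV F v)))"

definition canonical_trivial_fibration :: "'u dblfun \<Rightarrow> bool" where
  "canonical_trivial_fibration F \<longleftrightarrow> double_functor F \<and>
     FO F ` Ob (HC (Src F)) = Ob (HC (Tgt F)) \<and>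
     (\<forall>X\<in>Ob (HC (Src F)). \<forall>Y\<in>Ob (HC (Src F)).
        FH F ` hom (HC (Src F)) X Y = hom (HC (Tgt F)) (FO F X) (FO F Y)) \<and>
     (\<forall>X\<in>Ob (VC (Src F)). \<forall>Y\<in>Ob (VC (Src F)).
        FV F ` hom (VC (Src F)) X Y = hom (VC (Tgt F)) (FO F X) (FO F Y)) \<and>
     fully_faithful_on_squares F"


section \<open>The 2-categories of a double category\<close>

text \<open>\<open>C1\<close> is the underlying category, \<open>C2\<close> has the 1-cells as objects and the 2-cells as
  morphisms under vertical composition, and \<open>HCmp\<close> is horizontal composition of 2-cells.\<close>

record ('o, 'm, 't) twocat =
  C1 :: "('o, 'm) category"
  C2 :: "('m, 't) category"
  HCmp :: "'t \<Rightarrow> 't \<Rightarrow> 't"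

definition equivalence_in :: "('o, 'm, 't) twocat \<Rightarrow> 'm \<Rightarrow> bool" where
  "equivalence_in K f \<longleftrightarrow> f \<in> Ar (C1 K) \<and>
     (\<exists>g\<in>hom (C1 K) (Cd (C1 K) f) (Dm (C1 K) f).
        isomorphic_in (C2 K) (Cmp (C1 K) f g) (Idn (C1 K) (Dm (C1 K) f)) \<and>
        isomorphic_in (C2 K) (Cmp (C1 K) g f) (Idn (C1 K) (Cd (C1 K) f)))"

definition essentially_full_on_morphisms ::
  "('o, 'm, 't) twocat \<Rightarrow> ('p, 'n, 's) twocat \<Rightarrow> ('o \<Rightarrow> 'p) \<Rightarrow> ('m \<Rightarrow> 'n) \<Rightarrow> bool" where
  "essentially_full_on_morphisms K L Fo Fm \<longleftrightarrow>
     (\<forall>X\<in>Ob (C1 K). \<forall>Y\<in>Ob (C1 K). \<forall>g\<in>hom (C1 L) (Fo X) (Fo Y).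
        \<exists>f\<in>hom (C1 K) X Y. isomorphic_in (C2 L) g (Fm f))"

definition horizontal_2cat :: "'u dblcat \<Rightarrow> ('u, 'u, 'u) twocat" where
  "horizontal_2cat A = \<lparr> C1 = HC A,
     C2 = (VS A) \<lparr> Ar := {\<alpha> \<in> Sq A. lft A \<alpha> \<in> Idn (VC A) ` Ob (VC A) \<and>
                                    rgt A \<alpha> \<in> Idn (VC A) ` Ob (VC A)} \<rparr>,
     HCmp = beside A \<rparr>"

definition vertical_2cat :: "'u dblcat \<Rightarrow> ('u, 'u, 'u) twocat" where
  "vertical_2cat A = horizontal_2cat (transpose A)"

definition companion_pair :: "'u dblcat \<Rightarrow> 'u \<times> 'u \<times> 'u \<times> 'u \<Rightarrow> bool" where
  "companion_pair A = (\<lambda>(f, u, \<phi>, \<psi>).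
     \<exists>X\<in>Ob (HC A). \<exists>Y\<in>Ob (HC A). f \<in> hom (HC A) X Y \<and> u \<in> hom (VC A) X Y \<and>
       \<phi> \<in> squares A f (Idn (HC A) Y) u (Idn (VC A) Y) \<and>
       \<psi> \<in> squares A (Idn (HC A) X) f (Idn (VC A) X) u \<and>
       beside A \<psi> \<phi> = esq A f \<and> above A \<psi> \<phi> = idsq A u)"

text \<open>The composite of companion pairs is the pasting of the two-by-two grids
  \<open>\<phi> | e\<^sub>g\<close> above \<open>id\<^sub>v | \<phi>'\<close>, and \<open>\<psi> | id\<^sub>u\<close> above \<open>e\<^sub>f | \<psi>'\<close>.\<close>

definition companion_comp ::
  "'u dblcat \<Rightarrow> 'u \<times> 'u \<times> 'u \<times> 'u \<Rightarrow> 'u \<times> 'u \<times> 'u \<times> 'u \<Rightarrow> 'u \<times> 'u \<times> 'u \<times> 'u" where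
  "companion_comp A = (\<lambda>(f, u, \<phi>, \<psi>) (g, v, \<phi>', \<psi>').
     (Cmp (HC A) f g, Cmp (VC A) u v,
      above A (beside A \<phi> (esq A g)) (beside A (idsq A v) \<phi>'),
      above A (beside A \<psi> (idsq A u)) (beside A (esq A f) \<psi>')))"

definition companion_id :: "'u dblcat \<Rightarrow> 'u \<Rightarrow> 'u \<times> 'u \<times> 'u \<times> 'u" where
  "companion_id A X =
     (Idn (HC A) X, Idn (VC A) X, esq A (Idn (HC A) X), esq A (Idn (HC A) X))"

text \<open>A 2-cell \<open>(p, \<alpha>, q)\<close> carries its source and target companion pairs, which are not
  determined by the square \<open>\<alpha>\<close>.\<close>

definition companion_2cat ::
  "'u dblcat \<Rightarrow> ('u, 'u \<times> 'u \<times> 'u \<times> 'u, ('u \<times> 'u \<times> 'u \<times> 'u) \<times> 'u \<times> ('u \<times> 'u \<times> 'u \<times> 'u)) twocat"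
  where
  "companion_2cat A = \<lparr>
     C1 = \<lparr> Ob = Ob (HC A), Ar = {p. companion_pair A p},
            Dm = (\<lambda>p. Dm (HC A) (fst p)), Cd = (\<lambda>p. Cd (HC A) (fst p)),
            Idn = companion_id A, Cmp = companion_comp A \<rparr>,
     C2 = \<lparr> Ob = {p. companion_pair A p},
            Ar = {(p, \<alpha>, q). companion_pair A p \<and> companion_pair A q \<and>
                    (\<exists>X\<in>Ob (HC A). \<exists>Y\<in>Ob (HC A).
                       \<alpha> \<in> squares A (fst p) (fst q) (Idn (VC A) X) (Idn (VC A) Y))},
            Dm = fst, Cd = (\<lambda>t. snd (snd t)),
            Idn = (\<lambda>p. (p, esq A (fst p), p)),
            Cmp = (\<lambda>(p, \<alpha>, q) (p', \<beta>, q'). (p, above A \<alpha> \<beta>, q')) \<rparr>,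
     HCmp = (\<lambda>(p, \<alpha>, q) (p', \<beta>, q').
               (companion_comp A p p', beside A \<alpha> \<beta>, companion_comp A q q')) \<rparr>"

definition gregarious_equivalence :: "'u dblcat \<Rightarrow> 'u \<times> 'u \<times> 'u \<times> 'u \<Rightarrow> bool" where
  "gregarious_equivalence A p \<longleftrightarrow> companion_pair A p \<and> equivalence_in (companion_2cat A) p"


section \<open>The gregarious model structure\<close>

definition gregarious_double_equivalence :: "'u dblfun \<Rightarrow> bool" where
  "gregarious_double_equivalence F \<longleftrightarrow> double_functor F \<and>
     (\<forall>Y\<in>Ob (HC (Tgt F)). \<exists>X\<in>Ob (HC (Src F)).
        \<exists>p\<in>hom (C1 (companion_2cat (Tgt F))) (FO F X) Y. gregarious_equivalence (Tgt F) p) \<and>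
     essentially_full_on_morphisms
       (horizontal_2cat (Src F)) (horizontal_2cat (Tgt F)) (FO F) (FH F) \<and>
     essentially_full_on_morphisms
       (vertical_2cat (Src F)) (vertical_2cat (Tgt F)) (FO F) (FV F) \<and>
     fully_faithful_on_squares F"

text \<open>Weak equivalences and trivial fibrations determine a model structure, so there is at most
  one \<open>M\<close> satisfying this.\<close>

definition gregarious_model_structure :: "'u dblfun model \<Rightarrow> bool" where
  "gregarious_model_structure M \<longleftrightarrow>
     model_structure DblCat M \<and>
     Weq M = {F. gregarious_double_equivalence F} \<and>
     Fib M \<inter> Weq M = {F. canonical_trivial_fibration F}"

end

theory Submission
  imports Defs
begin

text \<open>
  Factor a weak equivalence as a trivial cofibration \<open>k : A \<rightarrow> E\<close> followed by a canonical trivial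
  fibration \<open>p : E \<rightarrow> B\<close>, and its pushout along \<open>A \<rightarrow> C\<close> as a trivial cofibration followed by a fibration.
  Lifting \<open>k\<close> against that fibration reduces the claim to a statement about \<open>p\<close> and an
  arbitrary double functor \<open>h : E \<rightarrow> X\<close>: there are a canonical trivial fibration \<open>r : Z \<rightarrow> X\<close>, a lift
  \<open>I : E \<rightarrow> Z\<close> of \<open>h\<close> and a commutative square from \<open>I\<close> to some \<open>B \<rightarrow> W\<close> with sides \<open>p\<close> and \<open>G : Z \<rightarrow> W\<close>,
  where \<open>G\<close> is again a canonical trivial fibration and the square has the existence part of the
  universal property of a pushout.  The pushout in question is then a retract of a composite of
  \<open>G\<close> with weak equivalences, so that no pushout has to be constructed.

  The arrows of \<open>Z\<close> are words in arrows of \<open>E\<close> and free generators, one for each arrow of \<open>X\<close>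
  between images of objects, and its squares are those of \<open>X\<close>.  The cells of \<open>W\<close> are normal forms of
  cells of \<open>Z\<close>: every letter is replaced by a chosen one with the same image under \<open>p\<close>.  As \<open>p\<close> is
  fully faithful on squares, letters with the same image are connected by unique squares over
  identities; these are therefore coherent, and conjugation by them is an idempotent \<open>N\<close> with
  \<open>N (x y) = N (N x N y)\<close> for all compositions.  Vertical words are normalised first: this makes the
  vertical lifts of identities invertible, which allows the second step to identify objects.
\<close>

section \<open>Calculus of squares\<close>

text \<open>A pushout of double categories is a quotient of formal pastings, over which there is
  little control. In \<open>Z\<close> the equations between arrows of the old target survive only as
  squares over identities, so words are unique and replacing their letters is well defined. The map
  from \<open>Z\<close> to the old target is fully faithful on squares by construction; for
  surjectivity on objects, a discrete copy of the objects of the target is added to both ends of the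
  trivial fibration. Fixed points of an idempotent replace equivalence classes: they need no code in
  the cell type, and a map out of \<open>Z\<close> that does not see the idempotent is literally a
  map out of \<open>W\<close>. Coherence is cheap, because a connecting square is determined by its
  boundary. The boundary is the obstacle once objects are merged. A lift of an identity from
  \<open>x\<close> to \<open>x'\<close> followed by one back is a loop at \<open>x\<close> over an
  identity, in general not an identity itself, and conjugates then fail to compose. Rewriting the
  letters of vertical words turns such loops into identities. Horizontally no invertibility is
  available or needed: two arrows that normalise to identities suffice for fullness.\<close>

definition harr :: "'u dblcat \<Rightarrow> 'u \<Rightarrow> 'u \<Rightarrow> 'u \<Rightarrow> bool" where
  "harr A f x y \<longleftrightarrow> f \<in> Ar (HC A) \<and> Dm (HC A) f = x \<and> Cd (HC A) f = y"

definition varr :: "'u dblcat \<Rightarrow> 'u \<Rightarrow> 'u \<Rightarrow> 'u \<Rightarrow> bool" where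
  "varr A u x y \<longleftrightarrow> u \<in> Ar (VC A) \<and> Dm (VC A) u = x \<and> Cd (VC A) u = y"

definition sq :: "'u dblcat \<Rightarrow> 'u \<Rightarrow> 'u \<Rightarrow> 'u \<Rightarrow> 'u \<Rightarrow> 'u \<Rightarrow> bool" where
  "sq A \<alpha> t b l r \<longleftrightarrow> \<alpha> \<in> Sq A \<and> tp A \<alpha> = t \<and> bt A \<alpha> = b \<and> lft A \<alpha> = l \<and> rgt A \<alpha> = r"

lemma in_hom_HC [simp]: "f \<in> hom (HC A) x y \<longleftrightarrow> harr A f x y"
  by (simp add: hom_def harr_def)

lemma in_hom_VC [simp]: "u \<in> hom (VC A) x y \<longleftrightarrow> varr A u x y"
  by (simp add: hom_def varr_def)

lemma in_squares [simp]: "\<alpha> \<in> squares A t b l r \<longleftrightarrow> sq A \<alpha> t b l r"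
  by (simp add: squares_def sq_def)

lemma transpose_sel [simp]:
  "HC (transpose A) = VC A" "VC (transpose A) = HC A" "HS (transpose A) = VS A" "VS (transpose A) = HS A"
  by (simp_all add: transpose_def)

lemma transpose_transpose [simp]: "transpose (transpose A) = A"
  by (simp add: transpose_def)

lemma harr_transpose [simp]: "harr (transpose A) = varr A"
  by (simp add: harr_def varr_def fun_eq_iff)

lemma varr_transpose [simp]: "varr (transpose A) = harr A"
  by (simp add: harr_def varr_def fun_eq_iff)

text \<open>The squares of \<open>transpose A\<close> are the arrows of \<open>VS A\<close>; that
  these are the squares of \<open>A\<close> is one of the double category axioms, hence the
  hypothesis.\<close>

lemma sq_transpose: "double_category A \<Longrightarrow> sq (transpose A) \<alpha> t b l r \<longleftrightarrow> sq A \<alpha> l r t b"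
  by (auto simp: sq_def double_category_def)

lemma category_Dm_Cd: "category C \<Longrightarrow> f \<in> Ar C \<Longrightarrow> Dm C f \<in> Ob C \<and> Cd C f \<in> Ob C"
  by (simp add: category_def)

lemma category_Idn: "category C \<Longrightarrow> a \<in> Ob C \<Longrightarrow> Idn C a \<in> Ar C \<and> Dm C (Idn C a) = a \<and> Cd C (Idn C a) = a"
  by (simp add: category_def)

lemma category_Cmp: "category C \<Longrightarrow> f \<in> Ar C \<Longrightarrow> g \<in> Ar C \<Longrightarrow> Cd C f = Dm C g \<Longrightarrow>
   Cmp C f g \<in> Ar C \<and> Dm C (Cmp C f g) = Dm C f \<and> Cd C (Cmp C f g) = Cd C g"
  by (simp add: category_def)

lemma category_unit: "category C \<Longrightarrow> f \<in> Ar C \<Longrightarrow> Cmp C (Idn C (Dm C f)) f = f \<and> Cmp C f (Idn C (Cd C f)) = f"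
  by (simp add: category_def)

lemma category_assoc: "category C \<Longrightarrow> f \<in> Ar C \<Longrightarrow> g \<in> Ar C \<Longrightarrow> h \<in> Ar C \<Longrightarrow> Cd C f = Dm C g \<Longrightarrow> Cd C g = Dm C h
   \<Longrightarrow> Cmp C (Cmp C f g) h = Cmp C f (Cmp C g h)"
  by (simp add: category_def)

locale dcat =
  fixes A :: "'u dblcat"
  assumes dc: "double_category A"
begin

lemma cats: "category (HC A)" "category (VC A)" "category (HS A)" "category (VS A)"
  and obs: "Ob (VC A) = Ob (HC A)" "Ob (HS A) = Ar (VC A)" "Ob (VS A) = Ar (HC A)" "Ar (VS A) = Ar (HS A)"
  and functors: "is_functor (VS A) (VC A) (Dm (HC A)) (lft A)" "is_functor (VS A) (VC A) (Cd (HC A)) (rgt A)"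
     "is_functor (VC A) (VS A) (Idn (HC A)) (idsq A)"
  using dc by (simp_all add: double_category_def)

lemma corners:
  assumes "\<alpha> \<in> Sq A"
  shows "Dm (VC A) (lft A \<alpha>) = Dm (HC A) (tp A \<alpha>)" "Cd (VC A) (lft A \<alpha>) = Dm (HC A) (bt A \<alpha>)"
    "Dm (VC A) (rgt A \<alpha>) = Cd (HC A) (tp A \<alpha>)" "Cd (VC A) (rgt A \<alpha>) = Cd (HC A) (bt A \<alpha>)"
    "lft A \<alpha> \<in> Ar (VC A)" "rgt A \<alpha> \<in> Ar (VC A)" "tp A \<alpha> \<in> Ar (HC A)" "bt A \<alpha> \<in> Ar (HC A)"
  using functors(1,2) category_Dm_Cd[OF cats(4), of \<alpha>] assms by (auto simp: is_functor_def obs)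

lemma above_sides:
  assumes "\<alpha> \<in> Sq A" "\<beta> \<in> Sq A" "bt A \<alpha> = tp A \<beta>"
  shows "lft A (above A \<alpha> \<beta>) = Cmp (VC A) (lft A \<alpha>) (lft A \<beta>)" "rgt A (above A \<alpha> \<beta>) = Cmp (VC A) (rgt A \<alpha>) (rgt A \<beta>)"
  using functors(1,2) assms by (auto simp: is_functor_def obs)

lemma beside_sides:
  assumes "\<alpha> \<in> Sq A" "\<beta> \<in> Sq A" "rgt A \<alpha> = lft A \<beta>"
  shows "tp A (beside A \<alpha> \<beta>) = Cmp (HC A) (tp A \<alpha>) (tp A \<beta>)" "bt A (beside A \<alpha> \<beta>) = Cmp (HC A) (bt A \<alpha>) (bt A \<beta>)"
  using dc assms by (auto simp: double_category_def)

lemma harr_ob: assumes "harr A f x y" shows "x \<in> Ob (HC A)" "y \<in> Ob (HC A)"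
  using assms category_Dm_Cd[OF cats(1)] by (auto simp: harr_def)

lemma varr_ob: assumes "varr A u x y" shows "x \<in> Ob (HC A)" "y \<in> Ob (HC A)"
  using assms category_Dm_Cd[OF cats(2)] obs(1) by (auto simp: varr_def)

lemma harr_id: "x \<in> Ob (HC A) \<Longrightarrow> harr A (Idn (HC A) x) x x"
  using category_Idn[OF cats(1)] by (simp add: harr_def)

lemma varr_id: "x \<in> Ob (HC A) \<Longrightarrow> varr A (Idn (VC A) x) x x"
  using category_Idn[OF cats(2)] by (simp add: varr_def obs)

lemma harr_comp: "harr A f x y \<Longrightarrow> harr A g y z \<Longrightarrow> harr A (Cmp (HC A) f g) x z"
  using category_Cmp[OF cats(1)] by (simp add: harr_def)

lemma varr_comp: "varr A f x y \<Longrightarrow> varr A g y z \<Longrightarrow> varr A (Cmp (VC A) f g) x z"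
  using category_Cmp[OF cats(2)] by (simp add: varr_def)

lemma harr_idl: "harr A f x y \<Longrightarrow> Cmp (HC A) (Idn (HC A) x) f = f"
  using category_unit[OF cats(1)] by (auto simp: harr_def)

lemma harr_idr: "harr A f x y \<Longrightarrow> Cmp (HC A) f (Idn (HC A) y) = f"
  using category_unit[OF cats(1)] by (auto simp: harr_def)

lemma varr_idl: "varr A f x y \<Longrightarrow> Cmp (VC A) (Idn (VC A) x) f = f"
  using category_unit[OF cats(2)] by (auto simp: varr_def)

lemma varr_idr: "varr A f x y \<Longrightarrow> Cmp (VC A) f (Idn (VC A) y) = f"
  using category_unit[OF cats(2)] by (auto simp: varr_def)

lemma varr_assoc: "varr A f x y \<Longrightarrow> varr A g y z \<Longrightarrow> varr A h z w \<Longrightarrow>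
   Cmp (VC A) (Cmp (VC A) f g) h = Cmp (VC A) f (Cmp (VC A) g h)"
  using category_assoc[OF cats(2)] by (simp add: varr_def)

lemma sq_corners:
  assumes "sq A \<alpha> t b l r"
  shows "harr A t (Dm (HC A) t) (Cd (HC A) t)" "harr A b (Dm (HC A) b) (Cd (HC A) b)"
    "varr A l (Dm (HC A) t) (Dm (HC A) b)" "varr A r (Cd (HC A) t) (Cd (HC A) b)"
  using assms corners[of \<alpha>] by (auto simp: sq_def harr_def varr_def)

lemma sq_harr:
  assumes "sq A \<alpha> t b l r" "harr A t x y" "harr A b x' y'" shows "varr A l x x'" "varr A r y y'"
  using sq_corners(3,4)[OF assms(1)] assms(2,3) by (auto simp: harr_def)

lemma sq_beside:
  assumes "sq A \<alpha> t b l m" "sq A \<beta> t' b' m r"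
  shows "sq A (beside A \<alpha> \<beta>) (Cmp (HC A) t t') (Cmp (HC A) b b') l r"
  using assms beside_sides[of \<alpha> \<beta>] category_Cmp[OF cats(3), of \<alpha> \<beta>] by (auto simp: sq_def)

lemma sq_above:
  assumes "sq A \<alpha> t m l r" "sq A \<beta> m b l' r'"
  shows "sq A (above A \<alpha> \<beta>) t b (Cmp (VC A) l l') (Cmp (VC A) r r')"
  using assms above_sides[of \<alpha> \<beta>] category_Cmp[OF cats(4), of \<alpha> \<beta>] by (auto simp: sq_def obs)

lemma sq_esq: assumes "harr A f x y" shows "sq A (esq A f) f f (Idn (VC A) x) (Idn (VC A) y)"
  using assms functors(1,2) category_Idn[OF cats(4), of f] by (auto simp: sq_def harr_def is_functor_def obs)

lemma sq_idsq: assumes "varr A u x y" shows "sq A (idsq A u) (Idn (HC A) x) (Idn (HC A) y) u u"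
  using assms functors(3) category_Idn[OF cats(3), of u] by (auto simp: sq_def varr_def is_functor_def obs)

lemma esq_above: "sq A \<alpha> t b l r \<Longrightarrow> above A (esq A t) \<alpha> = \<alpha>"
  using category_unit[OF cats(4), of \<alpha>] by (auto simp: sq_def obs)

lemma above_esq: "sq A \<alpha> t b l r \<Longrightarrow> above A \<alpha> (esq A b) = \<alpha>"
  using category_unit[OF cats(4), of \<alpha>] by (auto simp: sq_def obs)

lemma idsq_beside: "sq A \<alpha> t b l r \<Longrightarrow> beside A (idsq A l) \<alpha> = \<alpha>"
  using category_unit[OF cats(3), of \<alpha>] by (auto simp: sq_def obs)

lemma beside_idsq: "sq A \<alpha> t b l r \<Longrightarrow> beside A \<alpha> (idsq A r) = \<alpha>"
  using category_unit[OF cats(3), of \<alpha>] by (auto simp: sq_def obs)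

lemma above_assoc: "sq A \<alpha> t m l r \<Longrightarrow> sq A \<beta> m m' l' r' \<Longrightarrow> sq A \<gamma> m' b l'' r'' \<Longrightarrow>
   above A (above A \<alpha> \<beta>) \<gamma> = above A \<alpha> (above A \<beta> \<gamma>)"
  using category_assoc[OF cats(4), of \<alpha> \<beta> \<gamma>] by (auto simp: sq_def obs)

lemma beside_assoc: "sq A \<alpha> t b l m \<Longrightarrow> sq A \<beta> t' b' m m' \<Longrightarrow> sq A \<gamma> t'' b'' m' r \<Longrightarrow>
   beside A (beside A \<alpha> \<beta>) \<gamma> = beside A \<alpha> (beside A \<beta> \<gamma>)"
  using category_assoc[OF cats(3), of \<alpha> \<beta> \<gamma>] by (auto simp: sq_def obs)

lemma interchange:
  assumes "sq A \<alpha> t m l c" "sq A \<beta> t' m' c r" "sq A \<gamma> m b l' c'" "sq A \<delta> m' b' c' r'"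
  shows "above A (beside A \<alpha> \<beta>) (beside A \<gamma> \<delta>) = beside A (above A \<alpha> \<gamma>) (above A \<beta> \<delta>)"
proof -
  have "\<forall>\<alpha>\<in>Sq A. \<forall>\<beta>\<in>Sq A. \<forall>\<gamma>\<in>Sq A. \<forall>\<delta>\<in>Sq A.
        rgt A \<alpha> = lft A \<beta> \<longrightarrow> rgt A \<gamma> = lft A \<delta> \<longrightarrow>
        bt A \<alpha> = tp A \<gamma> \<longrightarrow> bt A \<beta> = tp A \<delta> \<longrightarrow>
        above A (beside A \<alpha> \<beta>) (beside A \<gamma> \<delta>) = beside A (above A \<alpha> \<gamma>) (above A \<beta> \<delta>)"
    using dc unfolding double_category_def by (elim conjE)
  then show ?thesis
    using assms by (simp add: sq_def)
qed

lemma esq_comp: "harr A f x y \<Longrightarrow> harr A g y z \<Longrightarrow> esq A (Cmp (HC A) f g) = beside A (esq A f) (esq A g)"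
  using dc by (simp add: double_category_def harr_def)

lemma idsq_comp: "varr A f x y \<Longrightarrow> varr A g y z \<Longrightarrow> idsq A (Cmp (VC A) f g) = above A (idsq A f) (idsq A g)"
  using functors(3) by (simp add: is_functor_def varr_def)

lemma esq_Idn: "x \<in> Ob (HC A) \<Longrightarrow> esq A (Idn (HC A) x) = idsq A (Idn (VC A) x)"
  using functors(3) by (simp add: is_functor_def obs)

text \<open>The definition favours one direction: the maps on \<open>VS A\<close> are functors by
  hypothesis, while for \<open>HS A\<close> the same facts are spread over equations for sides and
  identities. Reassembling those into functors gives symmetry, so a vertical statement can later be
  the horizontal one for the transpose.\<close>

lemma double_category_transpose: "double_category (transpose A)"
proof -
  have 1: "is_functor (HS A) (HC A) (Dm (VC A)) (tp A)" "is_functor (HS A) (HC A) (Cd (VC A)) (bt A)"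
    "is_functor (HC A) (HS A) (Idn (VC A)) (esq A)"
    unfolding is_functor_def
    using corners beside_sides sq_idsq sq_esq esq_comp esq_Idn[symmetric]
      category_Dm_Cd[OF cats(2)] category_Idn[OF cats(2)]
    by (auto simp: sq_def harr_def varr_def obs)
  show ?thesis
    unfolding double_category_def transpose_sel
    using 1 cats obs above_sides idsq_comp interchange[unfolded sq_def, symmetric] by (auto simp: varr_def)
qed

end

section \<open>Double functors without extensionality\<close>

text \<open>Plain functions without source, target or restriction: composition is associative by
  computation, and exchanging the two directions only swaps two fields. Equality is meaningful only
  on the cells of a source, which is the role of \<open>meq\<close>.\<close>

record 'u cellmap =
  mo :: "'u \<Rightarrow> 'u"
  mh :: "'u \<Rightarrow> 'u"
  mv :: "'u \<Rightarrow> 'u"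
  ms :: "'u \<Rightarrow> 'u"

definition mtranspose :: "'u cellmap \<Rightarrow> 'u cellmap" where
  "mtranspose m = \<lparr> mo = mo m, mh = mv m, mv = mh m, ms = ms m \<rparr>"

lemma mtranspose_sel [simp]:
  "mo (mtranspose m) = mo m" "mh (mtranspose m) = mv m" "mv (mtranspose m) = mh m" "ms (mtranspose m) = ms m"
  "mtranspose (mtranspose m) = m"
  by (simp_all add: mtranspose_def)

definition mcomp :: "'u cellmap \<Rightarrow> 'u cellmap \<Rightarrow> 'u cellmap" where
  "mcomp m n = \<lparr> mo = (\<lambda>x. mo n (mo m x)), mh = (\<lambda>x. mh n (mh m x)), mv = (\<lambda>x. mv n (mv m x)), ms = (\<lambda>x. ms n (ms m x)) \<rparr>"

lemma mcomp_sel [simp]: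
  "mo (mcomp m n) x = mo n (mo m x)" "mh (mcomp m n) x = mh n (mh m x)"
  "mv (mcomp m n) x = mv n (mv m x)" "ms (mcomp m n) x = ms n (ms m x)"
  by (simp_all add: mcomp_def)

definition meq :: "'u dblcat \<Rightarrow> 'u cellmap \<Rightarrow> 'u cellmap \<Rightarrow> bool" where
  "meq A m n \<longleftrightarrow> (\<forall>x\<in>Ob (HC A). mo m x = mo n x) \<and> (\<forall>x\<in>Ar (HC A). mh m x = mh n x) \<and>
     (\<forall>x\<in>Ar (VC A). mv m x = mv n x) \<and> (\<forall>x\<in>Sq A. ms m x = ms n x)"

definition dfun :: "'u dblcat \<Rightarrow> 'u dblcat \<Rightarrow> 'u cellmap \<Rightarrow> bool" where
  "dfun A B m \<longleftrightarrow> double_category A \<and> double_category B \<and>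
     is_functor (HC A) (HC B) (mo m) (mh m) \<and> is_functor (VC A) (VC B) (mo m) (mv m) \<and>
     is_functor (HS A) (HS B) (mv m) (ms m) \<and> is_functor (VS A) (VS B) (mh m) (ms m)"

lemma dfun_transpose: "dfun A B m \<Longrightarrow> dfun (transpose A) (transpose B) (mtranspose m)"
  by (simp add: dfun_def dcat.double_category_transpose dcat_def)

lemma dfun_dc: "dfun A B m \<Longrightarrow> double_category A" "dfun A B m \<Longrightarrow> double_category B"
  by (simp_all add: dfun_def)

lemma dfun_dcat: "dfun A B m \<Longrightarrow> dcat A" "dfun A B m \<Longrightarrow> dcat B"
  by (simp_all add: dfun_def dcat_def)

lemma dfun_ob: "dfun A B m \<Longrightarrow> x \<in> Ob (HC A) \<Longrightarrow> mo m x \<in> Ob (HC B)"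
  by (simp add: dfun_def is_functor_def)

lemma dfun_harr: "dfun A B m \<Longrightarrow> harr A f x y \<Longrightarrow> harr B (mh m f) (mo m x) (mo m y)"
  by (auto simp: dfun_def is_functor_def harr_def)

lemma dfun_varr: "dfun A B m \<Longrightarrow> varr A f x y \<Longrightarrow> varr B (mv m f) (mo m x) (mo m y)"
  by (auto simp: dfun_def is_functor_def varr_def)

lemma dfun_sq: "dfun A B m \<Longrightarrow> sq A \<alpha> t b l r \<Longrightarrow> sq B (ms m \<alpha>) (mh m t) (mh m b) (mv m l) (mv m r)"
  by (auto simp: dfun_def is_functor_def sq_def double_category_def)

lemma dfun_hcomp: "dfun A B m \<Longrightarrow> harr A f x y \<Longrightarrow> harr A g y z \<Longrightarrow> mh m (Cmp (HC A) f g) = Cmp (HC B) (mh m f) (mh m g)"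
  by (auto simp: dfun_def is_functor_def harr_def)

lemma dfun_vcomp: "dfun A B m \<Longrightarrow> varr A f x y \<Longrightarrow> varr A g y z \<Longrightarrow> mv m (Cmp (VC A) f g) = Cmp (VC B) (mv m f) (mv m g)"
  by (auto simp: dfun_def is_functor_def varr_def)

lemma dfun_beside: "dfun A B m \<Longrightarrow> sq A \<alpha> t b l c \<Longrightarrow> sq A \<beta> t' b' c r \<Longrightarrow> ms m (beside A \<alpha> \<beta>) = beside B (ms m \<alpha>) (ms m \<beta>)"
  by (auto simp: dfun_def is_functor_def sq_def)

lemma dfun_above: "dfun A B m \<Longrightarrow> sq A \<alpha> t c l r \<Longrightarrow> sq A \<beta> c b l' r' \<Longrightarrow> ms m (above A \<alpha> \<beta>) = above B (ms m \<alpha>) (ms m \<beta>)"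
  by (auto simp: dfun_def is_functor_def sq_def double_category_def)

lemma dfun_hid: "dfun A B m \<Longrightarrow> x \<in> Ob (HC A) \<Longrightarrow> mh m (Idn (HC A) x) = Idn (HC B) (mo m x)"
  by (auto simp: dfun_def is_functor_def)

lemma dfun_vid: "dfun A B m \<Longrightarrow> x \<in> Ob (HC A) \<Longrightarrow> mv m (Idn (VC A) x) = Idn (VC B) (mo m x)"
  by (auto simp: dfun_def is_functor_def double_category_def)

lemma dfun_esq: "dfun A B m \<Longrightarrow> harr A f x y \<Longrightarrow> ms m (esq A f) = esq B (mh m f)"
  by (auto simp: dfun_def is_functor_def double_category_def harr_def)

lemma dfun_idsq: "dfun A B m \<Longrightarrow> varr A f x y \<Longrightarrow> ms m (idsq A f) = idsq B (mv m f)"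
  by (auto simp: dfun_def is_functor_def double_category_def varr_def)

lemma is_functor_comp:
  "is_functor C D Fo Fm \<Longrightarrow> is_functor D E Go Gm \<Longrightarrow> is_functor C E (\<lambda>x. Go (Fo x)) (\<lambda>x. Gm (Fm x))"
  by (simp add: is_functor_def)

lemma dfun_mcomp: "dfun A B m \<Longrightarrow> dfun B C n \<Longrightarrow> dfun A C (mcomp m n)"
  by (auto simp: dfun_def mcomp_def intro: is_functor_comp)

lemma is_functor_cong:
  assumes "category C" "is_functor C D Fo Fm" "\<forall>x\<in>Ob C. Fo x = Go x" "\<forall>x\<in>Ar C. Fm x = Gm x"
  shows "is_functor C D Go Gm"
  using assms(2-) category_Dm_Cd[OF assms(1)] category_Idn[OF assms(1)] category_Cmp[OF assms(1)]
  unfolding is_functor_def by simp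

lemma dfun_meq:
  assumes "dfun A B m" "meq A m n" shows "dfun A B n"
proof -
  interpret A: dcat A using dfun_dcat(1)[OF assms(1)] .
  have "is_functor (HC A) (HC B) (mo n) (mh n)" "is_functor (VC A) (VC B) (mo n) (mv n)"
    "is_functor (HS A) (HS B) (mv n) (ms n)" "is_functor (VS A) (VS B) (mh n) (ms n)"
    using assms unfolding dfun_def meq_def
    by (auto intro!: is_functor_cong[of "HC A" "HC B" "mo m" "mh m"] is_functor_cong[of "VC A" "VC B" "mo m" "mv m"]
       is_functor_cong[of "HS A" "HS B" "mv m" "ms m"] is_functor_cong[of "VS A" "VS B" "mh m" "ms m"] simp: A.cats A.obs)
  then show ?thesis using assms(1) by (simp add: dfun_def)
qed

section \<open>Canonical trivial fibrations: lifting cells, and descent of maps along them\<close>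

definition dctf :: "'u dblcat \<Rightarrow> 'u dblcat \<Rightarrow> 'u cellmap \<Rightarrow> bool" where
  "dctf A B m \<longleftrightarrow> dfun A B m \<and>
     (\<forall>y\<in>Ob (HC B). \<exists>x\<in>Ob (HC A). mo m x = y) \<and>
     (\<forall>x\<in>Ob (HC A). \<forall>y\<in>Ob (HC A). \<forall>g. harr B g (mo m x) (mo m y) \<longrightarrow> (\<exists>f. harr A f x y \<and> mh m f = g)) \<and>
     (\<forall>x\<in>Ob (HC A). \<forall>y\<in>Ob (HC A). \<forall>g. varr B g (mo m x) (mo m y) \<longrightarrow> (\<exists>f. varr A f x y \<and> mv m f = g)) \<and>
     (\<forall>x y x' y' t b l r \<sigma>. harr A t x y \<longrightarrow> harr A b x' y' \<longrightarrow> varr A l x x' \<longrightarrow> varr A r y y' \<longrightarrow>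
        sq B \<sigma> (mh m t) (mh m b) (mv m l) (mv m r) \<longrightarrow> (\<exists>!\<alpha>. sq A \<alpha> t b l r \<and> ms m \<alpha> = \<sigma>))"

lemma dctf_dfun: "dctf A B m \<Longrightarrow> dfun A B m"
  by (simp add: dctf_def)

lemma dctf_ob: assumes "dctf A B m" "y \<in> Ob (HC B)" obtains x where "x \<in> Ob (HC A)" "mo m x = y"
  using assms unfolding dctf_def by blast

lemma dctf_h: assumes "dctf A B m" "harr B g (mo m x) (mo m y)" "x \<in> Ob (HC A)" "y \<in> Ob (HC A)"
  obtains f where "harr A f x y" "mh m f = g"
proof -
  have "\<forall>x\<in>Ob (HC A). \<forall>y\<in>Ob (HC A). \<forall>g. harr B g (mo m x) (mo m y) \<longrightarrow> (\<exists>f. harr A f x y \<and> mh m f = g)"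
    using assms(1) unfolding dctf_def by (elim conjE)
  then show ?thesis using assms that by blast
qed

lemma dctf_v: assumes "dctf A B m" "varr B g (mo m x) (mo m y)" "x \<in> Ob (HC A)" "y \<in> Ob (HC A)"
  obtains f where "varr A f x y" "mv m f = g"
proof -
  have "\<forall>x\<in>Ob (HC A). \<forall>y\<in>Ob (HC A). \<forall>g. varr B g (mo m x) (mo m y) \<longrightarrow> (\<exists>f. varr A f x y \<and> mv m f = g)"
    using assms(1) unfolding dctf_def by (elim conjE)
  then show ?thesis using assms that by blast
qed

lemma dctf_sq_ex1: assumes "dctf A B m" "sq B \<sigma> (mh m t) (mh m b) (mv m l) (mv m r)"
    "harr A t x y" "harr A b x' y'" "varr A l x x'" "varr A r y y'"
  shows "\<exists>!\<alpha>. sq A \<alpha> t b l r \<and> ms m \<alpha> = \<sigma>"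
  using assms unfolding dctf_def by (elim conjE) presburger

lemma dctf_sq: assumes "dctf A B m" "sq B \<sigma> (mh m t) (mh m b) (mv m l) (mv m r)"
    "harr A t x y" "harr A b x' y'" "varr A l x x'" "varr A r y y'"
  obtains \<alpha> where "sq A \<alpha> t b l r" "ms m \<alpha> = \<sigma>"
  using dctf_sq_ex1[OF assms] by blast

lemma dctf_sq_inj: assumes "dctf A B m" "sq A \<alpha> t b l r" "sq A \<beta> t b l r" "ms m \<alpha> = ms m \<beta>" shows "\<alpha> = \<beta>"
proof -
  interpret A: dcat A using dfun_dcat[OF dctf_dfun[OF assms(1)]] by simp
  have "\<exists>!\<gamma>. sq A \<gamma> t b l r \<and> ms m \<gamma> = ms m \<beta>"
    by (rule dctf_sq_ex1[OF assms(1) dfun_sq[OF dctf_dfun[OF assms(1)] assms(3)] A.sq_corners[OF assms(2)]])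
  then show ?thesis using assms(2-4) by blast
qed

lemma dctf_transpose:
  assumes "dctf A B m" shows "dctf (transpose A) (transpose B) (mtranspose m)"
proof -
  have dc: "double_category A" "double_category B" using dfun_dc[OF dctf_dfun[OF assms]] .
  have ob: "Ob (VC A) = Ob (HC A)" "Ob (VC B) = Ob (HC B)" using dc by (simp_all add: double_category_def)
  have "\<exists>!\<alpha>. sq A \<alpha> l r t b \<and> ms m \<alpha> = \<sigma>"
    if "varr A t x y" "varr A b x' y'" "harr A l x x'" "harr A r y y'" "sq B \<sigma> (mh m l) (mh m r) (mv m t) (mv m b)"
    for x y x' y' t b l r \<sigma>
    using dctf_sq_ex1[OF assms that(5,3,4,1,2)] .
  then show ?thesis
    using assms dfun_transpose[of A B m] unfolding dctf_def
    by (simp add: ob sq_transpose[OF dc(1)] sq_transpose[OF dc(2)])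
qed

lemma dctf_mcomp: assumes "dctf A B m" "dctf B C n" shows "dctf A C (mcomp m n)"
proof -
  note d = dctf_dfun[OF assms(1)] and e = dctf_dfun[OF assms(2)]
  have 1: "\<exists>x\<in>Ob (HC A). mo n (mo m x) = z" if "z \<in> Ob (HC C)" for z
    using dctf_ob[OF assms(2) that] dctf_ob[OF assms(1)] by metis
  have 2: "\<exists>f. harr A f x y \<and> mh n (mh m f) = g" if "x \<in> Ob (HC A)" "y \<in> Ob (HC A)" "harr C g (mo n (mo m x)) (mo n (mo m y))" for x y g
    using dctf_h[OF assms(2) that(3) dfun_ob[OF d that(1)] dfun_ob[OF d that(2)]] dctf_h[OF assms(1) _ that(1,2)] by metis
  have 3: "\<exists>f. varr A f x y \<and> mv n (mv m f) = g" if "x \<in> Ob (HC A)" "y \<in> Ob (HC A)" "varr C g (mo n (mo m x)) (mo n (mo m y))" for x y g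
    using dctf_v[OF assms(2) that(3) dfun_ob[OF d that(1)] dfun_ob[OF d that(2)]] dctf_v[OF assms(1) _ that(1,2)] by metis
  have 4: "\<exists>!\<alpha>. sq A \<alpha> t b l r \<and> ms n (ms m \<alpha>) = \<sigma>"
    if h: "harr A t x y" "harr A b x' y'" "varr A l x x'" "varr A r y y'" 
      and s: "sq C \<sigma> (mh n (mh m t)) (mh n (mh m b)) (mv n (mv m l)) (mv n (mv m r))" for x y x' y' t b l r \<sigma>
  proof -
    obtain \<beta> where \<beta>: "sq B \<beta> (mh m t) (mh m b) (mv m l) (mv m r)" "ms n \<beta> = \<sigma>"
      using dctf_sq[OF assms(2) s dfun_harr[OF d h(1)] dfun_harr[OF d h(2)] dfun_varr[OF d h(3)] dfun_varr[OF d h(4)]] .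
    obtain \<alpha> where \<alpha>: "sq A \<alpha> t b l r" "ms m \<alpha> = \<beta>"
      using dctf_sq[OF assms(1) \<beta>(1) h] .
    show ?thesis
    proof (rule ex1I)
      show "sq A \<alpha> t b l r \<and> ms n (ms m \<alpha>) = \<sigma>" using \<alpha> \<beta> by simp
    next
      fix \<alpha>' assume *: "sq A \<alpha>' t b l r \<and> ms n (ms m \<alpha>') = \<sigma>"
      have "ms m \<alpha>' = ms m \<alpha>"
        using dctf_sq_inj[OF assms(2) dfun_sq[OF d] dfun_sq[OF d]] * \<alpha> \<beta> by metis
      then show "\<alpha>' = \<alpha>" using dctf_sq_inj[OF assms(1)] * \<alpha> by metis
    qed
  qed
  show ?thesis
    unfolding dctf_def mcomp_sel
    by (intro conjI ballI allI impI dfun_mcomp[OF d e] 1 2 3) (assumption | rule 4)+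
qed

text \<open>For an arrow or square without prescribed boundary the lift is built in stages: corners
  first, then sides between the chosen corners by fullness, then the square.\<close>

lemma dctf_lifts:
  assumes "dctf A B m"
  shows "f \<in> Ar (HC B) \<Longrightarrow> \<exists>g\<in>Ar (HC A). mh m g = f"
    and "u \<in> Ar (VC B) \<Longrightarrow> \<exists>g\<in>Ar (VC A). mv m g = u"
    and "\<alpha> \<in> Sq B \<Longrightarrow> \<exists>\<beta>\<in>Sq A. ms m \<beta> = \<alpha>"
proof -
  interpret B: dcat B using dfun_dcat[OF dctf_dfun[OF assms]] by simp
  show 1: "\<exists>g\<in>Ar (HC A). mh m g = f" if "f \<in> Ar (HC B)" for f
  proof -
    have f: "harr B f (Dm (HC B) f) (Cd (HC B) f)" using that by (simp add: harr_def)
    obtain x where x: "x \<in> Ob (HC A)" "mo m x = Dm (HC B) f"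
      using dctf_ob[OF assms B.harr_ob(1)[OF f]] .
    obtain y where y: "y \<in> Ob (HC A)" "mo m y = Cd (HC B) f"
      using dctf_ob[OF assms B.harr_ob(2)[OF f]] .
    obtain g where "harr A g x y" "mh m g = f"
      using dctf_h[OF assms, of f x y] f x y by auto
    then show ?thesis by (auto simp: harr_def)
  qed
  show 2: "\<exists>g\<in>Ar (VC A). mv m g = f" if "f \<in> Ar (VC B)" for f
  proof -
    have f: "varr B f (Dm (VC B) f) (Cd (VC B) f)" using that by (simp add: varr_def)
    obtain x where x: "x \<in> Ob (HC A)" "mo m x = Dm (VC B) f"
      using dctf_ob[OF assms B.varr_ob(1)[OF f]] .
    obtain y where y: "y \<in> Ob (HC A)" "mo m y = Cd (VC B) f"
      using dctf_ob[OF assms B.varr_ob(2)[OF f]] .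
    obtain g where "varr A g x y" "mv m g = f"
      using dctf_v[OF assms, of f x y] f x y by auto
    then show ?thesis by (auto simp: varr_def)
  qed
  show "\<exists>\<beta>\<in>Sq A. ms m \<beta> = \<alpha>" if "\<alpha> \<in> Sq B"
  proof -
    have s: "sq B \<alpha> (tp B \<alpha>) (bt B \<alpha>) (lft B \<alpha>) (rgt B \<alpha>)" using that by (simp add: sq_def)
    note c = B.sq_corners[OF s]
    obtain x where 1: "x \<in> Ob (HC A)" "mo m x = Dm (HC B) (tp B \<alpha>)"
      using dctf_ob[OF assms B.harr_ob(1)[OF c(1)]] .
    obtain y where 2: "y \<in> Ob (HC A)" "mo m y = Cd (HC B) (tp B \<alpha>)"
      using dctf_ob[OF assms B.harr_ob(2)[OF c(1)]] .
    obtain x' where 3: "x' \<in> Ob (HC A)" "mo m x' = Dm (HC B) (bt B \<alpha>)"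
      using dctf_ob[OF assms B.harr_ob(1)[OF c(2)]] .
    obtain y' where 4: "y' \<in> Ob (HC A)" "mo m y' = Cd (HC B) (bt B \<alpha>)"
      using dctf_ob[OF assms B.harr_ob(2)[OF c(2)]] .
    note x = 1 2 3 4
    obtain t where t: "harr A t x y" "mh m t = tp B \<alpha>" using dctf_h[OF assms, of "tp B \<alpha>" x y] c(1) x by auto
    obtain b where b: "harr A b x' y'" "mh m b = bt B \<alpha>" using dctf_h[OF assms, of "bt B \<alpha>" x' y'] c(2) x by auto
    obtain l where l: "varr A l x x'" "mv m l = lft B \<alpha>" using dctf_v[OF assms, of "lft B \<alpha>" x x'] c(3) x by auto
    obtain r where r: "varr A r y y'" "mv m r = rgt B \<alpha>" using dctf_v[OF assms, of "rgt B \<alpha>" y y'] c(4) x by auto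
    obtain \<beta> where "sq A \<beta> t b l r" "ms m \<beta> = \<alpha>"
      using dctf_sq[OF assms _ t(1) b(1) l(1) r(1), of \<alpha>] s t b l r by auto
    then show ?thesis by (auto simp: sq_def)
  qed
qed

text \<open>The delicate hypothesis is the last one. Preserving a composite needs a composable pair
  of lifts, whereas surjectivity on arrows alone gives lifts whose inner ends differ.\<close>

lemma functor_descend:
  assumes "category C" "is_functor C D Fo Fm" "is_functor C E Io Im"
    and o: "\<And>a. a \<in> Ob C \<Longrightarrow> Jo (Fo a) = Io a" and m: "\<And>f. f \<in> Ar C \<Longrightarrow> Jm (Fm f) = Im f"
    and so: "\<And>b. b \<in> Ob D \<Longrightarrow> \<exists>a\<in>Ob C. Fo a = b" and sm: "\<And>g. g \<in> Ar D \<Longrightarrow> \<exists>f\<in>Ar C. Fm f = g"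
    and sc: "\<And>g g'. g \<in> Ar D \<Longrightarrow> g' \<in> Ar D \<Longrightarrow> Cd D g = Dm D g' \<Longrightarrow>
      \<exists>f\<in>Ar C. \<exists>f'\<in>Ar C. Fm f = g \<and> Fm f' = g' \<and> Cd C f = Dm C f'"
  shows "is_functor D E Jo Jm"
proof -
  have F: "\<And>a. a \<in> Ob C \<Longrightarrow> Fo a \<in> Ob D \<and> Fm (Idn C a) = Idn D (Fo a)"
    "\<And>f. f \<in> Ar C \<Longrightarrow> Fm f \<in> Ar D \<and> Dm D (Fm f) = Fo (Dm C f) \<and> Cd D (Fm f) = Fo (Cd C f)"
    "\<And>f g. f \<in> Ar C \<Longrightarrow> g \<in> Ar C \<Longrightarrow> Cd C f = Dm C g \<Longrightarrow> Fm (Cmp C f g) = Cmp D (Fm f) (Fm g)"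
    using assms(2) by (auto simp: is_functor_def)
  have I: "\<And>a. a \<in> Ob C \<Longrightarrow> Io a \<in> Ob E \<and> Im (Idn C a) = Idn E (Io a)"
    "\<And>f. f \<in> Ar C \<Longrightarrow> Im f \<in> Ar E \<and> Dm E (Im f) = Io (Dm C f) \<and> Cd E (Im f) = Io (Cd C f)"
    "\<And>f g. f \<in> Ar C \<Longrightarrow> g \<in> Ar C \<Longrightarrow> Cd C f = Dm C g \<Longrightarrow> Im (Cmp C f g) = Cmp E (Im f) (Im g)"
    using assms(3) by (auto simp: is_functor_def)
  have 1: "Jo b \<in> Ob E \<and> Jm (Idn D b) = Idn E (Jo b)" if "b \<in> Ob D" for b
  proof -
    obtain a where a: "a \<in> Ob C" "b = Fo a" using so \<open>b \<in> Ob D\<close> by blast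
    then show ?thesis using F(1)[OF a(1)] I(1)[OF a(1)] o[OF a(1)] m[of "Idn C a"] category_Idn[OF assms(1) a(1)] by simp
  qed
  have 2: "Jm g \<in> Ar E \<and> Dm E (Jm g) = Jo (Dm D g) \<and> Cd E (Jm g) = Jo (Cd D g)" if "g \<in> Ar D" for g
  proof -
    obtain f where a: "f \<in> Ar C" "g = Fm f" using sm \<open>g \<in> Ar D\<close> by blast
    then show ?thesis using F(2)[OF a(1)] I(2)[OF a(1)] m[OF a(1)] o category_Dm_Cd[OF assms(1) a(1)] by simp
  qed
  have 3: "Jm (Cmp D g g') = Cmp E (Jm g) (Jm g')" if gg: "g \<in> Ar D" "g' \<in> Ar D" "Cd D g = Dm D g'" for g g'
  proof -
    obtain f f' where a: "f \<in> Ar C" "f' \<in> Ar C" "g = Fm f" "g' = Fm f'" "Cd C f = Dm C f'" using sc[OF gg] by blast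
    then show ?thesis using F(3)[OF a(1,2,5)] I(3)[OF a(1,2,5)] m[OF a(1)] m[OF a(2)] m[of "Cmp C f f'"] category_Cmp[OF assms(1) a(1,2,5)] by simp
  qed
  show ?thesis unfolding is_functor_def using 1 2 3 by blast
qed

text \<open>Fullness allows the second lift to start at the codomain of the first.\<close>

lemma dctf_composable_h:
  assumes "dctf A B m" and g: "g \<in> Ar (HC B)" "g' \<in> Ar (HC B)" "Cd (HC B) g = Dm (HC B) g'"
  shows "\<exists>f\<in>Ar (HC A). \<exists>f'\<in>Ar (HC A). mh m f = g \<and> mh m f' = g' \<and> Cd (HC A) f = Dm (HC A) f'"
proof -
  interpret B: dcat B using dfun_dcat[OF dctf_dfun[OF assms(1)]] by simp
  interpret A: dcat A using dfun_dcat[OF dctf_dfun[OF assms(1)]] by simp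
  obtain f where f: "f \<in> Ar (HC A)" "mh m f = g" using dctf_lifts(1)[OF assms(1) g(1)] by blast
  then have f': "harr A f (Dm (HC A) f) (Cd (HC A) f)" by (simp add: harr_def)
  note mf = dfun_harr[OF dctf_dfun[OF assms(1)] f']
  have g': "harr B g' (mo m (Cd (HC A) f)) (Cd (HC B) g')" using mf f g by (simp add: harr_def)
  obtain z where z: "z \<in> Ob (HC A)" "mo m z = Cd (HC B) g'" using dctf_ob[OF assms(1) B.harr_ob(2)[OF g']] .
  obtain h where "harr A h (Cd (HC A) f) z" "mh m h = g'"
    using dctf_h[OF assms(1) _ A.harr_ob(2)[OF f'] z(1)] g' z by metis
  then show ?thesis using f unfolding harr_def by metis
qed

text \<open>The right side of the first lift is taken as left side of the second. This fixes two
  corners; the other two, then top, bottom and right side, are lifted before the square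
  itself.\<close>

lemma dctf_composable_beside:
  assumes "dctf A B m" and g: "\<alpha> \<in> Sq B" "\<beta> \<in> Sq B" "rgt B \<alpha> = lft B \<beta>"
  shows "\<exists>f\<in>Sq A. \<exists>f'\<in>Sq A. ms m f = \<alpha> \<and> ms m f' = \<beta> \<and> rgt A f = lft A f'"
proof -
  interpret B: dcat B using dfun_dcat[OF dctf_dfun[OF assms(1)]] by simp
  interpret A: dcat A using dfun_dcat[OF dctf_dfun[OF assms(1)]] by simp
  obtain f where f: "f \<in> Sq A" "ms m f = \<alpha>" using dctf_lifts(3)[OF assms(1) g(1)] by blast
  then have f': "sq A f (tp A f) (bt A f) (lft A f) (rgt A f)" by (simp add: sq_def)
  have "sq B \<alpha> (mh m (tp A f)) (mh m (bt A f)) (mv m (lft A f)) (mv m (rgt A f))"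
    using dfun_sq[OF dctf_dfun[OF assms(1)] f'] f(2) by simp
  then have b: "sq B \<beta> (tp B \<beta>) (bt B \<beta>) (mv m (rgt A f)) (rgt B \<beta>)" using g by (simp add: sq_def)
  define x where "x = Cd (HC A) (tp A f)"
  define x' where "x' = Cd (HC A) (bt A f)"
  have l: "varr A (rgt A f) x x'" using A.sq_corners(4)[OF f'] by (simp add: x_def x'_def)
  note bl = B.sq_corners[OF b]
  have d: "Dm (HC B) (tp B \<beta>) = mo m x" "Dm (HC B) (bt B \<beta>) = mo m x'"
    using bl(3) dfun_varr[OF dctf_dfun[OF assms(1)] l] by (simp_all add: varr_def)
  obtain z where z: "z \<in> Ob (HC A)" "mo m z = Cd (HC B) (tp B \<beta>)" using dctf_ob[OF assms(1) B.harr_ob(2)[OF bl(1)]] .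
  obtain z' where z': "z' \<in> Ob (HC A)" "mo m z' = Cd (HC B) (bt B \<beta>)" using dctf_ob[OF assms(1) B.harr_ob(2)[OF bl(2)]] .
  obtain t where t: "harr A t x z" "mh m t = tp B \<beta>"
    using dctf_h[OF assms(1) _ A.varr_ob(1)[OF l] z(1), of "tp B \<beta>"] bl(1) z d by auto
  obtain t' where t': "harr A t' x' z'" "mh m t' = bt B \<beta>"
    using dctf_h[OF assms(1) _ A.varr_ob(2)[OF l] z'(1), of "bt B \<beta>"] bl(2) z' d by auto
  obtain r where r: "varr A r z z'" "mv m r = rgt B \<beta>"
    using dctf_v[OF assms(1) _ z(1) z'(1), of "rgt B \<beta>"] bl(4) z z' by auto
  obtain \<gamma> where "sq A \<gamma> t t' (rgt A f) r" "ms m \<gamma> = \<beta>"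
    using dctf_sq[OF assms(1) _ t(1) t'(1) l r(1), of \<beta>] b t t' r by auto
  then show ?thesis using f unfolding sq_def by metis
qed

text \<open>The kernel condition under which \<open>I\<close> factors through a surjective
  \<open>F\<close>.\<close>

definition mconst :: "'u dblcat \<Rightarrow> 'u cellmap \<Rightarrow> 'u cellmap \<Rightarrow> bool" where
  "mconst A F I \<longleftrightarrow> (\<forall>x\<in>Ob (HC A). \<forall>y\<in>Ob (HC A). mo F x = mo F y \<longrightarrow> mo I x = mo I y) \<and>
     (\<forall>x\<in>Ar (HC A). \<forall>y\<in>Ar (HC A). mh F x = mh F y \<longrightarrow> mh I x = mh I y) \<and>
     (\<forall>x\<in>Ar (VC A). \<forall>y\<in>Ar (VC A). mv F x = mv F y \<longrightarrow> mv I x = mv I y) \<and>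
     (\<forall>x\<in>Sq A. \<forall>y\<in>Sq A. ms F x = ms F y \<longrightarrow> ms I x = ms I y)"

lemma mconst_D: assumes "mconst A F I"
  shows "\<And>x y. x \<in> Ob (HC A) \<Longrightarrow> y \<in> Ob (HC A) \<Longrightarrow> mo F x = mo F y \<Longrightarrow> mo I x = mo I y"
   "\<And>x y. x \<in> Ar (HC A) \<Longrightarrow> y \<in> Ar (HC A) \<Longrightarrow> mh F x = mh F y \<Longrightarrow> mh I x = mh I y"
   "\<And>x y. x \<in> Ar (VC A) \<Longrightarrow> y \<in> Ar (VC A) \<Longrightarrow> mv F x = mv F y \<Longrightarrow> mv I x = mv I y"
   "\<And>x y. x \<in> Sq A \<Longrightarrow> y \<in> Sq A \<Longrightarrow> ms F x = ms F y \<Longrightarrow> ms I x = ms I y"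
  using assms unfolding mconst_def by (elim conjE, blast)+

lemma fibre_some:
  assumes "\<And>x y. x \<in> S \<Longrightarrow> y \<in> S \<Longrightarrow> F x = F y \<Longrightarrow> I x = I y" "x \<in> S"
  shows "I (SOME y. y \<in> S \<and> F y = F x) = I x"
  by (rule someI2[of _ x]) (use assms in blast)+

lemma dctf_descend:
  assumes F: "dctf A B F" and I: "dfun A W I" and c: "mconst A F I"
  obtains J where "dfun B W J" "meq A (mcomp F J) I"
proof -
  note c' = mconst_D[OF c]
  note dF = dctf_dfun[OF F]
  interpret A: dcat A using dfun_dcat[OF I] by simp
  have tF: "dctf (transpose A) (transpose B) (mtranspose F)" using dctf_transpose[OF F] .
  have obB: "Ob (VC B) = Ob (HC B)" "Ob (HS B) = Ar (VC B)" "Ob (VS B) = Ar (HC B)" "Ar (VS B) = Ar (HS B)"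
    using dcat.obs[OF dfun_dcat(2)[OF dF]] .
  define J where "J = \<lparr> mo = (\<lambda>y. mo I (SOME x. x \<in> Ob (HC A) \<and> mo F x = y)),
     mh = (\<lambda>y. mh I (SOME x. x \<in> Ar (HC A) \<and> mh F x = y)),
     mv = (\<lambda>y. mv I (SOME x. x \<in> Ar (VC A) \<and> mv F x = y)),
     ms = (\<lambda>y. ms I (SOME x. x \<in> Sq A \<and> ms F x = y)) \<rparr>"
  have J: "mo J (mo F x) = mo I x" if "x \<in> Ob (HC A)" for x
    unfolding J_def cellmap.simps by (rule fibre_some[of "Ob (HC A)" "mo F" "mo I", OF c'(1) that])
  moreover have "mh J (mh F x) = mh I x" if "x \<in> Ar (HC A)" for x
    unfolding J_def cellmap.simps by (rule fibre_some[of "Ar (HC A)" "mh F" "mh I", OF c'(2) that])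
  moreover have "mv J (mv F x) = mv I x" if "x \<in> Ar (VC A)" for x
    unfolding J_def cellmap.simps by (rule fibre_some[of "Ar (VC A)" "mv F" "mv I", OF c'(3) that])
  moreover have "ms J (ms F x) = ms I x" if "x \<in> Sq A" for x
    unfolding J_def cellmap.simps by (rule fibre_some[of "Sq A" "ms F" "ms I", OF c'(4) that])
  ultimately have eq: "meq A (mcomp F J) I" by (simp add: meq_def)
  note e = eq[unfolded meq_def mcomp_sel, THEN conjunct1, rule_format] 
    eq[unfolded meq_def mcomp_sel, THEN conjunct2, THEN conjunct1, rule_format]
    eq[unfolded meq_def mcomp_sel, THEN conjunct2, THEN conjunct2, THEN conjunct1, rule_format]
    eq[unfolded meq_def mcomp_sel, THEN conjunct2, THEN conjunct2, THEN conjunct2, rule_format]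
  note l = dctf_lifts[OF F]
  have lo: "\<exists>x\<in>Ob (HC A). mo F x = y" if "y \<in> Ob (HC B)" for y using dctf_ob[OF F that] by metis
  have "is_functor (HC B) (HC W) (mo J) (mh J)"
    by (rule functor_descend[OF A.cats(1), where Fo="mo F" and Fm="mh F" and Io="mo I" and Im="mh I"])
      (use dF I e lo l dctf_composable_h[OF F] in \<open>simp_all add: dfun_def\<close>)
  \<comment> \<open>Composable vertical arrows are lifted by the horizontal lemma for the transpose
    \<open>tF\<close>; likewise for \<open>VS\<close> below.\<close>
  moreover have "is_functor (VC B) (VC W) (mo J) (mv J)"
    by (rule functor_descend[OF A.cats(2), where Fo="mo F" and Fm="mv F" and Io="mo I" and Im="mv I"])
      (use dF I e lo l dctf_composable_h[OF tF] in \<open>simp_all add: dfun_def A.obs obB\<close>)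
  moreover have "is_functor (HS B) (HS W) (mv J) (ms J)"
    by (rule functor_descend[OF A.cats(3), where Fo="mv F" and Fm="ms F" and Io="mv I" and Im="ms I"])
      (use dF I e lo l dctf_composable_beside[OF F] in \<open>simp_all add: dfun_def A.obs obB\<close>)
  moreover have "is_functor (VS B) (VS W) (mh J) (ms J)"
    by (rule functor_descend[OF A.cats(4), where Fo="mh F" and Fm="ms F" and Io="mh I" and Im="ms I"])
      (use dF I e lo l dctf_composable_beside[OF tF] in \<open>simp_all add: dfun_def A.obs obB\<close>)
  ultimately have "dfun B W J" using dF I by (simp add: dfun_def)
  then show ?thesis using eq that by blast
qed

section \<open>Double categories of normal forms\<close>

text \<open>The condition on composites makes \<open>nm (Cmp C f g)\<close> an associative composition of normal forms.\<close>

definition ncat :: "('o, 'm) category \<Rightarrow> ('o \<Rightarrow> 'o) \<Rightarrow> ('m \<Rightarrow> 'm) \<Rightarrow> bool" where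
  "ncat C no nm \<longleftrightarrow> (\<forall>a\<in>Ob C. no a \<in> Ob C \<and> no (no a) = no a \<and> nm (Idn C a) = Idn C (no a)) \<and>
    (\<forall>f\<in>Ar C. nm f \<in> Ar C \<and> Dm C (nm f) = no (Dm C f) \<and> Cd C (nm f) = no (Cd C f) \<and> nm (nm f) = nm f) \<and>
    (\<forall>f\<in>Ar C. \<forall>g\<in>Ar C. Cd C f = Dm C g \<longrightarrow> nm (Cmp C (nm f) (nm g)) = nm (Cmp C f g))"

text \<open>A quotient of \<open>C\<close> realised on representatives, so that equivalence classes
  need no code.\<close>

definition fixcat :: "('o, 'm) category \<Rightarrow> ('o \<Rightarrow> 'o) \<Rightarrow> ('m \<Rightarrow> 'm) \<Rightarrow> ('o, 'm) category" where
  "fixcat C no nm = \<lparr> Ob = no ` Ob C, Ar = nm ` Ar C, Dm = Dm C, Cd = Cd C, Idn = Idn C,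
     Cmp = (\<lambda>f g. nm (Cmp C f g)) \<rparr>"

lemma fixcat_sel [simp]:
  "Ob (fixcat C no nm) = no ` Ob C" "Ar (fixcat C no nm) = nm ` Ar C" "Dm (fixcat C no nm) = Dm C"
  "Cd (fixcat C no nm) = Cd C" "Idn (fixcat C no nm) = Idn C" "Cmp (fixcat C no nm) f g = nm (Cmp C f g)"
  by (simp_all add: fixcat_def)

lemma ncatD:
  assumes "ncat C no nm"
  shows "a \<in> Ob C \<Longrightarrow> no a \<in> Ob C" "a \<in> Ob C \<Longrightarrow> no (no a) = no a" "a \<in> Ob C \<Longrightarrow> nm (Idn C a) = Idn C (no a)"
    "f \<in> Ar C \<Longrightarrow> nm f \<in> Ar C" "f \<in> Ar C \<Longrightarrow> Dm C (nm f) = no (Dm C f)" "f \<in> Ar C \<Longrightarrow> Cd C (nm f) = no (Cd C f)"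
    "f \<in> Ar C \<Longrightarrow> nm (nm f) = nm f"
    "f \<in> Ar C \<Longrightarrow> g \<in> Ar C \<Longrightarrow> Cd C f = Dm C g \<Longrightarrow> nm (Cmp C (nm f) (nm g)) = nm (Cmp C f g)"
  using assms by (simp_all add: ncat_def)

lemma fixcat_in:
  assumes "ncat C no nm" 
  shows "a \<in> no ` Ob C \<longleftrightarrow> a \<in> Ob C \<and> no a = a" "f \<in> nm ` Ar C \<longleftrightarrow> f \<in> Ar C \<and> nm f = f"
  using ncatD[OF assms] by (auto, metis imageI, metis imageI)

text \<open>Associativity holds because normalising an inner composite is invisible under an outer
  \<open>nm\<close>: both bracketings are the normal form of the corresponding composite in
  \<open>C\<close>.\<close>

lemma fixcat_category:
  assumes C: "category C" and N: "ncat C no nm"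
  shows "category (fixcat C no nm)"
proof -
  note n = ncatD[OF N]
  have comp: "nm (Cmp C f g) \<in> Ar C \<and> nm (nm (Cmp C f g)) = nm (Cmp C f g) \<and> Dm C (nm (Cmp C f g)) = no (Dm C f) \<and> Cd C (nm (Cmp C f g)) = no (Cd C g)"
    if "f \<in> Ar C" "g \<in> Ar C" "Cd C f = Dm C g" for f g
    using n category_Cmp[OF C that] by simp
  have ob: "no (Dm C f) = Dm C f" "no (Cd C f) = Cd C f" if "f \<in> Ar C" "nm f = f" for f
    using n(5,6)[OF that(1)] that(2) by simp_all
  have assoc: "nm (Cmp C (nm (Cmp C f g)) h) = nm (Cmp C f (nm (Cmp C g h)))"
    if "f \<in> Ar C" "nm f = f" "g \<in> Ar C" "nm g = g" "h \<in> Ar C" "nm h = h" "Cd C f = Dm C g" "Cd C g = Dm C h" for f g h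
  proof -
    have fg: "Cmp C f g \<in> Ar C \<and> Dm C (Cmp C f g) = Dm C f \<and> Cd C (Cmp C f g) = Cd C g"
      and gh: "Cmp C g h \<in> Ar C \<and> Dm C (Cmp C g h) = Dm C g \<and> Cd C (Cmp C g h) = Cd C h"
      using category_Cmp[OF C] that by auto
    have "nm (Cmp C (nm (Cmp C f g)) h) = nm (Cmp C (Cmp C f g) h)"
      using n(8)[of "Cmp C f g" h] fg that by simp
    also have "\<dots> = nm (Cmp C f (Cmp C g h))" using category_assoc[OF C] that by simp
    also have "\<dots> = nm (Cmp C f (nm (Cmp C g h)))"
      using n(8)[of f "Cmp C g h"] gh that by simp
    finally show ?thesis .
  qed
  show ?thesis
    unfolding category_def fixcat_sel
  proof (intro conjI ballI impI)
    fix f assume "f \<in> nm ` Ar C" then have f: "f \<in> Ar C" "nm f = f" using fixcat_in[OF N] by auto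
    show "Dm C f \<in> no ` Ob C" "Cd C f \<in> no ` Ob C"
      using category_Dm_Cd[OF C f(1)] ob[OF f] by (simp_all add: fixcat_in[OF N])
    show "nm (Cmp C (Idn C (Dm C f)) f) = f" "nm (Cmp C f (Idn C (Cd C f))) = f"
      using category_unit[OF C f(1)] f by simp_all
  next
    fix a assume "a \<in> no ` Ob C" then have a: "a \<in> Ob C" "no a = a" using fixcat_in[OF N] by auto
    show "Idn C a \<in> nm ` Ar C" using category_Idn[OF C a(1)] n(3)[OF a(1)] a(2) by (simp add: fixcat_in[OF N])
    show "Dm C (Idn C a) = a" "Cd C (Idn C a) = a" using category_Idn[OF C a(1)] by auto
  next
    fix f g assume "f \<in> nm ` Ar C" "g \<in> nm ` Ar C" and c: "Cd C f = Dm C g"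
    then have fg: "f \<in> Ar C" "nm f = f" "g \<in> Ar C" "nm g = g" using fixcat_in[OF N] by auto
    show "nm (Cmp C f g) \<in> nm ` Ar C" "Dm C (nm (Cmp C f g)) = Dm C f" "Cd C (nm (Cmp C f g)) = Cd C g"
      using comp[OF fg(1,3) c] ob fg by (simp_all add: fixcat_in[OF N])
    fix h assume "h \<in> nm ` Ar C" and d: "Cd C g = Dm C h"
    then have h: "h \<in> Ar C" "nm h = h" using fixcat_in[OF N] by auto
    show "nm (Cmp C (nm (Cmp C f g)) h) = nm (Cmp C f (nm (Cmp C g h)))"
      by (rule assoc[OF fg h c d])
  qed
qed

lemma fixcat_functor: "category C \<Longrightarrow> ncat C no nm \<Longrightarrow> is_functor C (fixcat C no nm) no nm"
  by (auto simp: is_functor_def ncatD)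

text \<open>A functor that does not see \<open>nm\<close> cannot see the difference between the two
  compositions, so the same maps serve on fixed points.\<close>

lemma fixcat_functor_from:
  assumes "category C" "ncat C no nm" "is_functor C D Ko Km" "\<And>f. f \<in> Ar C \<Longrightarrow> Km (nm f) = Km f"
  shows "is_functor (fixcat C no nm) D Ko Km"
  using assms(3,4) category_Cmp[OF assms(1)] unfolding is_functor_def fixcat_sel
  by (simp add: fixcat_in[OF assms(2)])

definition normalizer :: "'u dblcat \<Rightarrow> 'u cellmap \<Rightarrow> bool" where
  "normalizer Z N \<longleftrightarrow> double_category Z \<and> ncat (HC Z) (mo N) (mh N) \<and> ncat (VC Z) (mo N) (mv N) \<and>
     ncat (HS Z) (mv N) (ms N) \<and> ncat (VS Z) (mh N) (ms N)"

definition fixdbl :: "'u dblcat \<Rightarrow> 'u cellmap \<Rightarrow> 'u dblcat" where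
  "fixdbl Z N = \<lparr> HC = fixcat (HC Z) (mo N) (mh N), VC = fixcat (VC Z) (mo N) (mv N),
     HS = fixcat (HS Z) (mv N) (ms N), VS = fixcat (VS Z) (mh N) (ms N) \<rparr>"

lemma fixdbl_sel [simp]: "HC (fixdbl Z N) = fixcat (HC Z) (mo N) (mh N)" "VC (fixdbl Z N) = fixcat (VC Z) (mo N) (mv N)"
  "HS (fixdbl Z N) = fixcat (HS Z) (mv N) (ms N)" "VS (fixdbl Z N) = fixcat (VS Z) (mh N) (ms N)"
  by (simp_all add: fixdbl_def)

lemma fixdbl_transpose: "fixdbl (transpose Z) (mtranspose N) = transpose (fixdbl Z N)"
  by (simp add: fixdbl_def transpose_def)

lemma normalizer_transpose: "normalizer Z N \<Longrightarrow> normalizer (transpose Z) (mtranspose N)"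
  by (simp add: normalizer_def dcat.double_category_transpose dcat_def)

text \<open>Interchange is the axiom that nests the two renormalised compositions. The outer
  \<open>ms N\<close> absorbs the inner ones, by the condition on \<open>VS Z\<close> for one
  pasting and by that on \<open>HS Z\<close> for the other, and interchange in \<open>Z\<close>
  remains.\<close>

lemma double_category_fixdbl:
  assumes "normalizer Z N" shows "double_category (fixdbl Z N)"
proof -
  interpret Z: dcat Z using assms by (simp add: dcat_def normalizer_def)
  note n = assms[unfolded normalizer_def]
  have N: "ncat (HC Z) (mo N) (mh N)" "ncat (VC Z) (mo N) (mv N)" "ncat (HS Z) (mv N) (ms N)" "ncat (VS Z) (mh N) (ms N)"
    using n by auto
  note i = fixcat_in(1)[OF N(1)] fixcat_in(2)[OF N(1)] fixcat_in(2)[OF N(2)] fixcat_in(2)[OF N(3)]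
  note d = ncatD[OF N(1)] ncatD[OF N(2)] ncatD[OF N(3)] ncatD[OF N(4), unfolded Z.obs]
  have sd: "tp Z (ms N \<alpha>) = mh N (tp Z \<alpha>)" "bt Z (ms N \<alpha>) = mh N (bt Z \<alpha>)" "lft Z (ms N \<alpha>) = mv N (lft Z \<alpha>)" "rgt Z (ms N \<alpha>) = mv N (rgt Z \<alpha>)"
     "ms N \<alpha> \<in> Sq Z" "ms N (ms N \<alpha>) = ms N \<alpha>" if "\<alpha> \<in> Sq Z" for \<alpha>
    using that ncatD(4-7)[OF N(3)] ncatD(4-7)[OF N(4), unfolded Z.obs] by simp_all
  have fx: "mh N (tp Z \<alpha>) = tp Z \<alpha>" "mh N (bt Z \<alpha>) = bt Z \<alpha>" "mv N (lft Z \<alpha>) = lft Z \<alpha>" "mv N (rgt Z \<alpha>) = rgt Z \<alpha>" if "\<alpha> \<in> Sq Z" "ms N \<alpha> = \<alpha>" for \<alpha>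
    using sd(1-4)[OF that(1)] that(2) by simp_all
  have fo: "mo N (Dm (HC Z) f) = Dm (HC Z) f" "mo N (Cd (HC Z) f) = Cd (HC Z) f" if "f \<in> Ar (HC Z)" "mh N f = f" for f
    using ncatD(5,6)[OF N(1) that(1)] that(2) by simp_all
  have fv: "mo N (Dm (VC Z) f) = Dm (VC Z) f" "mo N (Cd (VC Z) f) = Cd (VC Z) f" if "f \<in> Ar (VC Z)" "mv N f = f" for f
    using ncatD(5,6)[OF N(2) that(1)] that(2) by simp_all
  have sqc: "sq Z \<alpha> (tp Z \<alpha>) (bt Z \<alpha>) (lft Z \<alpha>) (rgt Z \<alpha>)" if "\<alpha> \<in> Sq Z" for \<alpha> using that by (simp add: sq_def)
  have besidein: "beside Z \<alpha> \<beta> \<in> Sq Z" if "\<alpha> \<in> Sq Z" "\<beta> \<in> Sq Z" "rgt Z \<alpha> = lft Z \<beta>" for \<alpha> \<beta>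
    using category_Cmp[OF Z.cats(3)] that by simp
  have abovein: "above Z \<alpha> \<beta> \<in> Sq Z" if "\<alpha> \<in> Sq Z" "\<beta> \<in> Sq Z" "bt Z \<alpha> = tp Z \<beta>" for \<alpha> \<beta>
    using category_Cmp[OF Z.cats(4)] that by (simp add: Z.obs)
  have 1: "is_functor (VS (fixdbl Z N)) (VC (fixdbl Z N)) (Dm (HC (fixdbl Z N))) (lft (fixdbl Z N))"
    unfolding is_functor_def fixdbl_sel fixcat_sel Z.obs
    using category_Dm_Cd[OF Z.cats(1)] Z.corners Z.above_sides sd fx fo Z.sq_esq abovein
    by (auto simp: i sq_def harr_def)
  have 2: "is_functor (VS (fixdbl Z N)) (VC (fixdbl Z N)) (Cd (HC (fixdbl Z N))) (rgt (fixdbl Z N))"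
    unfolding is_functor_def fixdbl_sel fixcat_sel Z.obs
    using category_Dm_Cd[OF Z.cats(1)] Z.corners Z.above_sides sd fx fo Z.sq_esq abovein
    by (auto simp: i sq_def harr_def)
  have 3: "is_functor (VC (fixdbl Z N)) (VS (fixdbl Z N)) (Idn (HC (fixdbl Z N))) (idsq (fixdbl Z N))"
  proof -
    have e: "ms N (idsq Z (mv N (Cmp (VC Z) f g))) = ms N (idsq Z (Cmp (VC Z) f g))" if "varr Z f x y" "varr Z g y z" for f g x y z
      using d(3) Z.varr_comp[OF that] ncatD(3,4,7)[OF N(3)] ncatD(4,7)[OF N(2)] by (simp add: Z.obs varr_def)
    show ?thesis
    unfolding is_functor_def fixdbl_sel fixcat_sel Z.obs
    proof (intro conjI ballI impI)
      fix a assume "a \<in> mo N ` Ob (HC Z)" then have a: "a \<in> Ob (HC Z)" "mo N a = a" using i by auto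
      show "Idn (HC Z) a \<in> mh N ` Ar (HC Z)" using category_Idn[OF Z.cats(1) a(1)] d(3)[OF a(1)] a i by auto
      show "idsq Z (Idn (VC Z) a) = esq Z (Idn (HC Z) a)" using Z.esq_Idn[OF a(1)] by simp
    next
      fix u assume "u \<in> mv N ` Ar (VC Z)" then have u: "u \<in> Ar (VC Z)" "mv N u = u" using i by auto
      then have s: "sq Z (idsq Z u) (Idn (HC Z) (Dm (VC Z) u)) (Idn (HC Z) (Cd (VC Z) u)) u u" using Z.sq_idsq by (simp add: varr_def)
      show "idsq Z u \<in> ms N ` Sq Z" using s ncatD(3)[OF N(3)] u i by (simp add: sq_def Z.obs)
      show "tp Z (idsq Z u) = Idn (HC Z) (Dm (VC Z) u)" "bt Z (idsq Z u) = Idn (HC Z) (Cd (VC Z) u)"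
        using s by (simp_all add: sq_def)
      fix v assume "v \<in> mv N ` Ar (VC Z)" and c: "Cd (VC Z) u = Dm (VC Z) v" 
      then have v: "v \<in> Ar (VC Z)" "mv N v = v" using i by auto
      have uv: "varr Z u (Dm (VC Z) u) (Cd (VC Z) u)" "varr Z v (Cd (VC Z) u) (Cd (VC Z) v)" using u v c by (simp_all add: varr_def)
      have w: "Cmp (VC Z) u v \<in> Ar (VC Z)" using Z.varr_comp[OF uv] by (simp add: varr_def)
      have "idsq Z (mv N (Cmp (VC Z) u v)) = ms N (idsq Z (Cmp (VC Z) u v))"
        using ncatD(3)[OF N(3)] w by (simp add: Z.obs)
      then show "idsq Z (mv N (Cmp (VC Z) u v)) = ms N (above Z (idsq Z u) (idsq Z v))"
        using Z.idsq_comp[OF uv] by simp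
    qed
  qed
  have 4: "tp Z (ms N (beside Z \<alpha> \<beta>)) = mh N (Cmp (HC Z) (tp Z \<alpha>) (tp Z \<beta>)) \<and>
      bt Z (ms N (beside Z \<alpha> \<beta>)) = mh N (Cmp (HC Z) (bt Z \<alpha>) (bt Z \<beta>))"
    if "\<alpha> \<in> Sq Z" "\<beta> \<in> Sq Z" "rgt Z \<alpha> = lft Z \<beta>" for \<alpha> \<beta>
    using sd besidein[OF that] Z.beside_sides[OF that] by simp
  have 5: "esq Z (mh N (Cmp (HC Z) f g)) = ms N (beside Z (esq Z f) (esq Z g))"
    if "f \<in> Ar (HC Z)" "g \<in> Ar (HC Z)" "Cd (HC Z) f = Dm (HC Z) g" for f g
  proof -
    have "esq Z (Cmp (HC Z) f g) = beside Z (esq Z f) (esq Z g)" using Z.esq_comp that by (simp add: harr_def)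
    then show ?thesis using ncatD(3)[OF N(4), of "Cmp (HC Z) f g"] category_Cmp[OF Z.cats(1) that] by (simp add: Z.obs)
  qed
  have 6: "ms N (above Z (ms N (beside Z \<alpha> \<beta>)) (ms N (beside Z \<gamma> \<delta>))) = ms N (beside Z (ms N (above Z \<alpha> \<gamma>)) (ms N (above Z \<beta> \<delta>)))"
    if s: "\<alpha> \<in> Sq Z" "\<beta> \<in> Sq Z" "\<gamma> \<in> Sq Z" "\<delta> \<in> Sq Z" and e: "rgt Z \<alpha> = lft Z \<beta>" "rgt Z \<gamma> = lft Z \<delta>" "bt Z \<alpha> = tp Z \<gamma>" "bt Z \<beta> = tp Z \<delta>" for \<alpha> \<beta> \<gamma> \<delta>
  proof -
    have "bt Z (beside Z \<alpha> \<beta>) = tp Z (beside Z \<gamma> \<delta>)" using Z.beside_sides s e by simp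
    then have "ms N (above Z (ms N (beside Z \<alpha> \<beta>)) (ms N (beside Z \<gamma> \<delta>))) = ms N (above Z (beside Z \<alpha> \<beta>) (beside Z \<gamma> \<delta>))"
      using ncatD(8)[OF N(4), unfolded Z.obs, of "beside Z \<alpha> \<beta>" "beside Z \<gamma> \<delta>"] besidein[OF s(1,2) e(1)] besidein[OF s(3,4) e(2)] by simp
    also have "\<dots> = ms N (beside Z (above Z \<alpha> \<gamma>) (above Z \<beta> \<delta>))"
      using Z.interchange[of \<alpha> "tp Z \<alpha>" "bt Z \<alpha>" "lft Z \<alpha>" "rgt Z \<alpha>" \<beta> "tp Z \<beta>" "bt Z \<beta>" "rgt Z \<beta>" \<gamma> "bt Z \<gamma>" "lft Z \<gamma>" "rgt Z \<gamma>" \<delta> "bt Z \<delta>" "rgt Z \<delta>"] s e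
      by (simp add: sq_def)
    also have "\<dots> = ms N (beside Z (ms N (above Z \<alpha> \<gamma>)) (ms N (above Z \<beta> \<delta>)))"
      using ncatD(8)[OF N(3), of "above Z \<alpha> \<gamma>" "above Z \<beta> \<delta>"] abovein[OF s(1,3) e(3)] abovein[OF s(2,4) e(4)] Z.above_sides s e by simp
    finally show ?thesis .
  qed
  show ?thesis
    unfolding double_category_def
  proof (intro conjI 1 2 3)
    show "category (HC (fixdbl Z N))" "category (VC (fixdbl Z N))" "category (HS (fixdbl Z N))" "category (VS (fixdbl Z N))"
      by (simp_all add: fixcat_category Z.cats N)
    show "Ob (VC (fixdbl Z N)) = Ob (HC (fixdbl Z N))" "Ob (HS (fixdbl Z N)) = Ar (VC (fixdbl Z N))"
      "Ob (VS (fixdbl Z N)) = Ar (HC (fixdbl Z N))" "Ar (VS (fixdbl Z N)) = Ar (HS (fixdbl Z N))" by (simp_all add: Z.obs)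
  qed (use 4 5 6 i in auto)
qed

lemma dfun_fixdbl: "normalizer Z N \<Longrightarrow> dfun Z (fixdbl Z N) N"
  using double_category_fixdbl[of Z N]
  by (auto simp: dfun_def normalizer_def double_category_def intro: fixcat_functor)

lemma dfun_from_fixdbl:
  assumes n: "normalizer Z N" and K: "dfun Z Y K" and eq: "meq Z (mcomp N K) K"
  shows "dfun (fixdbl Z N) Y K"
proof -
  have o: "Ar (VS Z) = Sq Z" using n by (simp add: normalizer_def double_category_def)
  then show ?thesis
  using double_category_fixdbl[OF n] assms unfolding dfun_def normalizer_def meq_def mcomp_sel fixdbl_sel
  by (auto intro!: fixcat_functor_from simp: double_category_def)
qed

section \<open>Normalisation by vertically invertible squares\<close>

context dcat
begin

text \<open>The mechanism by which conjugates compose: where two of them meet, an inverse pair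
  appears in the middle and disappears.\<close>

lemma varr_cancel:
  assumes p: "varr A p a x" and i: "varr A i x m" and j: "varr A j m x" and q: "varr A q x b"
    and e: "Cmp (VC A) i j = Idn (VC A) x"
  shows "Cmp (VC A) (Cmp (VC A) p i) (Cmp (VC A) j q) = Cmp (VC A) p q"
proof -
  have "Cmp (VC A) (Cmp (VC A) p i) (Cmp (VC A) j q) = Cmp (VC A) p (Cmp (VC A) i (Cmp (VC A) j q))"
    using varr_assoc[OF p i varr_comp[OF j q]] .
  also have "Cmp (VC A) i (Cmp (VC A) j q) = Cmp (VC A) (Cmp (VC A) i j) q"
    using varr_assoc[OF i j q] by simp
  also have "\<dots> = q" using varr_idl[OF q] e by simp
  finally show ?thesis .
qed

lemma above_cancel:
  assumes p: "sq A p t c l r" and i: "sq A i c m l1 r1" and j: "sq A j m c l2 r2" and q: "sq A q c b l3 r3"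
    and e: "above A i j = esq A c"
  shows "above A (above A p i) (above A j q) = above A p q"
proof -
  have "above A (above A p i) (above A j q) = above A p (above A i (above A j q))"
    using above_assoc[OF p i sq_above[OF j q]] .
  also have "above A i (above A j q) = above A (above A i j) q"
    using above_assoc[OF i j q] by simp
  also have "\<dots> = q" using esq_above[OF q] e by simp
  finally show ?thesis .
qed

lemma above_inverse_unique:
  assumes a: "sq A a t b l r" and x: "sq A x b t l' r'" and y: "sq A y b t l'' r''"
    and "above A a x = esq A t" "above A y a = esq A b"
  shows "x = y"
proof -
  have "x = above A (above A y a) x" using esq_above[OF x] assms(5) by simp
  also have "\<dots> = above A y (above A a x)" using above_assoc[OF y a x] .
  also have "\<dots> = y" using above_esq[OF y] assms(4) by simp
  finally show ?thesis .
qed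

end

text \<open>
  Conjugation by \<open>rho\<close> is strictly compatible with vertical composition; \<open>rho_comp\<close> is the coherence
  condition which makes it compatible with horizontal composition up to renormalisation.
\<close>

locale conj_data = dcat Z for Z :: "'u dblcat" +
  fixes n0 lam lami nH rho rhoi :: "'u \<Rightarrow> 'u"
  assumes n0: "x \<in> Ob (HC Z) \<Longrightarrow> n0 x \<in> Ob (HC Z)" "x \<in> Ob (HC Z) \<Longrightarrow> n0 (n0 x) = n0 x"
    and lam: "x \<in> Ob (HC Z) \<Longrightarrow> varr Z (lam x) (n0 x) x"
    and lami: "x \<in> Ob (HC Z) \<Longrightarrow> varr Z (lami x) x (n0 x)"
    and lam_lami: "x \<in> Ob (HC Z) \<Longrightarrow> Cmp (VC Z) (lam x) (lami x) = Idn (VC Z) (n0 x)"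
    and lami_lam: "x \<in> Ob (HC Z) \<Longrightarrow> Cmp (VC Z) (lami x) (lam x) = Idn (VC Z) x"
    and lam_n0: "x \<in> Ob (HC Z) \<Longrightarrow> lam (n0 x) = Idn (VC Z) (n0 x)"
    and nH: "harr Z f x y \<Longrightarrow> harr Z (nH f) (n0 x) (n0 y)"
    and rho: "harr Z f x y \<Longrightarrow> sq Z (rho f) (nH f) f (lam x) (lam y)"
    and rhoi: "harr Z f x y \<Longrightarrow> sq Z (rhoi f) f (nH f) (lami x) (lami y)"
    and rho_rhoi: "harr Z f x y \<Longrightarrow> above Z (rho f) (rhoi f) = esq Z (nH f)"
    and rhoi_rho: "harr Z f x y \<Longrightarrow> above Z (rhoi f) (rho f) = esq Z f"
    and nH_nH: "harr Z f x y \<Longrightarrow> nH (nH f) = nH f"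
    and rho_nH: "harr Z f x y \<Longrightarrow> rho (nH f) = esq Z (nH f)"
    and rho_Idn: "x \<in> Ob (HC Z) \<Longrightarrow> rho (Idn (HC Z) x) = idsq Z (lam x)"
    and rho_comp: "harr Z f x y \<Longrightarrow> harr Z g y z \<Longrightarrow>
      rho (Cmp (HC Z) f g) = above Z (rho (Cmp (HC Z) (nH f) (nH g))) (beside Z (rho f) (rho g))"
begin

definition nV :: "'u \<Rightarrow> 'u" where
  "nV u = Cmp (VC Z) (Cmp (VC Z) (lam (Dm (VC Z) u)) u) (lami (Cd (VC Z) u))"

definition nS :: "'u \<Rightarrow> 'u" where
  "nS \<alpha> = above Z (above Z (rho (tp Z \<alpha>)) \<alpha>) (rhoi (bt Z \<alpha>))"

definition conjmap :: "'u cellmap" where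
  "conjmap = \<lparr> mo = n0, mh = nH, mv = nV, ms = nS \<rparr>"

lemma conjmap_sel [simp]: "mo conjmap = n0" "mh conjmap = nH" "mv conjmap = nV" "ms conjmap = nS"
  by (simp_all add: conjmap_def)

lemma nV_eq: "varr Z u x y \<Longrightarrow> nV u = Cmp (VC Z) (Cmp (VC Z) (lam x) u) (lami y)"
  by (auto simp: nV_def varr_def)

lemma nS_eq: "sq Z \<alpha> t b l r \<Longrightarrow> nS \<alpha> = above Z (above Z (rho t) \<alpha>) (rhoi b)"
  by (auto simp: nS_def sq_def)

lemma nV: assumes u: "varr Z u x y" shows "varr Z (nV u) (n0 x) (n0 y)"
  unfolding nV_eq[OF u] using varr_comp[OF varr_comp[OF lam u] lami] varr_ob[OF u] by simp

lemma lami_n0: assumes "x \<in> Ob (HC Z)" shows "lami (n0 x) = Idn (VC Z) (n0 x)"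
proof -
  have "Cmp (VC Z) (lam (n0 x)) (lami (n0 x)) = Idn (VC Z) (n0 x)" 
    using lam_lami[OF n0(1)[OF assms]] n0(2)[OF assms] by simp
  then show ?thesis using varr_idl[OF lami[OF n0(1)[OF assms]]] lam_n0[OF assms] by simp
qed

lemma nS: assumes a: "sq Z \<alpha> t b l r" shows "sq Z (nS \<alpha>) (nH t) (nH b) (nV l) (nV r)"
proof -
  note c = sq_corners[OF a]
  show ?thesis
    unfolding nS_eq[OF a] nV_eq[OF c(3)] nV_eq[OF c(4)]
    by (rule sq_above[OF sq_above[OF rho[OF c(1)] a] rhoi[OF c(2)]])
qed

text \<open>Both arrows are the top of one square, \<open>rho\<close> of the composite: once by its
  type, once through the decomposition \<open>rho_comp\<close>.\<close>

lemma nH_comp: assumes "harr Z f x y" "harr Z g y z"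
  shows "nH (Cmp (HC Z) (nH f) (nH g)) = nH (Cmp (HC Z) f g)"
proof -
  have "sq Z (rho (Cmp (HC Z) f g)) (nH (Cmp (HC Z) f g)) (Cmp (HC Z) f g) (lam x) (lam z)"
    by (rule rho[OF harr_comp[OF assms]])
  moreover have "sq Z (rho (Cmp (HC Z) f g)) (nH (Cmp (HC Z) (nH f) (nH g))) (Cmp (HC Z) f g)
     (Cmp (VC Z) (lam (n0 x)) (lam x)) (Cmp (VC Z) (lam (n0 z)) (lam z))"
    unfolding rho_comp[OF assms]
    by (rule sq_above[OF rho[OF harr_comp[OF nH[OF assms(1)] nH[OF assms(2)]]] sq_beside[OF rho[OF assms(1)] rho[OF assms(2)]]])
  ultimately show ?thesis by (auto simp: sq_def)
qed

lemma nH_Idn: assumes "x \<in> Ob (HC Z)" shows "nH (Idn (HC Z) x) = Idn (HC Z) (n0 x)"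
  using rho[OF harr_id[OF assms]] sq_idsq[OF lam[OF assms]] rho_Idn[OF assms] by (auto simp: sq_def)

lemma rhoi_unique:
  assumes "harr Z f x y" "sq Z s f (nH f) l' r'" "above Z s (rho f) = esq Z f" shows "rhoi f = s"
  using above_inverse_unique[OF rho[OF assms(1)] rhoi[OF assms(1)] assms(2) rho_rhoi[OF assms(1)] assms(3)] .

lemma rhoi_nH: assumes f: "harr Z f x y" shows "rhoi (nH f) = esq Z (nH f)"
  by (rule rhoi_unique[OF nH[OF f], unfolded rho_nH[OF f] nH_nH[OF f], OF sq_esq[OF nH[OF f]] above_esq[OF sq_esq[OF nH[OF f]]]])

lemma rhoi_Idn: assumes x: "x \<in> Ob (HC Z)" shows "rhoi (Idn (HC Z) x) = idsq Z (lami x)"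
proof (rule rhoi_unique[OF harr_id[OF x]])
  show "sq Z (idsq Z (lami x)) (Idn (HC Z) x) (nH (Idn (HC Z) x)) (lami x) (lami x)"
    using sq_idsq[OF lami[OF x]] nH_Idn[OF x] by simp
  show "above Z (idsq Z (lami x)) (rho (Idn (HC Z) x)) = esq Z (Idn (HC Z) x)"
    unfolding rho_Idn[OF x] idsq_comp[OF lami[OF x] lam[OF x], symmetric] lami_lam[OF x] esq_Idn[OF x] ..
qed

text \<open>Inverses are unique, so it suffices to undo the pasting in \<open>rho_comp\<close> layer
  by layer.\<close>

lemma rhoi_comp: assumes f: "harr Z f x y" and g: "harr Z g y z"
  shows "rhoi (Cmp (HC Z) f g) = above Z (beside Z (rhoi f) (rhoi g)) (rhoi (Cmp (HC Z) (nH f) (nH g)))"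
proof (rule rhoi_unique[OF harr_comp[OF f g]])
  let ?n = "Cmp (HC Z) (nH f) (nH g)"
  have n: "harr Z ?n (n0 x) (n0 z)" using harr_comp[OF nH[OF f] nH[OF g]] .
  note bi = sq_beside[OF rhoi[OF f] rhoi[OF g]] and b = sq_beside[OF rho[OF f] rho[OF g]]
  note ri = rhoi[OF n, unfolded nH_comp[OF f g]] and r = rho[OF n, unfolded nH_comp[OF f g]]
  show "sq Z (above Z (beside Z (rhoi f) (rhoi g)) (rhoi ?n)) (Cmp (HC Z) f g) (nH (Cmp (HC Z) f g))
     (Cmp (VC Z) (lami x) (lami (n0 x))) (Cmp (VC Z) (lami z) (lami (n0 z)))"
    by (rule sq_above[OF bi ri])
  have "above Z (above Z (beside Z (rhoi f) (rhoi g)) (rhoi ?n)) (rho (Cmp (HC Z) f g))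
    = above Z (beside Z (rhoi f) (rhoi g)) (beside Z (rho f) (rho g))"
    unfolding rho_comp[OF f g]
    by (rule above_cancel[OF bi ri r b rhoi_rho[OF n]])
  also have "\<dots> = beside Z (above Z (rhoi f) (rho f)) (above Z (rhoi g) (rho g))"
    by (rule interchange[OF rhoi[OF f] rhoi[OF g] rho[OF f] rho[OF g]])
  also have "\<dots> = esq Z (Cmp (HC Z) f g)" 
    unfolding rhoi_rho[OF f] rhoi_rho[OF g] esq_comp[OF f g] ..
  finally show "above Z (above Z (beside Z (rhoi f) (rhoi g)) (rhoi ?n)) (rho (Cmp (HC Z) f g)) = esq Z (Cmp (HC Z) f g)" .
qed

lemma nV_comp: assumes u: "varr Z u x y" and v: "varr Z v y z"
  shows "nV (Cmp (VC Z) u v) = Cmp (VC Z) (nV u) (nV v)"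
proof -
  note x = varr_ob[OF u] varr_ob[OF v]
  note lu = varr_comp[OF lam[OF x(1)] u] and vl = varr_comp[OF v lami[OF x(4)]]
  have "Cmp (VC Z) (nV u) (nV v) = Cmp (VC Z) (Cmp (VC Z) (Cmp (VC Z) (lam x) u) (lami y)) (Cmp (VC Z) (lam y) (Cmp (VC Z) v (lami z)))"
    unfolding nV_eq[OF u] nV_eq[OF v] varr_assoc[OF lam[OF x(2)] v lami[OF x(4)]] ..
  also have "\<dots> = Cmp (VC Z) (Cmp (VC Z) (lam x) u) (Cmp (VC Z) v (lami z))"
    by (rule varr_cancel[OF lu lami[OF x(2)] lam[OF x(2)] vl lami_lam[OF x(2)]])
  also have "\<dots> = nV (Cmp (VC Z) u v)"
    unfolding nV_eq[OF varr_comp[OF u v]] varr_assoc[OF lam[OF x(1)] u v, symmetric] varr_assoc[OF lu v lami[OF x(4)]] ..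
  finally show ?thesis ..
qed

lemma nV_nV: assumes u: "varr Z u x y" shows "nV (nV u) = nV u"
proof -
  note x = varr_ob[OF u]
  show ?thesis
    unfolding nV_eq[OF nV[OF u]] lam_n0[OF x(1)] lami_n0[OF x(2)] varr_idl[OF nV[OF u]] varr_idr[OF nV[OF u]] ..
qed

lemma nV_Idn: assumes x: "x \<in> Ob (HC Z)" shows "nV (Idn (VC Z) x) = Idn (VC Z) (n0 x)"
  unfolding nV_eq[OF varr_id[OF x]] varr_idr[OF lam[OF x]] lam_lami[OF x] ..

lemma nS_above: assumes a: "sq Z \<alpha> t c l r" and b: "sq Z \<beta> c b l' r'"
  shows "nS (above Z \<alpha> \<beta>) = above Z (nS \<alpha>) (nS \<beta>)"
proof -
  note ca = sq_corners[OF a] and cb = sq_corners[OF b]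
  note t = rho[OF ca(1)] and b' = rhoi[OF cb(2)]
  note ta = sq_above[OF t a] and bb = sq_above[OF b b']
  have "above Z (nS \<alpha>) (nS \<beta>) = above Z (above Z (above Z (rho t) \<alpha>) (rhoi c)) (above Z (rho c) (above Z \<beta> (rhoi b)))"
    unfolding nS_eq[OF a] nS_eq[OF b] above_assoc[OF rho[OF cb(1)] b b'] ..
  also have "\<dots> = above Z (above Z (rho t) \<alpha>) (above Z \<beta> (rhoi b))"
    by (rule above_cancel[OF ta rhoi[OF cb(1)] rho[OF cb(1)] bb rhoi_rho[OF cb(1)]])
  also have "\<dots> = nS (above Z \<alpha> \<beta>)"
    unfolding nS_eq[OF sq_above[OF a b]] above_assoc[OF t a b, symmetric] above_assoc[OF ta b b'] ..
  finally show ?thesis ..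
qed

lemma nS_nS: assumes a: "sq Z \<alpha> t b l r" shows "nS (nS \<alpha>) = nS \<alpha>"
proof -
  note c = sq_corners[OF a]
  show ?thesis
    unfolding nS_eq[OF nS[OF a]] rho_nH[OF c(1)] rhoi_nH[OF c(2)] esq_above[OF nS[OF a]] above_esq[OF nS[OF a]] ..
qed

lemma nS_esq: assumes f: "harr Z f x y" shows "nS (esq Z f) = esq Z (nH f)"
  unfolding nS_eq[OF sq_esq[OF f]] above_esq[OF rho[OF f]] rho_rhoi[OF f] ..

lemma nS_idsq: assumes u: "varr Z u x y" shows "nS (idsq Z u) = idsq Z (nV u)"
proof -
  note x = varr_ob[OF u]
  show ?thesis
    unfolding nS_eq[OF sq_idsq[OF u]] rho_Idn[OF x(1)] rhoi_Idn[OF x(2)] nV_eq[OF u]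
     idsq_comp[OF lam[OF x(1)] u, symmetric] idsq_comp[OF varr_comp[OF lam[OF x(1)] u] lami[OF x(2)], symmetric] ..
qed

text \<open>Equality can hold only after renormalising, because the composite of the normal tops
  \<open>nH t\<close> and \<open>nH t'\<close> need not be normal. The missing layer is exactly the
  first factor in \<open>rho_comp\<close>.\<close>

lemma nS_beside: assumes a: "sq Z \<alpha> t b l m" and b: "sq Z \<beta> t' b' m r"
  shows "nS (beside Z (nS \<alpha>) (nS \<beta>)) = nS (beside Z \<alpha> \<beta>)"
proof -
  note ca = sq_corners[OF a] and cb = sq_corners[OF b]
  have tt: "harr Z t' (Cd (HC Z) t) (Cd (HC Z) t')" "harr Z b' (Cd (HC Z) b) (Cd (HC Z) b')"
    using ca cb by (auto simp: varr_def harr_def)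
  note x = ca(1) tt(1) and y = ca(2) tt(2)
  note nx = harr_comp[OF nH[OF x(1)] nH[OF x(2)]] and ny = harr_comp[OF nH[OF y(1)] nH[OF y(2)]]
  note R = rho[OF nx] and R' = rhoi[OF ny]
  note s = sq_beside[OF rho[OF x(1)] rho[OF x(2)]] and ab = sq_beside[OF a b] and s' = sq_beside[OF rhoi[OF y(1)] rhoi[OF y(2)]]
  have e: "beside Z (nS \<alpha>) (nS \<beta>) = above Z (above Z (beside Z (rho t) (rho t')) (beside Z \<alpha> \<beta>)) (beside Z (rhoi b) (rhoi b'))"
    unfolding nS_eq[OF a] nS_eq[OF b]
      interchange[OF rho[OF x(1)] rho[OF x(2)] a b]
      interchange[OF sq_above[OF rho[OF x(1)] a] sq_above[OF rho[OF x(2)] b] rhoi[OF y(1)] rhoi[OF y(2)]] ..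
  note sn = sq_beside[OF nS[OF a] nS[OF b]]
  have "nS (beside Z (nS \<alpha>) (nS \<beta>)) = above Z (above Z (rho (Cmp (HC Z) (nH t) (nH t'))) (beside Z (nS \<alpha>) (nS \<beta>)))
      (rhoi (Cmp (HC Z) (nH b) (nH b')))"
    by (rule nS_eq[OF sn])
  also have "\<dots> = nS (beside Z \<alpha> \<beta>)"
    unfolding nS_eq[OF ab] rho_comp[OF x] rhoi_comp[OF y] e
      above_assoc[OF R s ab]
      above_assoc[OF R sq_above[OF s ab] s', symmetric]
      above_assoc[OF sq_above[OF R sq_above[OF s ab]] s' R'] ..
  finally show ?thesis .
qed

lemma normalizer: "normalizer Z conjmap"
proof -
  have "ncat (HC Z) n0 nH"
    unfolding ncat_def using n0 nH nH_nH nH_comp nH_Idn by (simp add: harr_def)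
  moreover have "ncat (VC Z) n0 nV"
    unfolding ncat_def using n0 nV nV_nV nV_comp nV_Idn by (simp add: varr_def obs)
  moreover have "ncat (HS Z) nV nS"
    unfolding ncat_def using nV nV_nV nS nS_nS nS_beside nS_idsq by (simp add: varr_def obs sq_def)
  moreover have "ncat (VS Z) nH nS"
    unfolding ncat_def using nH nH_nH nS nS_nS nS_above nS_esq by (simp add: harr_def obs sq_def)
  ultimately show ?thesis using dc by (simp add: normalizer_def)
qed

lemma fix_harr: "harr (fixdbl Z conjmap) f x y \<longleftrightarrow> harr Z f x y \<and> nH f = f"
  using fixcat_in(2)[of "HC Z" n0 nH] normalizer by (auto simp: harr_def normalizer_def)

lemma fix_varr: "varr (fixdbl Z conjmap) f x y \<longleftrightarrow> varr Z f x y \<and> nV f = f"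
  using fixcat_in(2)[of "VC Z" n0 nV] normalizer by (auto simp: varr_def normalizer_def)

lemma fix_sq: "sq (fixdbl Z conjmap) \<alpha> t b l r \<longleftrightarrow> sq Z \<alpha> t b l r \<and> nS \<alpha> = \<alpha>"
  using fixcat_in(2)[of "HS Z" nV nS] normalizer by (auto simp: sq_def normalizer_def)

text \<open>Vertical arrows and squares are lifted by undoing the conjugation. Nothing undoes the
  choice of a horizontal normal form, so horizontal fullness relies on the arrows \<open>k\<close>
  and \<open>k'\<close>: a normal \<open>g\<close> is the normal form of \<open>k'\<close> followed
  by \<open>g\<close> and \<open>k\<close>.\<close>

lemma dctf_conjmap:
  assumes k: "\<And>x. x \<in> Ob (HC Z) \<Longrightarrow> \<exists>k k'. harr Z k (n0 x) x \<and> nH k = Idn (HC Z) (n0 x) \<and> harr Z k' x (n0 x) \<and> nH k' = Idn (HC Z) (n0 x)"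
  shows "dctf Z (fixdbl Z conjmap) conjmap"
proof -
  have 1: "\<exists>f. harr Z f x y \<and> nH f = g" if x: "x \<in> Ob (HC Z)" "y \<in> Ob (HC Z)" and g: "harr Z g (n0 x) (n0 y)" "nH g = g" for x y g
  proof -
    obtain k where k1: "harr Z k (n0 y) y" "nH k = Idn (HC Z) (n0 y)" using k[OF x(2)] by blast
    obtain k' where k': "harr Z k' x (n0 x)" "nH k' = Idn (HC Z) (n0 x)" using k[OF x(1)] by blast
    let ?h = "Cmp (HC Z) k' g"
    have h: "harr Z ?h x (n0 y)" using harr_comp[OF k'(1) g(1)] .
    have "nH ?h = nH g" using nH_comp[OF k'(1) g(1)] k'(2) g(2) harr_idl[OF g(1)] by simp
    moreover have "nH (Cmp (HC Z) ?h k) = nH (Cmp (HC Z) (nH ?h) (Idn (HC Z) (n0 y)))"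
      using nH_comp[OF h k1(1)] k1(2) by simp
    ultimately have "nH (Cmp (HC Z) ?h k) = g" using harr_idr[OF g(1)] g(2) by simp
    then show ?thesis using harr_comp[OF h k1(1)] by blast
  qed
  have 2: "\<exists>f. varr Z f x y \<and> nV f = g" if x: "x \<in> Ob (HC Z)" "y \<in> Ob (HC Z)" and g: "varr Z g (n0 x) (n0 y)" for x y g
  proof -
    note l = lam[OF x(1)] lami[OF x(1)] lam[OF x(2)] lami[OF x(2)]
    let ?f = "Cmp (VC Z) (Cmp (VC Z) (lami x) g) (lam y)"
    have f: "varr Z ?f x y" using varr_comp[OF varr_comp[OF l(2) g] l(3)] .
    have "nV ?f = Cmp (VC Z) (Cmp (VC Z) (lam x) (Cmp (VC Z) (lami x) (Cmp (VC Z) g (lam y)))) (lami y)"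
      using nV_eq[OF f] varr_assoc[OF l(2) g l(3)] by simp
    also have "Cmp (VC Z) (lam x) (Cmp (VC Z) (lami x) (Cmp (VC Z) g (lam y))) = Cmp (VC Z) g (lam y)"
      using varr_assoc[OF l(1) l(2) varr_comp[OF g l(3)]] lam_lami[OF x(1)] varr_idl[OF varr_comp[OF g l(3)]] by simp
    also have "Cmp (VC Z) (Cmp (VC Z) g (lam y)) (lami y) = g"
      using varr_assoc[OF g l(3) l(4)] lam_lami[OF x(2)] varr_idr[OF g] by simp
    finally show ?thesis using f by blast
  qed
  have 3: "\<exists>!\<alpha>. sq Z \<alpha> t b l r \<and> nS \<alpha> = \<sigma>"
    if h: "harr Z t x y" "harr Z b x' y'" "varr Z l x x'" "varr Z r y y'" and s: "sq Z \<sigma> (nH t) (nH b) (nV l) (nV r)" for x y x' y' t b l r \<sigma>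
  proof -
    note x = harr_ob[OF h(1)] harr_ob[OF h(2)]
    \<comment> \<open>Undoing the conjugation of a side returns the given side, so the square
      \<open>?a\<close> below has the required boundary and not merely a conjugate one.\<close>
    have side: "Cmp (VC Z) (Cmp (VC Z) (lami a) (nV u)) (lam a') = u" if u: "varr Z u a a'" for u a a'
    proof -
      note a = varr_ob[OF u]
      note l = lam[OF a(1)] lami[OF a(1)] lam[OF a(2)] lami[OF a(2)]
      have "Cmp (VC Z) (lami a) (nV u) = Cmp (VC Z) u (lami a')"
        unfolding nV_eq[OF u] varr_assoc[OF l(1) u l(4)] varr_assoc[OF l(2) l(1) varr_comp[OF u l(4)], symmetric]
          lami_lam[OF a(1)] varr_idl[OF varr_comp[OF u l(4)]] ..
      then show ?thesis using varr_assoc[OF u l(4) l(3)] lami_lam[OF a(2)] varr_idr[OF u] by simp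
    qed
    note rt = rho[OF h(1)] rhoi[OF h(1)] and rb = rho[OF h(2)] rhoi[OF h(2)]
    let ?a = "above Z (above Z (rhoi t) \<sigma>) (rho b)"
    have a: "sq Z ?a t b l r"
      using sq_above[OF sq_above[OF rt(2) s] rb(1)] side[OF h(3)] side[OF h(4)] by simp
    have "nS ?a = above Z (above Z (rho t) (above Z (rhoi t) (above Z \<sigma> (rho b)))) (rhoi b)"
      using nS_eq[OF a] above_assoc[OF rt(2) s rb(1)] by simp
    also have "above Z (rho t) (above Z (rhoi t) (above Z \<sigma> (rho b))) = above Z \<sigma> (rho b)"
      using above_assoc[OF rt sq_above[OF s rb(1)]] rho_rhoi[OF h(1)] esq_above[OF sq_above[OF s rb(1)]] by simp
    also have "above Z (above Z \<sigma> (rho b)) (rhoi b) = \<sigma>"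
      using above_assoc[OF s rb] rho_rhoi[OF h(2)] above_esq[OF s] by simp
    finally have na: "nS ?a = \<sigma>" .
    show ?thesis
    proof (rule ex1I)
      show "sq Z ?a t b l r \<and> nS ?a = \<sigma>" using a na by simp
      fix \<alpha> assume "sq Z \<alpha> t b l r \<and> nS \<alpha> = \<sigma>"
      then have al: "sq Z \<alpha> t b l r" and e: "\<sigma> = nS \<alpha>" by auto
      have "?a = above Z (above Z (rhoi t) (above Z (rho t) (above Z \<alpha> (rhoi b)))) (rho b)"
        unfolding e nS_eq[OF al] above_assoc[OF rt(1) al rb(2)] ..
      also have "above Z (rhoi t) (above Z (rho t) (above Z \<alpha> (rhoi b))) = above Z \<alpha> (rhoi b)"
        using above_assoc[OF rt(2) rt(1) sq_above[OF al rb(2)]] rhoi_rho[OF h(1)] esq_above[OF sq_above[OF al rb(2)]] by simp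
      also have "above Z (above Z \<alpha> (rhoi b)) (rho b) = \<alpha>"
        using above_assoc[OF al rb(2) rb(1)] rhoi_rho[OF h(2)] above_esq[OF al] by simp
      finally show "\<alpha> = ?a" ..
    qed
  qed
  have 0: "\<exists>x\<in>Ob (HC Z). mo conjmap x = y" if "y \<in> Ob (HC (fixdbl Z conjmap))" for y
    using that by auto
  show ?thesis
    unfolding dctf_def fix_harr fix_varr fix_sq conjmap_sel
    by (intro conjI ballI allI impI; (elim conjE)?;
      (rule dfun_fixdbl[OF normalizer] | rule 0[unfolded conjmap_sel] | rule 1 | rule 2 | rule 3); assumption?)
qed

end

section \<open>Words\<close>

text \<open>
  A word \<open>m0 g1 m1 \<dots> gn mn\<close> alternates between arrows \<open>mi\<close> of a category and free generators \<open>gi\<close>.  Identities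
  are allowed as letters, so that every arrow of the free extension has exactly one word.
\<close>

datatype ('m, 'g) word = End 'm | Step 'm 'g "('m, 'g) word"

primrec lmult :: "('m \<Rightarrow> 'm \<Rightarrow> 'm) \<Rightarrow> 'm \<Rightarrow> ('m, 'g) word \<Rightarrow> ('m, 'g) word" where
  "lmult c m (End n) = End (c m n)"
| "lmult c m (Step n g w) = Step (c m n) g w"

primrec jn :: "('m \<Rightarrow> 'm \<Rightarrow> 'm) \<Rightarrow> ('m, 'g) word \<Rightarrow> ('m, 'g) word \<Rightarrow> ('m, 'g) word" where
  "jn c (End m) w' = lmult c m w'"
| "jn c (Step m g w) w' = Step m g (jn c w w')"

primrec vword :: "('o, 'm) category \<Rightarrow> 'g set \<Rightarrow> ('g \<Rightarrow> 'o) \<Rightarrow> ('g \<Rightarrow> 'o) \<Rightarrow> ('m, 'g) word \<Rightarrow> 'o \<Rightarrow> 'o \<Rightarrow> bool" where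
  "vword C G gd gc (End m) x y \<longleftrightarrow> m \<in> Ar C \<and> Dm C m = x \<and> Cd C m = y"
| "vword C G gd gc (Step m g w) x y \<longleftrightarrow> m \<in> Ar C \<and> Dm C m = x \<and> Cd C m = gd g \<and> g \<in> G \<and> vword C G gd gc w (gc g) y"

primrec evw :: "('m \<Rightarrow> 'm \<Rightarrow> 'm) \<Rightarrow> ('n \<Rightarrow> 'm) \<Rightarrow> ('g \<Rightarrow> 'm) \<Rightarrow> ('n, 'g) word \<Rightarrow> 'm" where
  "evw c i gv (End m) = i m"
| "evw c i gv (Step m g w) = c (i m) (c (gv g) (evw c i gv w))"

text \<open>For two well-typed words the inner ends of the letters are prescribed by the common
  generators; only the two outer ends can differ.\<close>

primrec par :: "('m \<Rightarrow> 'n) \<Rightarrow> ('m, 'g) word \<Rightarrow> ('m, 'g) word \<Rightarrow> bool" where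
  "par p (End m) w' \<longleftrightarrow> (\<exists>m'. w' = End m' \<and> p m = p m')"
| "par p (Step m g w) w' \<longleftrightarrow> (\<exists>m' v. w' = Step m' g v \<and> p m = p m' \<and> par p w v)"

lemma par_sym: "par p w w' \<Longrightarrow> par p w' w"
  by (induction w arbitrary: w') auto

text \<open>The choice \<open>ch\<close> sees a letter only through its image under \<open>p\<close>
  and the ends prescribed for the new letter. Hence parallel words have equal normal forms, and only
  the outer ends \<open>a\<close> and \<open>z\<close> remain to be given.\<close>

primrec nword :: "('n \<Rightarrow> 'o \<Rightarrow> 'o \<Rightarrow> 'm) \<Rightarrow> ('m \<Rightarrow> 'n) \<Rightarrow> ('g \<Rightarrow> 'o) \<Rightarrow> ('g \<Rightarrow> 'o) \<Rightarrow> 'o \<Rightarrow> 'o \<Rightarrow> ('m, 'g) word \<Rightarrow> ('m, 'g) word" where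
  "nword ch p gd gc a z (End m) = End (ch (p m) a z)"
| "nword ch p gd gc a z (Step m g w) = Step (ch (p m) a (gd g)) g (nword ch p gd gc (gc g) z w)"

lemma nword_par: "par p w w' \<Longrightarrow> nword ch p gd gc a z w = nword ch p gd gc a z w'"
  by (induction w arbitrary: w' a) auto

lemma vword_ob:
  assumes "category C" "vword C G gd gc w x y" shows "x \<in> Ob C" "y \<in> Ob C"
  using assms(2) category_Dm_Cd[OF assms(1)] by (induction w arbitrary: x) auto

lemma vword_lmult:
  assumes "category C" "m \<in> Ar C" "Dm C m = x" "Cd C m = y" "vword C G gd gc w y z"
  shows "vword C G gd gc (lmult (Cmp C) m w) x z"
  using assms category_Cmp[OF assms(1), of m] by (cases w) auto

lemma vword_jn:
  assumes "category C" "vword C G gd gc w x y" "vword C G gd gc w' y z"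
  shows "vword C G gd gc (jn (Cmp C) w w') x z"
  using assms(2,3) by (induction w arbitrary: x) (auto intro: vword_lmult[OF assms(1)])

lemma jn_assoc:
  assumes C: "category C" and "vword C G gd gc w x y" "vword C G gd gc w' y z" "vword C G gd gc w'' z t"
  shows "jn (Cmp C) (jn (Cmp C) w w') w'' = jn (Cmp C) w (jn (Cmp C) w' w'')"
  using assms(2-)
proof (induction w arbitrary: x)
  case (End m)
  \<comment> \<open>If the middle word is a single letter, three letters merge into one; this is
    where associativity of \<open>C\<close> enters.\<close>
  have "lmult (Cmp C) (Cmp C m m') v = lmult (Cmp C) m (lmult (Cmp C) m' v)"
    if "m' \<in> Ar C" "Cd C m = Dm C m'" "vword C G gd gc v (Cd C m') t" for m' v
    using that End category_assoc[OF C, of m m'] by (cases v) auto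
  then show ?case using End by (cases w') auto
qed auto

lemma jn_unit:
  assumes C: "category C" and "vword C G gd gc w x y"
  shows "jn (Cmp C) (End (Idn C x)) w = w" "jn (Cmp C) w (End (Idn C y)) = w"
proof -
  show "jn (Cmp C) (End (Idn C x)) w = w" using assms(2) category_unit[OF C] by (cases w) auto
  show "jn (Cmp C) w (End (Idn C y)) = w" using assms(2)
    by (induction w arbitrary: x) (use category_unit[OF C] in auto)
qed

text \<open>The mapping property of a free extension. Joining words merges the two letters that
  meet, and functoriality of \<open>i\<close> separates them again.\<close>

lemma evw_jn:
  assumes "vword C G gd gc w x y" "vword C G gd gc w' y z" "category C"
    and D: "category D" and i: "is_functor C D io i" 
    and gv: "\<And>g. g \<in> G \<Longrightarrow> gv g \<in> Ar D \<and> Dm D (gv g) = io (gd g) \<and> Cd D (gv g) = io (gc g)"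
  shows "evw (Cmp D) i gv (jn (Cmp C) w w') = Cmp D (evw (Cmp D) i gv w) (evw (Cmp D) i gv w')"
    and "evw (Cmp D) i gv w \<in> Ar D \<and> Dm D (evw (Cmp D) i gv w) = io x \<and> Cd D (evw (Cmp D) i gv w) = io y"
proof -
  have t: "evw (Cmp D) i gv w \<in> Ar D \<and> Dm D (evw (Cmp D) i gv w) = io x \<and> Cd D (evw (Cmp D) i gv w) = io y"
    if "vword C G gd gc w x y" for w x y
    using that
  proof (induction w arbitrary: x)
    case (End m) then show ?case using i by (auto simp: is_functor_def)
  next
    case (Step m g w)
    have "i m \<in> Ar D \<and> Dm D (i m) = io x \<and> Cd D (i m) = io (gd g)" using Step.prems i by (auto simp: is_functor_def)
    moreover have v: "vword C G gd gc w (gc g) y" "g \<in> G" using Step.prems by auto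
    moreover have "Cmp D (gv g) (evw (Cmp D) i gv w) \<in> Ar D \<and> Dm D (Cmp D (gv g) (evw (Cmp D) i gv w)) = io (gd g)
       \<and> Cd D (Cmp D (gv g) (evw (Cmp D) i gv w)) = io y"
      using category_Cmp[OF D] v gv Step.IH[OF v(1)] by simp
    ultimately show ?case using category_Cmp[OF D] by simp
  qed
  show "evw (Cmp D) i gv w \<in> Ar D \<and> Dm D (evw (Cmp D) i gv w) = io x \<and> Cd D (evw (Cmp D) i gv w) = io y"
    using t[OF assms(1)] .
  have l: "evw (Cmp D) i gv (lmult (Cmp C) m w') = Cmp D (i m) (evw (Cmp D) i gv w')"
    if m: "m \<in> Ar C" "Cd C m = y" for m
  proof (cases w')
    case (End n) then show ?thesis using m assms(2) i by (auto simp: is_functor_def)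
  next
    case (Step n g v)
    have n: "i m \<in> Ar D \<and> Cd D (i m) = io y" "i n \<in> Ar D \<and> Dm D (i n) = io y \<and> Cd D (i n) = io (gd g)" "i (Cmp C m n) = Cmp D (i m) (i n)"
      using m assms(2) i Step by (auto simp: is_functor_def)
    have v: "evw (Cmp D) i gv v \<in> Ar D \<and> Dm D (evw (Cmp D) i gv v) = io (gc g)" "g \<in> G"
      using t[of v "gc g" z] assms(2) Step by auto
    have "Cmp D (gv g) (evw (Cmp D) i gv v) \<in> Ar D \<and> Dm D (Cmp D (gv g) (evw (Cmp D) i gv v)) = io (gd g)"
      using category_Cmp[OF D] v gv by simp
    then show ?thesis using n category_assoc[OF D] by (simp add: Step)
  qed
  show "evw (Cmp D) i gv (jn (Cmp C) w w') = Cmp D (evw (Cmp D) i gv w) (evw (Cmp D) i gv w')"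
    using assms(1)
  proof (induction w arbitrary: x)
    case (End m) then show ?case using l by simp
  next
    case (Step m g w)
    note n = t[of w "gc g" y] t[OF assms(2)]
    have m: "i m \<in> Ar D \<and> Cd D (i m) = io (gd g)" using Step.prems i by (auto simp: is_functor_def)
    have v: "vword C G gd gc w (gc g) y" "g \<in> G" using Step.prems by auto
    have "Cmp D (gv g) (evw (Cmp D) i gv w) \<in> Ar D \<and> Dm D (Cmp D (gv g) (evw (Cmp D) i gv w)) = io (gd g)
       \<and> Cd D (Cmp D (gv g) (evw (Cmp D) i gv w)) = io y"
      using category_Cmp[OF D] v gv n by simp
    then show ?case using Step.IH[OF v(1)] m n v gv category_assoc[OF D] by simp
  qed
qed

text \<open>
  The locale is used twice: for the transposed double categories, where \<open>collapse\<close> holds because \<open>I\<close> is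
  injective on arrows, and then for \<open>I\<close> followed by the first normalisation, which identifies squares
  with equal horizontal sides and equal images under \<open>F\<close>.
\<close>

locale word_data =
  F: dcat A + Z: dcat Z for A Z :: "'u dblcat" +
  fixes B :: "'u dblcat" and F I :: "'u cellmap" and G :: "'g set" and gd gc gv :: "'g \<Rightarrow> 'u"
    and n0 l l' :: "'u \<Rightarrow> 'u"
  assumes F: "dctf A B F" and I: "dfun A Z I"
    and obZ: "Ob (HC Z) = Ob (HC A)" and I_ob: "a \<in> Ob (HC A) \<Longrightarrow> mo I a = a"
    and gens: "g \<in> G \<Longrightarrow> gd g \<in> Ob (HC A)" "g \<in> G \<Longrightarrow> gc g \<in> Ob (HC A)" "g \<in> G \<Longrightarrow> harr Z (gv g) (gd g) (gc g)"
    and free: "harr Z f x y \<Longrightarrow> \<exists>!w. vword (HC A) G gd gc w x y \<and> evw (Cmp (HC Z)) (mh I) gv w = f"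
    and n0: "x \<in> Ob (HC A) \<Longrightarrow> n0 x \<in> Ob (HC A)" "x \<in> Ob (HC A) \<Longrightarrow> n0 (n0 x) = n0 x" "x \<in> Ob (HC A) \<Longrightarrow> mo F (n0 x) = mo F x"
    and collapse: "sq A \<alpha> t b u v \<Longrightarrow> sq A \<beta> t b u' v' \<Longrightarrow> ms F \<alpha> = ms F \<beta> \<Longrightarrow> mv I u = mv I u' \<Longrightarrow> mv I v = mv I v' \<Longrightarrow> ms I \<alpha> = ms I \<beta>"
    and l: "x \<in> Ob (HC A) \<Longrightarrow> varr A (l x) (n0 x) x" "x \<in> Ob (HC A) \<Longrightarrow> mv F (l x) = Idn (VC B) (mo F x)"
      "x \<in> Ob (HC A) \<Longrightarrow> l (n0 x) = Idn (VC A) (n0 x)"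
    and l': "x \<in> Ob (HC A) \<Longrightarrow> varr A (l' x) x (n0 x)" "x \<in> Ob (HC A) \<Longrightarrow> mv F (l' x) = Idn (VC B) (mo F x)"
    and l_l': "x \<in> Ob (HC A) \<Longrightarrow> Cmp (VC Z) (mv I (l x)) (mv I (l' x)) = Idn (VC Z) (n0 x)"
      "x \<in> Ob (HC A) \<Longrightarrow> Cmp (VC Z) (mv I (l' x)) (mv I (l x)) = Idn (VC Z) x"
begin

abbreviation "vw \<equiv> vword (HC A) G gd gc"
abbreviation "ev \<equiv> evw (Cmp (HC Z)) (mh I) gv"
abbreviation "jw \<equiv> jn (Cmp (HC A))"
abbreviation "pr \<equiv> par (mh F)"

section \<open>Connecting squares over identities, for letters and for parallel words\<close>

definition over :: "'u \<Rightarrow> 'u \<Rightarrow> 'u \<Rightarrow> bool" where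
  "over u x x' \<longleftrightarrow> varr A u x x' \<and> mo F x = mo F x' \<and> mv F u = Idn (VC B) (mo F x)"

text \<open>Preferring the identity to an arbitrary lift makes identities at fixed objects normal,
  so that conjugation preserves identities.\<close>

definition ch :: "'u \<Rightarrow> 'u \<Rightarrow> 'u \<Rightarrow> 'u" where
  "ch m a z = (if a = z \<and> m = Idn (HC B) (mo F a) then Idn (HC A) a else SOME f. harr A f a z \<and> mh F f = m)"

abbreviation "nw \<equiv> nword ch (mh F) gd gc"

definition sqe :: "'u \<Rightarrow> 'u \<Rightarrow> 'u \<Rightarrow> 'u \<Rightarrow> 'u" where
  "sqe t b u v = (THE \<alpha>. sq A \<alpha> t b u v \<and> ms F \<alpha> = esq B (mh F t))"

lemmas dF = dctf_dfun[OF F]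

lemma B: "dcat B" using dfun_dcat(2)[OF dF] .

lemma over_Idn: "x \<in> Ob (HC A) \<Longrightarrow> over (Idn (VC A) x) x x"
  by (simp add: over_def F.varr_id dfun_vid[OF dF])

lemma over_l: "x \<in> Ob (HC A) \<Longrightarrow> over (l x) (n0 x) x" "x \<in> Ob (HC A) \<Longrightarrow> over (l' x) x (n0 x)"
  by (simp_all add: over_def l l' n0)

lemma over_ob: "over u x x' \<Longrightarrow> x \<in> Ob (HC A) \<and> x' \<in> Ob (HC A)"
  using F.varr_ob by (auto simp: over_def)

lemma ch: assumes "harr B m (mo F a) (mo F z)" "a \<in> Ob (HC A)" "z \<in> Ob (HC A)"
  shows "harr A (ch m a z) a z" "mh F (ch m a z) = m"
proof -
  obtain f where "harr A f a z \<and> mh F f = m" using dctf_h[OF F assms] by blast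
  then have "harr A (SOME f. harr A f a z \<and> mh F f = m) a z \<and> mh F (SOME f. harr A f a z \<and> mh F f = m) = m" by (rule someI)
  then show "harr A (ch m a z) a z" "mh F (ch m a z) = m"
    using F.harr_id[OF assms(2)] dfun_hid[OF dF assms(2)] by (auto simp: ch_def)
qed

lemma ch_Idn: "ch (Idn (HC B) (mo F a)) a a = Idn (HC A) a"
  by (simp add: ch_def)

text \<open>As \<open>u\<close> and \<open>v\<close> lie over identities, the identity square at
  \<open>mh F t\<close> has the boundary demanded by full faithfulness.\<close>

lemma sqe_ex1:
  assumes t: "harr A t x y" and b: "harr A b x' y'" and u: "over u x x'" and v: "over v y y'" and e: "mh F t = mh F b"
  shows "\<exists>!\<alpha>. sq A \<alpha> t b u v \<and> ms F \<alpha> = esq B (mh F t)"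
proof (rule dctf_sq_ex1[OF F _ t b])
  show "varr A u x x'" "varr A v y y'" using u v by (auto simp: over_def)
  have "sq B (esq B (mh F t)) (mh F t) (mh F t) (Idn (VC B) (mo F x)) (Idn (VC B) (mo F y))"
    by (rule dcat.sq_esq[OF B dfun_harr[OF dF t]])
  then show "sq B (esq B (mh F t)) (mh F t) (mh F b) (mv F u) (mv F v)" using e u v by (simp add: over_def)
qed

lemma sqe:
  assumes "harr A t x y" "harr A b x' y'" "over u x x'" "over v y y'" "mh F t = mh F b"
  shows "sq A (sqe t b u v) t b u v" "ms F (sqe t b u v) = esq B (mh F t)"
  using theI'[OF sqe_ex1[OF assms]] by (simp_all add: sqe_def)

text \<open>The comparison takes place in \<open>Z\<close>, because only there do the connecting
  arrows \<open>l\<close> and \<open>l'\<close> become inverse to each other.\<close>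

definition S :: "'u \<Rightarrow> 'u \<Rightarrow> 'u \<Rightarrow> 'u \<Rightarrow> 'u" where
  "S t b u v = ms I (sqe t b u v)"

lemma S:
  assumes "harr A t x y" "harr A b x' y'" "over u x x'" "over v y y'" "mh F t = mh F b"
  shows "sq Z (S t b u v) (mh I t) (mh I b) (mv I u) (mv I v)"
  unfolding S_def by (rule dfun_sq[OF I sqe(1)[OF assms]])

text \<open>Sides need to agree only after \<open>I\<close>, which is what \<open>collapse\<close>
  provides. Pasting produces composite sides, and these differ in \<open>A\<close> from the sides
  wanted.\<close>

lemma S_eqI:
  assumes h: "harr A t x y" "harr A b x' y'" "over u x x'" "over v y y'" "mh F t = mh F b"
    and a: "sq A \<alpha> t b u' v'" "ms F \<alpha> = esq B (mh F t)" "mv I u' = mv I u" "mv I v' = mv I v"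
  shows "ms I \<alpha> = S t b u v"
  unfolding S_def using collapse[OF a(1) sqe(1)[OF h]] sqe(2)[OF h] a by simp

lemma S_above:
  assumes t: "harr A t x y" and m: "harr A m x' y'" and b: "harr A b x'' y''" 
    and u: "over u x x'" and v: "over v y y'" and u': "over u' x' x''" and v': "over v' y' y''"
    and e: "mh F t = mh F m" "mh F m = mh F b"
    and w: "over w x x''" "over w' y y''" "mv I w = Cmp (VC Z) (mv I u) (mv I u')" "mv I w' = Cmp (VC Z) (mv I v) (mv I v')"
  shows "above Z (S t m u v) (S m b u' v') = S t b w w'"
proof -
  note 1 = sqe[OF t m u v e(1)] and 2 = sqe[OF m b u' v' e(2)]
  have "above Z (S t m u v) (S m b u' v') = ms I (above A (sqe t m u v) (sqe m b u' v'))"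
    unfolding S_def by (rule dfun_above[OF I 1(1) 2(1), symmetric])
  also have "\<dots> = S t b w w'"
  proof (rule S_eqI[OF t b w(1,2) _ F.sq_above[OF 1(1) 2(1)]])
    show "mh F t = mh F b" using e by simp
    show "ms F (above A (sqe t m u v) (sqe m b u' v')) = esq B (mh F t)"
      unfolding dfun_above[OF dF 1(1) 2(1)] 1(2) 2(2)
      using dcat.above_esq[OF B dcat.sq_esq[OF B dfun_harr[OF dF t]]] e by simp
    show "mv I (Cmp (VC A) u u') = mv I w" "mv I (Cmp (VC A) v v') = mv I w'"
      using dfun_vcomp[OF I] u v u' v' w by (auto simp: over_def)
  qed
  finally show ?thesis .
qed

lemma S_beside:
  assumes t: "harr A t x y" and t': "harr A t' y z" and b: "harr A b x' y'" and b': "harr A b' y' z'"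
    and u: "over u x x'" and v: "over v y y'" and w: "over w z z'"
    and e: "mh F t = mh F b" "mh F t' = mh F b'"
  shows "beside Z (S t b u v) (S t' b' v w) = S (Cmp (HC A) t t') (Cmp (HC A) b b') u w"
proof -
  note 1 = sqe[OF t b u v e(1)] and 2 = sqe[OF t' b' v w e(2)]
  have "beside Z (S t b u v) (S t' b' v w) = ms I (beside A (sqe t b u v) (sqe t' b' v w))"
    unfolding S_def by (rule dfun_beside[OF I 1(1) 2(1), symmetric])
  also have "\<dots> = S (Cmp (HC A) t t') (Cmp (HC A) b b') u w"
  proof (rule S_eqI[OF F.harr_comp[OF t t'] F.harr_comp[OF b b'] u w _ F.sq_beside[OF 1(1) 2(1)] _ refl refl])
    show "mh F (Cmp (HC A) t t') = mh F (Cmp (HC A) b b')" using dfun_hcomp[OF dF] t t' b b' e by simp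
    show "ms F (beside A (sqe t b u v) (sqe t' b' v w)) = esq B (mh F (Cmp (HC A) t t'))"
      unfolding dfun_beside[OF dF 1(1) 2(1)] 1(2) 2(2) dfun_hcomp[OF dF t t']
      by (rule dcat.esq_comp[OF B dfun_harr[OF dF t] dfun_harr[OF dF t'], symmetric])
  qed
  finally show ?thesis .
qed

lemma S_refl: assumes t: "harr A t x y" shows "S t t (Idn (VC A) x) (Idn (VC A) y) = esq Z (mh I t)"
proof -
  have "ms I (esq A t) = S t t (Idn (VC A) x) (Idn (VC A) y)"
    by (rule S_eqI[OF t t over_Idn over_Idn refl F.sq_esq[OF t] dfun_esq[OF dF t] refl refl]) (use F.harr_ob[OF t] in auto)
  then show ?thesis using dfun_esq[OF I t] by simp
qed

lemma S_Idn: assumes u: "over u x x'" shows "S (Idn (HC A) x) (Idn (HC A) x') u u = idsq Z (mv I u)"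
proof -
  have o: "x \<in> Ob (HC A)" "x' \<in> Ob (HC A)" using over_ob[OF u] by auto
  have v: "varr A u x x'" "mo F x' = mo F x" "mv F u = Idn (VC B) (mo F x)" using u by (auto simp: over_def)
  have "ms I (idsq A u) = S (Idn (HC A) x) (Idn (HC A) x') u u"
  proof (rule S_eqI[OF F.harr_id[OF o(1)] F.harr_id[OF o(2)] u u _ F.sq_idsq[OF v(1)] _ refl refl])
    show "mh F (Idn (HC A) x) = mh F (Idn (HC A) x')" by (simp add: dfun_hid[OF dF] o v)
    show "ms F (idsq A u) = esq B (mh F (Idn (HC A) x))"
      using dfun_idsq[OF dF v(1)] dcat.esq_Idn[OF B dfun_ob[OF dF o(1)]] v dfun_hid[OF dF o(1)] by simp
  qed
  then show ?thesis using dfun_idsq[OF I v(1)] by simp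
qed

lemma functor_I: "is_functor (HC A) (HC Z) (mo I) (mh I)"
  using I by (simp add: dfun_def)

lemma gens_ar: "g \<in> G \<Longrightarrow> gv g \<in> Ar (HC Z) \<and> Dm (HC Z) (gv g) = mo I (gd g) \<and> Cd (HC Z) (gv g) = mo I (gc g)"
  using gens I_ob by (auto simp: harr_def)

lemma vw_ob: "vw w x y \<Longrightarrow> x \<in> Ob (HC A) \<and> y \<in> Ob (HC A)"
  using vword_ob[OF F.cats(1)] by metis

lemma ev_harr: assumes "vw w x y" shows "harr Z (ev w) x y"
proof -
  have i: "vw (End (Idn (HC A) y)) y y" using category_Idn[OF F.cats(1)] vw_ob[OF assms] by simp
  then show ?thesis
  using evw_jn(2)[OF assms i F.cats(1) Z.cats(1) functor_I gens_ar] vw_ob[OF assms] I_ob by (simp add: harr_def)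
qed

lemma ev_jw: "vw w x y \<Longrightarrow> vw w' y z \<Longrightarrow> ev (jw w w') = Cmp (HC Z) (ev w) (ev w')"
  by (rule evw_jn(1)[OF _ _ F.cats(1) Z.cats(1) functor_I gens_ar])

text \<open>Letters are compared by connecting squares and generators by identity squares, so all
  inner sides are identities and only \<open>u\<close> and \<open>v\<close> are free. The value
  \<open>undefined\<close> concerns words that are not parallel.\<close>

primrec T :: "'u \<Rightarrow> 'u \<Rightarrow> ('u, 'g) word \<Rightarrow> ('u, 'g) word \<Rightarrow> 'u" where
  "T u v (End m) w' = (case w' of End m' \<Rightarrow> S m m' u v | _ \<Rightarrow> undefined)"
| "T u v (Step m g w) w' = (case w' of Step m' _ q \<Rightarrow>
     beside Z (S m m' u (Idn (VC A) (gd g))) (beside Z (esq Z (gv g)) (T (Idn (VC A) (gc g)) v w q)) | _ \<Rightarrow> undefined)"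

lemma I_vid: "x \<in> Ob (HC A) \<Longrightarrow> mv I (Idn (VC A) x) = Idn (VC Z) x"
  using dfun_vid[OF I] I_ob by simp

lemma sq_gens: "g \<in> G \<Longrightarrow> sq Z (esq Z (gv g)) (gv g) (gv g) (mv I (Idn (VC A) (gd g))) (mv I (Idn (VC A) (gc g)))"
  using Z.sq_esq[OF gens(3)] I_vid gens by simp

lemma T_sq:
  assumes "vw w x y" "vw w' x' y'" "pr w w'" "over u x x'" "over v y y'"
  shows "sq Z (T u v w w') (ev w) (ev w') (mv I u) (mv I v)"
  using assms
proof (induction w arbitrary: w' x x' u)
  case (End m)
  then show ?case using S[of m x y] by (auto simp: harr_def)
next
  case (Step m g w)
  then obtain m' q where w': "w' = Step m' g q" "mh F m = mh F m'" "pr w q" by auto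
  have g: "g \<in> G" and m: "harr A m x (gd g)" "harr A m' x' (gd g)" and v: "vw w (gc g) y" "vw q (gc g) y'"
    using Step.prems w' by (auto simp: harr_def)
  note s = S[OF m Step.prems(4) over_Idn[OF gens(1)[OF g]] w'(2)]
  note r = Step.IH[OF v w'(3) over_Idn[OF gens(2)[OF g]] Step.prems(5)]
  show ?case using Z.sq_beside[OF s Z.sq_beside[OF sq_gens[OF g] r]] by (simp add: w'(1))
qed

text \<open>Interchange cuts two stacked rows into columns, one for each letter or generator. The
  new outer sides \<open>p\<close> and \<open>q\<close> are matched with composites in
  \<open>Z\<close> only, so that \<open>l\<close> followed by \<open>l'\<close> may be replaced by
  an identity.\<close>

lemma T_above:
  assumes "vw w x y" "vw w' x' y'" "vw w'' x'' y''" "pr w w'" "pr w' w''" "over u x x'" "over v y y'" "over u' x' x''" "over v' y' y''"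
    "over p x x''" "over q y y''" "mv I p = Cmp (VC Z) (mv I u) (mv I u')" "mv I q = Cmp (VC Z) (mv I v) (mv I v')"
  shows "above Z (T u v w w') (T u' v' w' w'') = T p q w w''"
  using assms
proof (induction w arbitrary: w' w'' x x' x'' u u' p)
  case (End m)
  then show ?case by (auto simp: harr_def intro!: S_above[of _ x y _ x' y' _ x'' y''])
next
  case (Step m g w)
  then obtain m' k where w': "w' = Step m' g k" "mh F m = mh F m'" "pr w k" by auto
  with Step.prems obtain m'' k' where w'': "w'' = Step m'' g k'" "mh F m' = mh F m''" "pr k k'" by auto
  have g: "g \<in> G" and m: "harr A m x (gd g)" "harr A m' x' (gd g)" "harr A m'' x'' (gd g)"
    and v: "vw w (gc g) y" "vw k (gc g) y'" "vw k' (gc g) y''"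
    using Step.prems w' w'' by (auto simp: harr_def)
  note od = over_Idn[OF gens(1)[OF g]] and oc = over_Idn[OF gens(2)[OF g]]
  have idI: "mv I (Idn (VC A) o') = Cmp (VC Z) (mv I (Idn (VC A) o')) (mv I (Idn (VC A) o'))" if "o' \<in> Ob (HC A)" for o'
    using I_vid[OF that] Z.varr_idl[OF Z.varr_id] that obZ by simp
  note s = S[OF m(1,2) Step.prems(6) od w'(2)] S[OF m(2,3) Step.prems(8) od w''(2)]
  note t = T_sq[OF v(1,2) w'(3) oc Step.prems(7)] T_sq[OF v(2,3) w''(3) oc Step.prems(9)]
  note G = sq_gens[OF g]
  have ge: "above Z (esq Z (gv g)) (esq Z (gv g)) = esq Z (gv g)" by (rule Z.above_esq[OF G])
  have S1: "above Z (S m m' u (Idn (VC A) (gd g))) (S m' m'' u' (Idn (VC A) (gd g))) = S m m'' p (Idn (VC A) (gd g))"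
    by (rule S_above[OF m Step.prems(6) od Step.prems(8) od w'(2) w''(2) Step.prems(10) od Step.prems(12) idI[OF gens(1)[OF g]]])
  have T1: "above Z (T (Idn (VC A) (gc g)) v w k) (T (Idn (VC A) (gc g)) v' k k') = T (Idn (VC A) (gc g)) q w k'"
    by (rule Step.IH[OF v w'(3) w''(3) oc Step.prems(7) oc Step.prems(9) oc Step.prems(11) idI[OF gens(2)[OF g]] Step.prems(13)])
  show ?case
    using Z.interchange[OF s(1) Z.sq_beside[OF G t(1)] s(2) Z.sq_beside[OF G t(2)]]
      Z.interchange[OF G t(1) G t(2)] S1 T1 ge by (simp add: w' w'')
qed

lemma T_refl: "vw w x y \<Longrightarrow> T (Idn (VC A) x) (Idn (VC A) y) w w = esq Z (ev w)"
proof (induction w arbitrary: x)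
  case (End m)
  then show ?case using S_refl[of m x y] by (simp add: harr_def)
next
  case (Step m g w)
  then have m: "harr A m x (gd g)" and g: "g \<in> G" and w: "vw w (gc g) y" by (auto simp: harr_def)
  have m': "harr Z (mh I m) x (gd g)" using dfun_harr[OF I m] I_ob F.harr_ob[OF m] by simp
  show ?case
    using S_refl[OF m] Step.IH[OF w] Z.esq_comp[OF m' Z.harr_comp[OF gens(3)[OF g] ev_harr[OF w]]]
      Z.esq_comp[OF gens(3)[OF g] ev_harr[OF w]] by simp
qed

text \<open>The letters that meet at the junction are multiplied, so their connecting squares must
  paste to a single one; the common side \<open>v\<close> makes this possible.\<close>

lemma T_jw:
  assumes "vw w x y" "vw w' x' y'" "vw p y z" "vw p' y' z'" "pr w w'" "pr p p'" "over u x x'" "over v y y'" "over k z z'"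
  shows "T u k (jw w p) (jw w' p') = beside Z (T u v w w') (T v k p p')"
  using assms
proof (induction w arbitrary: w' x x' u)
  case (End m)
  then obtain m' where w': "w' = End m'" "mh F m = mh F m'" by auto
  have m: "harr A m x y" "harr A m' x' y'" using End.prems w' by (auto simp: harr_def)
  show ?case
  proof (cases p)
    case (End n)
    with End.prems obtain n' where p': "p' = End n'" "mh F n = mh F n'" by auto
    have n: "harr A n y z" "harr A n' y' z'" using End.prems End p' by (auto simp: harr_def)
    show ?thesis using S_beside[OF m(1) n(1) m(2) n(2) End.prems(7,8,9) w'(2) p'(2)] by (simp add: w' p' End)
  next
    case (Step n g q)
    with End.prems obtain n' q' where p': "p' = Step n' g q'" "mh F n = mh F n'" "pr q q'" by auto
    have n: "harr A n y (gd g)" "harr A n' y' (gd g)" and g: "g \<in> G" and q: "vw q (gc g) z" "vw q' (gc g) z'"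
       using End.prems Step p' by (auto simp: harr_def)
    note od = over_Idn[OF gens(1)[OF g]] and oc = over_Idn[OF gens(2)[OF g]]
    note r = Z.sq_beside[OF sq_gens[OF g] T_sq[OF q p'(3) oc End.prems(9)]]
    show ?thesis
      using S_beside[OF m(1) n(1) m(2) n(2) End.prems(7,8) od w'(2) p'(2)]
        Z.beside_assoc[OF S[OF m End.prems(7,8) w'(2)] S[OF n End.prems(8) od p'(2)] r]
      by (simp add: w' p' Step)
  qed
next
  case (Step m g w)
  then obtain m' r where w': "w' = Step m' g r" "mh F m = mh F m'" "pr w r" by auto
  have g: "g \<in> G" and m: "harr A m x (gd g)" "harr A m' x' (gd g)" and v: "vw w (gc g) y" "vw r (gc g) y'"
    using Step.prems w' by (auto simp: harr_def)
  note od = over_Idn[OF gens(1)[OF g]] and oc = over_Idn[OF gens(2)[OF g]]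
  note s = S[OF m Step.prems(7) od w'(2)]
  note t1 = T_sq[OF v w'(3) oc Step.prems(8)] and t2 = T_sq[OF Step.prems(3,4,6,8,9)]
  note G = sq_gens[OF g]
  show ?case
    using Step.IH[OF v Step.prems(3,4) w'(3) Step.prems(6) oc Step.prems(8,9)]
      Z.beside_assoc[OF s Z.sq_beside[OF G t1] t2] Z.beside_assoc[OF G t1 t2]
    by (simp add: w')
qed

lemma nw:
  assumes "vw w x y" "a \<in> Ob (HC A)" "z \<in> Ob (HC A)" "mo F a = mo F x" "mo F z = mo F y"
  shows "vw (nw a z w) a z" "pr (nw a z w) w"
proof -
  have "vw (nw a z w) a z \<and> pr (nw a z w) w"
    using assms
  proof (induction w arbitrary: x a)
    case (End m)
    then have "harr B (mh F m) (mo F a) (mo F z)" using dfun_harr[OF dF, of m x y] by (simp add: harr_def)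
    then show ?case using ch[of "mh F m" a z] End by (simp add: harr_def)
  next
    case (Step m g w)
    then have "harr B (mh F m) (mo F a) (mo F (gd g))" using dfun_harr[OF dF, of m x "gd g"] by (simp add: harr_def)
    moreover have "vw w (gc g) y" "g \<in> G" using Step.prems by auto
    ultimately show ?case using ch[of "mh F m" a "gd g"] Step.IH[of "gc g" "gc g"] Step.prems gens by (simp add: harr_def)
  qed
  then show "vw (nw a z w) a z" "pr (nw a z w) w" by auto
qed

end

section \<open>Normal forms of arrows in a free extension, and conjugation by their connecting
  squares\<close>

context word_data
begin

definition wd :: "'u \<Rightarrow> ('u, 'g) word" where
  "wd f = (THE w. vw w (Dm (HC Z) f) (Cd (HC Z) f) \<and> ev w = f)"

lemma wd: assumes "harr Z f x y" shows "vw (wd f) x y" "ev (wd f) = f"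
  using theI'[OF free[OF assms]] assms by (auto simp: wd_def harr_def)

lemma wd_ev: assumes w: "vw w x y" shows "wd (ev w) = w"
  using free[OF ev_harr[OF w]] wd[OF ev_harr[OF w]] w by blast

definition nf :: "'u \<Rightarrow> ('u, 'g) word" where
  "nf f = nw (n0 (Dm (HC Z) f)) (n0 (Cd (HC Z) f)) (wd f)"

definition wH :: "'u \<Rightarrow> 'u" where "wH f = ev (nf f)"

definition wrho :: "'u \<Rightarrow> 'u" where
  "wrho f = T (l (Dm (HC Z) f)) (l (Cd (HC Z) f)) (nf f) (wd f)"

definition wrhoi :: "'u \<Rightarrow> 'u" where
  "wrhoi f = T (l' (Dm (HC Z) f)) (l' (Cd (HC Z) f)) (wd f) (nf f)"

lemma nf_eq: "harr Z f x y \<Longrightarrow> nf f = nw (n0 x) (n0 y) (wd f)"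
  by (auto simp: nf_def harr_def)

lemma wrho_eq: "harr Z f x y \<Longrightarrow> wrho f = T (l x) (l y) (nf f) (wd f)"
  by (auto simp: wrho_def harr_def)

lemma wrhoi_eq: "harr Z f x y \<Longrightarrow> wrhoi f = T (l' x) (l' y) (wd f) (nf f)"
  by (auto simp: wrhoi_def harr_def)

lemma harr_Z_ob: "harr Z f x y \<Longrightarrow> x \<in> Ob (HC A) \<and> y \<in> Ob (HC A)"
  using Z.harr_ob obZ by auto

lemma nf: assumes f: "harr Z f x y" shows "vw (nf f) (n0 x) (n0 y)" "pr (nf f) (wd f)"
  unfolding nf_eq[OF f] using nw[OF wd(1)[OF f]] harr_Z_ob[OF f] n0 by auto

lemma wH: assumes f: "harr Z f x y" shows "harr Z (wH f) (n0 x) (n0 y)"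
  unfolding wH_def by (rule ev_harr[OF nf(1)[OF f]])

lemma wd_wH: assumes f: "harr Z f x y" shows "wd (wH f) = nf f"
  unfolding wH_def by (rule wd_ev[OF nf(1)[OF f]])

text \<open>A normal word is parallel to the word it came from, and normalising depends on a word
  only up to parallelism.\<close>

lemma nf_wH: assumes f: "harr Z f x y" shows "nf (wH f) = nf f"
  unfolding nf_eq[OF wH[OF f]] wd_wH[OF f] 
  using nword_par[OF nf(2)[OF f], of ch gd gc "n0 x" "n0 y"] nf_eq[OF f] n0 harr_Z_ob[OF f] by simp

lemma par_jw:
  assumes "vw w x y" "vw w' x' y'" "vw p y z" "vw p' y' z'" "pr w w'" "pr p p'"
  shows "pr (jw w p) (jw w' p')"
  using assms
proof (induction w arbitrary: w' x x')
  case (End m)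
  then obtain m' where w': "w' = End m'" "mh F m = mh F m'" by auto
  show ?case
  proof (cases p)
    case (End n)
    then show ?thesis using \<open>vw (End m) x y\<close> End.prems w' dfun_hcomp[OF dF] by (auto simp: harr_def)
  next
    case (Step n g q)
    then show ?thesis using \<open>vw (End m) x y\<close> End.prems w' dfun_hcomp[OF dF] by (auto simp: harr_def)
  qed
qed auto

lemma I_l: "x \<in> Ob (HC A) \<Longrightarrow> varr Z (mv I (l x)) (n0 x) x" "x \<in> Ob (HC A) \<Longrightarrow> varr Z (mv I (l' x)) x (n0 x)"
  using dfun_varr[OF I l(1)] dfun_varr[OF I l'(1)] I_ob n0 by simp_all

lemma wrho: assumes f: "harr Z f x y" shows "sq Z (wrho f) (wH f) f (mv I (l x)) (mv I (l y))"
  unfolding wrho_eq[OF f] wH_def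
  using T_sq[OF nf(1)[OF f] wd(1)[OF f] nf(2)[OF f] over_l(1) over_l(1)] wd(2)[OF f] harr_Z_ob[OF f] by simp

lemma wrhoi: assumes f: "harr Z f x y" shows "sq Z (wrhoi f) f (wH f) (mv I (l' x)) (mv I (l' y))"
  unfolding wrhoi_eq[OF f] wH_def
  using T_sq[OF wd(1)[OF f] nf(1)[OF f] par_sym[OF nf(2)[OF f]] over_l(2) over_l(2)] wd(2)[OF f] harr_Z_ob[OF f] by simp

lemma l_n0: "x \<in> Ob (HC A) \<Longrightarrow> over (Idn (VC A) (n0 x)) (n0 x) (n0 x)"
  using over_Idn n0 by simp

text \<open>The composite compares a word with itself: the outer sides cancel in \<open>Z\<close>,
  so \<open>T_refl\<close> applies.\<close>

lemma wrho_wrhoi: assumes f: "harr Z f x y" shows "above Z (wrho f) (wrhoi f) = esq Z (wH f)"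
proof -
  have o: "x \<in> Ob (HC A)" "y \<in> Ob (HC A)" using harr_Z_ob[OF f] by auto
  show ?thesis
    unfolding wrho_eq[OF f] wrhoi_eq[OF f] wH_def T_refl[OF nf(1)[OF f], symmetric]
    by (rule T_above[OF nf(1)[OF f] wd(1)[OF f] nf(1)[OF f] nf(2)[OF f] par_sym[OF nf(2)[OF f]] over_l(1) over_l(1) over_l(2) over_l(2) l_n0 l_n0])
      (use o l_l' I_vid n0 in simp_all)
qed

lemma wrhoi_wrho: assumes f: "harr Z f x y" shows "above Z (wrhoi f) (wrho f) = esq Z f"
proof -
  have o: "x \<in> Ob (HC A)" "y \<in> Ob (HC A)" using harr_Z_ob[OF f] by auto
  have "above Z (wrhoi f) (wrho f) = T (Idn (VC A) x) (Idn (VC A) y) (wd f) (wd f)"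
    unfolding wrho_eq[OF f] wrhoi_eq[OF f]
    by (rule T_above[OF wd(1)[OF f] nf(1)[OF f] wd(1)[OF f] par_sym[OF nf(2)[OF f]] nf(2)[OF f] over_l(2) over_l(2) over_l(1) over_l(1) over_Idn over_Idn])
      (use o l_l' I_vid n0 in simp_all)
  then show ?thesis using T_refl[OF wd(1)[OF f]] wd(2)[OF f] by simp
qed

lemma wd_comp: assumes f: "harr Z f x y" and g: "harr Z g y z" shows "wd (Cmp (HC Z) f g) = jw (wd f) (wd g)"
proof -
  note w = wd[OF f] and v = wd[OF g]
  have "Cmp (HC Z) f g = ev (jw (wd f) (wd g))" using ev_jw[OF w(1) v(1)] w v by simp
  then show ?thesis using wd_ev[OF vword_jn[OF F.cats(1) w(1) v(1)]] by simp
qed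

text \<open>Joined normal words are parallel to the joined words, hence have the same normal form.
  Both sides therefore compare this normal form with the word of the composite, and the right-hand
  side merely factors the comparison through the joined normal words.\<close>

lemma wrho_comp: assumes f: "harr Z f x y" and g: "harr Z g y z"
  shows "wrho (Cmp (HC Z) f g) = above Z (wrho (Cmp (HC Z) (wH f) (wH g))) (beside Z (wrho f) (wrho g))"
proof -
  have o: "x \<in> Ob (HC A)" "y \<in> Ob (HC A)" "z \<in> Ob (HC A)" using harr_Z_ob[OF f] harr_Z_ob[OF g] by auto
  note fg = Z.harr_comp[OF f g] and n = Z.harr_comp[OF wH[OF f] wH[OF g]]
  note w = wd(1)[OF f] wd(1)[OF g] nf(1)[OF f] nf(1)[OF g] and p = nf(2)[OF f] nf(2)[OF g]
  have wn: "wd (Cmp (HC Z) (wH f) (wH g)) = jw (nf f) (nf g)"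
    using wd_comp[OF wH[OF f] wH[OF g]] wd_wH[OF f] wd_wH[OF g] by simp
  have pj: "pr (jw (nf f) (nf g)) (jw (wd f) (wd g))" by (rule par_jw[OF w(3,1,4,2) p])
  have nn: "nf (Cmp (HC Z) (wH f) (wH g)) = nf (Cmp (HC Z) f g)"
    unfolding nf_eq[OF n] nf_eq[OF fg] wn wd_comp[OF f g] using nword_par[OF pj] n0 o by simp
  have "beside Z (wrho f) (wrho g) = T (l x) (l z) (jw (nf f) (nf g)) (jw (wd f) (wd g))"
    unfolding wrho_eq[OF f] wrho_eq[OF g]
    by (rule T_jw[OF w(3,1,4,2) p over_l(1) over_l(1) over_l(1), symmetric]) (use o in auto)
  moreover have "above Z (T (l (n0 x)) (l (n0 z)) (nf (Cmp (HC Z) f g)) (jw (nf f) (nf g)))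
     (T (l x) (l z) (jw (nf f) (nf g)) (jw (wd f) (wd g))) = T (l x) (l z) (nf (Cmp (HC Z) f g)) (jw (wd f) (wd g))"
  proof (rule T_above[OF nf(1)[OF fg] vword_jn[OF F.cats(1) w(3,4)] vword_jn[OF F.cats(1) w(1,2)] _ pj _ _ over_l(1) over_l(1) over_l(1) over_l(1)])
    show "pr (nf (Cmp (HC Z) f g)) (jw (nf f) (nf g))" using nf(2)[OF n] nn wn by simp
    show "over (l (n0 x)) (n0 x) (n0 x)" "over (l (n0 z)) (n0 z) (n0 z)" using o l(3) over_Idn n0 by auto
    show "mv I (l x) = Cmp (VC Z) (mv I (l (n0 x))) (mv I (l x))" "mv I (l z) = Cmp (VC Z) (mv I (l (n0 z))) (mv I (l z))"
      using o l(3) I_vid n0 Z.varr_idl[OF I_l(1)] by auto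
  qed (use o in auto)
  ultimately show ?thesis
    unfolding wrho_eq[OF fg] wrho_eq[OF n] nn wn wd_comp[OF f g] by simp
qed

lemma wd_Idn: assumes x: "x \<in> Ob (HC A)" shows "wd (Idn (HC Z) x) = End (Idn (HC A) x)"
proof -
  have "vw (End (Idn (HC A) x)) x x" using F.harr_id[OF x] by (simp add: harr_def)
  from wd_ev[OF this] show ?thesis using dfun_hid[OF I x] I_ob[OF x] by simp
qed

lemma wrho_Idn: assumes x: "x \<in> Ob (HC A)" shows "wrho (Idn (HC Z) x) = idsq Z (mv I (l x))"
proof -
  have i: "harr Z (Idn (HC Z) x) x x" using Z.harr_id x obZ by simp
  have "nf (Idn (HC Z) x) = End (Idn (HC A) (n0 x))"
    using ch_Idn[of "n0 x"] n0 x by (simp add: nf_eq[OF i] wd_Idn[OF x] dfun_hid[OF dF])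
  then show ?thesis using S_Idn[OF over_l(1)[OF x]] by (simp add: wrho_eq[OF i] wd_Idn[OF x])
qed

sublocale N: conj_data Z n0 "\<lambda>x. mv I (l x)" "\<lambda>x. mv I (l' x)" wH wrho wrhoi
proof unfold_locales
  fix x assume "x \<in> Ob (HC Z)" then have x: "x \<in> Ob (HC A)" using obZ by simp
  show "n0 x \<in> Ob (HC Z)" "n0 (n0 x) = n0 x" using n0 x obZ by auto
  show "varr Z (mv I (l x)) (n0 x) x" "varr Z (mv I (l' x)) x (n0 x)" using I_l x by auto
  show "Cmp (VC Z) (mv I (l x)) (mv I (l' x)) = Idn (VC Z) (n0 x)" "Cmp (VC Z) (mv I (l' x)) (mv I (l x)) = Idn (VC Z) x" using l_l' x by auto
  show "mv I (l (n0 x)) = Idn (VC Z) (n0 x)" using l(3) x I_vid n0 by auto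
  show "wrho (Idn (HC Z) x) = idsq Z (mv I (l x))" by (rule wrho_Idn[OF x])
next
  fix f x y assume f: "harr Z f x y"
  show "harr Z (wH f) (n0 x) (n0 y)" by (rule wH[OF f])
  show "sq Z (wrho f) (wH f) f (mv I (l x)) (mv I (l y))" by (rule wrho[OF f])
  show "sq Z (wrhoi f) f (wH f) (mv I (l' x)) (mv I (l' y))" by (rule wrhoi[OF f])
  show "above Z (wrho f) (wrhoi f) = esq Z (wH f)" by (rule wrho_wrhoi[OF f])
  show "above Z (wrhoi f) (wrho f) = esq Z f" by (rule wrhoi_wrho[OF f])
  show "wH (wH f) = wH f" using nf_wH[OF f] by (simp add: wH_def)
  have "wrho (wH f) = T (Idn (VC A) (n0 x)) (Idn (VC A) (n0 y)) (nf f) (nf f)"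
    unfolding wrho_eq[OF wH[OF f]] nf_wH[OF f] wd_wH[OF f] using l(3) harr_Z_ob[OF f] by simp
  then show "wrho (wH f) = esq Z (wH f)" using T_refl[OF nf(1)[OF f]] by (simp add: wH_def)
  show "wrho (Cmp (HC Z) f g) = above Z (wrho (Cmp (HC Z) (wH f) (wH g))) (beside Z (wrho f) (wrho g))" if "harr Z g y z" for g z
    by (rule wrho_comp[OF f that])
qed

lemma wd_I: assumes m: "harr A m x y" shows "wd (mh I m) = End m"
proof -
  have "vw (End m) x y" using m by (simp add: harr_def)
  from wd_ev[OF this] show ?thesis by simp
qed

lemma I_harr: "harr A m x y \<Longrightarrow> harr Z (mh I m) x y"
  using dfun_harr[OF I, of m x y] F.harr_ob I_ob by metis

lemma wH_I: assumes m: "harr A m x y" shows "wH (mh I m) = mh I (ch (mh F m) (n0 x) (n0 y))"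
  by (simp add: wH_def nf_eq[OF I_harr[OF m]] wd_I[OF m])

lemma wH_I_const:
  assumes "harr A m x y" "harr A m' x' y'" "mh F m = mh F m'" "n0 x = n0 x'" "n0 y = n0 y'"
  shows "wH (mh I m) = wH (mh I m')"
  using assms by (simp add: wH_I)

text \<open>The arrows needed are lifts of the identity at \<open>mo F x\<close> between
  \<open>n0 x\<close> and \<open>x\<close>. Being single letters, they normalise to the preferred
  lift at \<open>n0 x\<close>, which is the identity.\<close>

lemma dctf_N: "dctf Z (fixdbl Z N.conjmap) N.conjmap"
proof (rule N.dctf_conjmap)
  fix x assume "x \<in> Ob (HC Z)" then have x: "x \<in> Ob (HC A)" using obZ by simp
  have e: "mo F (n0 x) = mo F x" using n0 x by simp
  have i: "harr B (Idn (HC B) (mo F x)) (mo F x) (mo F x)" by (rule dcat.harr_id[OF B dfun_ob[OF dF x]])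
  define k where "k = ch (Idn (HC B) (mo F x)) (n0 x) x"
  define k' where "k' = ch (Idn (HC B) (mo F x)) x (n0 x)"
  have k: "harr A k (n0 x) x" "mh F k = Idn (HC B) (mo F x)" and k': "harr A k' x (n0 x)" "mh F k' = Idn (HC B) (mo F x)"
    unfolding k_def k'_def using ch[of "Idn (HC B) (mo F x)"] i e x n0 by auto
  have "wH (mh I k) = Idn (HC Z) (n0 x)" "wH (mh I k') = Idn (HC Z) (n0 x)"
    unfolding wH_I[OF k(1)] wH_I[OF k'(1)] k(2) k'(2)
    using ch_Idn[of "n0 x"] e n0 x dfun_hid[OF I] I_ob by simp_all
  then show "\<exists>k k'. harr Z k (n0 x) x \<and> wH k = Idn (HC Z) (n0 x) \<and> harr Z k' x (n0 x) \<and> wH k' = Idn (HC Z) (n0 x)"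
    using I_harr[OF k(1)] I_harr[OF k'(1)] by blast
qed

text \<open>For squares coming from \<open>A\<close> the conjugation can already be carried out in
  \<open>A\<close>, where images under \<open>F\<close> can be compared.\<close>

definition conjA :: "'u \<Rightarrow> 'u" where
  "conjA \<alpha> = (let t = tp A \<alpha>; b = bt A \<alpha>; x = Dm (HC A) t; y = Cd (HC A) t; x' = Dm (HC A) b; y' = Cd (HC A) b in
     above A (above A (sqe (ch (mh F t) (n0 x) (n0 y)) t (l x) (l y)) \<alpha>) (sqe b (ch (mh F b) (n0 x') (n0 y')) (l' x') (l' y')))"

lemma conjA:
  assumes a: "sq A \<alpha> t b u v" and t: "harr A t x y" and b: "harr A b x' y'"
  shows "sq A (conjA \<alpha>) (ch (mh F t) (n0 x) (n0 y)) (ch (mh F b) (n0 x') (n0 y'))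
      (Cmp (VC A) (Cmp (VC A) (l x) u) (l' x')) (Cmp (VC A) (Cmp (VC A) (l y) v) (l' y'))" (is ?S)
    and "ms F (conjA \<alpha>) = ms F \<alpha>" (is ?F)
    and "N.nS (ms I \<alpha>) = ms I (conjA \<alpha>)" (is ?N)
    and "mv I (Cmp (VC A) (Cmp (VC A) (l x) u) (l' x')) = N.nV (mv I u)"
    and "mv I (Cmp (VC A) (Cmp (VC A) (l y) v) (l' y')) = N.nV (mv I v)"
proof -
  note o = F.harr_ob[OF t] F.harr_ob[OF b]
  note uv = F.sq_harr[OF a t b]
  let ?t = "ch (mh F t) (n0 x) (n0 y)" and ?b = "ch (mh F b) (n0 x') (n0 y')"
  have ct: "harr A ?t (n0 x) (n0 y)" "mh F ?t = mh F t" using ch dfun_harr[OF dF t] n0 o by auto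
  have cb: "harr A ?b (n0 x') (n0 y')" "mh F ?b = mh F b" using ch dfun_harr[OF dF b] n0 o by auto
  note s = sqe[OF ct(1) t over_l(1)[OF o(1)] over_l(1)[OF o(2)] ct(2)]
  note s' = sqe[OF b cb(1) over_l(2)[OF o(3)] over_l(2)[OF o(4)] cb(2)[symmetric]]
  have c: "conjA \<alpha> = above A (above A (sqe ?t t (l x) (l y)) \<alpha>) (sqe b ?b (l' x') (l' y'))"
    using a t b by (auto simp: conjA_def sq_def harr_def Let_def)
  note sa = F.sq_above[OF s(1) a]
  show ?S unfolding c by (rule F.sq_above[OF sa s'(1)])
  note fa = dfun_sq[OF dF a]
  show ?F unfolding c dfun_above[OF dF sa s'(1)] dfun_above[OF dF s(1) a] s(2) s'(2) ct(2)
    using dcat.esq_above[OF B fa] dcat.above_esq[OF B fa] by simp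
  note ia = dfun_sq[OF I a]
  have "ms I (conjA \<alpha>) = above Z (above Z (S ?t t (l x) (l y)) (ms I \<alpha>)) (S b ?b (l' x') (l' y'))"
    unfolding c dfun_above[OF I sa s'(1)] dfun_above[OF I s(1) a] S_def ..
  also have "S ?t t (l x) (l y) = wrho (mh I t)"
    unfolding wrho_eq[OF I_harr[OF t]] nf_eq[OF I_harr[OF t]] wd_I[OF t] by simp
  also have "S b ?b (l' x') (l' y') = wrhoi (mh I b)"
    unfolding wrhoi_eq[OF I_harr[OF b]] nf_eq[OF I_harr[OF b]] wd_I[OF b] by simp
  finally show ?N unfolding N.nS_eq[OF ia] ..
  have v: "mv I (Cmp (VC A) (Cmp (VC A) (l p) k) (l' q)) = N.nV (mv I k)" if k: "varr A k p q" for k p q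
  proof -
    note pq = F.varr_ob[OF k]
    have ik: "varr Z (mv I k) p q" using dfun_varr[OF I k] I_ob pq by simp
    show ?thesis
      unfolding N.nV_eq[OF ik] dfun_vcomp[OF I F.varr_comp[OF l(1)[OF pq(1)] k] l'(1)[OF pq(2)]]
        dfun_vcomp[OF I l(1)[OF pq(1)] k] ..
  qed
  show "mv I (Cmp (VC A) (Cmp (VC A) (l x) u) (l' x')) = N.nV (mv I u)"
    "mv I (Cmp (VC A) (Cmp (VC A) (l y) v) (l' y')) = N.nV (mv I v)" using v uv by auto
qed

text \<open>The conjugates formed in \<open>A\<close> have the same image under \<open>F\<close>,
  the same chosen top and bottom, and sides that \<open>I\<close> identifies; so
  \<open>collapse\<close> applies.\<close>

lemma nS_I_const:
  assumes a: "sq A \<alpha> t b u v" "harr A t x y" "harr A b x' y'" and c: "sq A \<beta> p q r s" "harr A p z w" "harr A q z' w'"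
    and e: "ms F \<alpha> = ms F \<beta>" and n: "n0 x = n0 z" "n0 y = n0 w" "n0 x' = n0 z'" "n0 y' = n0 w'"
    and V: "N.nV (mv I u) = N.nV (mv I r)" "N.nV (mv I v) = N.nV (mv I s)"
  shows "N.nS (ms I \<alpha>) = N.nS (ms I \<beta>)"
proof -
  have "mh F t = mh F p" "mh F b = mh F q" using dfun_sq[OF dF a(1)] dfun_sq[OF dF c(1)] e by (auto simp: sq_def)
  then have 1: "sq A (conjA \<alpha>) (ch (mh F p) (n0 z) (n0 w)) (ch (mh F q) (n0 z') (n0 w'))
      (Cmp (VC A) (Cmp (VC A) (l x) u) (l' x')) (Cmp (VC A) (Cmp (VC A) (l y) v) (l' y'))"
    using conjA(1)[OF a] n by simp
  show ?thesis
    unfolding conjA(3)[OF a] conjA(3)[OF c]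
    by (rule collapse[OF 1 conjA(1)[OF c]]) (simp_all add: conjA(2,4,5)[OF a] conjA(2,4,5)[OF c] e V)
qed

text \<open>If \<open>K\<close> after \<open>I\<close> respects the fibres of \<open>F\<close>, it
  sends arrows over identities to identities and connecting squares to identity squares, first for
  letters and then for words. Conjugation by identities changes nothing, so \<open>K\<close> does
  not see the normalisation.\<close>

lemma meq_conjmap:
  assumes K: "dfun Z Y K" and c: "mconst A F (mcomp I K)"
  shows "meq Z (mcomp N.conjmap K) K"
proof -
  interpret Y: dcat Y using dfun_dcat(2)[OF K] .
  note c = mconst_D[OF c, unfolded mcomp_sel]
  have Ko: "mo K (n0 x) = mo K x" if "x \<in> Ob (HC A)" for x
    using c(1)[of "n0 x" x] n0 that I_ob by simp
  \<comment> \<open>\<open>u\<close> and the identity at \<open>x'\<close> have the same image under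
    \<open>F\<close>, so the hypothesis on \<open>K\<close> identifies them.\<close>
  have Kover: "mv K (mv I u) = Idn (VC Y) (mo K x')" if u: "over u x x'" for u x x'
  proof -
    have x: "x \<in> Ob (HC A)" "x' \<in> Ob (HC A)" using over_ob[OF u] by auto
    have u': "varr A u x x'" "mv F u = mv F (Idn (VC A) x')" using u dfun_vid[OF dF x(2)] by (auto simp: over_def)
    have "mv K (mv I u) = mv K (mv I (Idn (VC A) x'))"
      using c(3)[of u "Idn (VC A) x'"] u' F.varr_id[OF x(2)] by (simp add: varr_def)
    then show ?thesis using I_vid[OF x(2)] dfun_vid[OF K] x obZ by simp
  qed
  have KS: "ms K (S t b u v) = esq Y (mh K (mh I b))"
    if h: "harr A t x y" "harr A b x' y'" "over u x x'" "over v y y'" "mh F t = mh F b" for t b u v x y x' y'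
  proof -
    have "ms F (sqe t b u v) = ms F (esq A b)" using sqe(2)[OF h] dfun_esq[OF dF h(2)] h(5) by simp
    then have "ms K (ms I (sqe t b u v)) = ms K (ms I (esq A b))"
      using c(4) sqe(1)[OF h] F.sq_esq[OF h(2)] by (simp add: sq_def)
    then show ?thesis unfolding S_def dfun_esq[OF I h(2)] dfun_esq[OF K I_harr[OF h(2)]] .
  qed
  have KT: "ms K (T u v w w') = esq Y (mh K (ev w'))"
    if "vw w x y" "vw w' x' y'" "pr w w'" "over u x x'" "over v y y'" for u v w w' x y x' y'
    using that
  proof (induction w arbitrary: w' x x' u)
    case (End m)
    then show ?case using KS[of m x y] by (auto simp: harr_def)
  next
    case (Step m g w)
    then obtain m' q where w': "w' = Step m' g q" "mh F m = mh F m'" "pr w q" by auto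
    have g: "g \<in> G" and m: "harr A m x (gd g)" "harr A m' x' (gd g)" and v: "vw w (gc g) y" "vw q (gc g) y'"
      using Step.prems w' by (auto simp: harr_def)
    note od = over_Idn[OF gens(1)[OF g]] and oc = over_Idn[OF gens(2)[OF g]]
    note s = S[OF m Step.prems(4) od w'(2)]
    note t = T_sq[OF v w'(3) oc Step.prems(5)]
    note G = sq_gens[OF g]
    note e = ev_harr[OF v(2)] and gg = gens(3)[OF g] and im = I_harr[OF m(2)]
    note ge = Z.harr_comp[OF gg e]
    have "ms K (T u v (Step m g w) w') = beside Y (esq Y (mh K (mh I m'))) (beside Y (esq Y (mh K (gv g))) (esq Y (mh K (ev q))))"
      using dfun_beside[OF K s Z.sq_beside[OF G t]] dfun_beside[OF K G t] KS[OF m Step.prems(4) od w'(2)] dfun_esq[OF K gg]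
        Step.IH[OF v w'(3) oc Step.prems(5)] by (simp add: w')
    also have "\<dots> = esq Y (mh K (ev w'))"
      unfolding w' evw.simps dfun_hcomp[OF K im ge] dfun_hcomp[OF K gg e]
       Y.esq_comp[OF dfun_harr[OF K gg] dfun_harr[OF K e], symmetric]
       Y.esq_comp[OF dfun_harr[OF K im] Y.harr_comp[OF dfun_harr[OF K gg] dfun_harr[OF K e]], symmetric] ..
    finally show ?case .
  qed
  have Krho: "ms K (wrho f) = esq Y (mh K f)" "mh K (wH f) = mh K f" if f: "harr Z f x y" for f x y
  proof -
    have o: "x \<in> Ob (HC A)" "y \<in> Ob (HC A)" using harr_Z_ob[OF f] by auto
    show 1: "ms K (wrho f) = esq Y (mh K f)"
      using KT[OF nf(1)[OF f] wd(1)[OF f] nf(2)[OF f] over_l(1)[OF o(1)] over_l(1)[OF o(2)]] wd(2)[OF f] wrho_eq[OF f] by simp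
    show "mh K (wH f) = mh K f"
      using dfun_sq[OF K wrho[OF f]] Y.sq_esq[OF dfun_harr[OF K f]] 1 by (simp add: sq_def)
  qed
  have Krhoi: "ms K (wrhoi f) = esq Y (mh K f)" if f: "harr Z f x y" for f x y
  proof -
    have o: "x \<in> Ob (HC A)" "y \<in> Ob (HC A)" using harr_Z_ob[OF f] by auto
    show "ms K (wrhoi f) = esq Y (mh K f)"
      using KT[OF wd(1)[OF f] nf(1)[OF f] par_sym[OF nf(2)[OF f]] over_l(2)[OF o(1)] over_l(2)[OF o(2)]] Krho(2)[OF f] wrhoi_eq[OF f]
      by (simp add: wH_def)
  qed
  have KV: "mv K (N.nV u) = mv K u" if u: "varr Z u x y" for u x y
  proof -
    have o: "x \<in> Ob (HC A)" "y \<in> Ob (HC A)" using Z.varr_ob[OF u] obZ by auto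
    note ku = dfun_varr[OF K u]
    have "mv K (N.nV u) = Cmp (VC Y) (Cmp (VC Y) (mv K (mv I (l x))) (mv K u)) (mv K (mv I (l' y)))"
      unfolding N.nV_eq[OF u] dfun_vcomp[OF K Z.varr_comp[OF I_l(1)[OF o(1)] u] I_l(2)[OF o(2)]] dfun_vcomp[OF K I_l(1)[OF o(1)] u] ..
    then show ?thesis
      using Kover[OF over_l(1)[OF o(1)]] Kover[OF over_l(2)[OF o(2)]] Ko[OF o(2)] Y.varr_idl[OF ku] Y.varr_idr[OF ku] by simp
  qed
  have Ks: "ms K (N.nS \<alpha>) = ms K \<alpha>" if a: "sq Z \<alpha> t b u v" for \<alpha> t b u v
  proof -
    note c = Z.sq_corners[OF a]
    note s = wrho[OF c(1)] and s' = wrhoi[OF c(2)] and ka = dfun_sq[OF K a]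
    show ?thesis
      unfolding N.nS_eq[OF a] dfun_above[OF K Z.sq_above[OF s a] s'] dfun_above[OF K s a] Krho(1)[OF c(1)] Krhoi[OF c(2)]
        Y.esq_above[OF ka] Y.above_esq[OF ka] ..
  qed
  show ?thesis
    unfolding meq_def mcomp_sel N.conjmap_sel
  proof (intro conjI ballI)
    fix x assume "x \<in> Ob (HC Z)" then show "mo K (n0 x) = mo K x" using Ko obZ by simp
  next
    fix f assume "f \<in> Ar (HC Z)" then have "harr Z f (Dm (HC Z) f) (Cd (HC Z) f)" by (simp add: harr_def)
    then show "mh K (wH f) = mh K f" by (rule Krho(2))
  next
    fix f assume "f \<in> Ar (VC Z)" then have "varr Z f (Dm (VC Z) f) (Cd (VC Z) f)" by (simp add: varr_def)
    then show "mv K (N.nV f) = mv K f" by (rule KV)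
  next
    fix \<alpha> assume "\<alpha> \<in> Sq Z" then have "sq Z \<alpha> (tp Z \<alpha>) (bt Z \<alpha>) (lft Z \<alpha>) (rgt Z \<alpha>)" by (simp add: sq_def)
    then show "ms K (N.nS \<alpha>) = ms K \<alpha>" by (rule Ks)
  qed
qed

end

section \<open>Double categories with prescribed arrows\<close>

lemma category_cong:
  assumes "category C" "Ob C = Ob D" "Ar C = Ar D" "\<And>f. f \<in> Ar C \<Longrightarrow> Dm C f = Dm D f" "\<And>f. f \<in> Ar C \<Longrightarrow> Cd C f = Cd D f"
    "Idn C = Idn D" "\<And>f g. f \<in> Ar C \<Longrightarrow> g \<in> Ar C \<Longrightarrow> Cmp C f g = Cmp D f g"
  shows "category D"
  using assms(1) category_Cmp[OF assms(1)] category_Idn[OF assms(1)] unfolding category_def assms(2,3,6)[symmetric]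
  by (simp add: assms(4,5,7)[symmetric])

text \<open>The squares of \<open>C\<close> are pulled back along functors on arrows. Since
  \<open>eH\<close> and \<open>eV\<close> need not be injective, a new square has to remember its
  boundary; \<open>cd\<close> codes the four sides together with a square of \<open>C\<close> as one
  cell.\<close>

locale pullback = C: dcat C for C :: "'u dblcat" +
  fixes H V :: "('u, 'u) category" and eo eH eV :: "'u \<Rightarrow> 'u" and cd :: "'u \<times> 'u \<times> 'u \<times> 'u \<times> 'u \<Rightarrow> 'u"
  assumes H: "category H" and V: "category V" and obV: "Ob V = Ob H"
    and eH: "is_functor H (HC C) eo eH" and eV: "is_functor V (VC C) eo eV" and cd: "inj cd"
begin

definition mk :: "'u \<Rightarrow> 'u \<Rightarrow> 'u \<Rightarrow> 'u \<Rightarrow> 'u \<Rightarrow> 'u" where "mk t b l r \<sigma> = cd (t, b, l, r, \<sigma>)"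
definition pt :: "'u \<Rightarrow> 'u" where "pt \<alpha> = (case inv cd \<alpha> of (t, b, l, r, \<sigma>) \<Rightarrow> t)"
definition pb :: "'u \<Rightarrow> 'u" where "pb \<alpha> = (case inv cd \<alpha> of (t, b, l, r, \<sigma>) \<Rightarrow> b)"
definition pl :: "'u \<Rightarrow> 'u" where "pl \<alpha> = (case inv cd \<alpha> of (t, b, l, r, \<sigma>) \<Rightarrow> l)"
definition pr :: "'u \<Rightarrow> 'u" where "pr \<alpha> = (case inv cd \<alpha> of (t, b, l, r, \<sigma>) \<Rightarrow> r)"
definition ps :: "'u \<Rightarrow> 'u" where "ps \<alpha> = (case inv cd \<alpha> of (t, b, l, r, \<sigma>) \<Rightarrow> \<sigma>)"

lemma proj [simp]: "pt (mk t b l r \<sigma>) = t" "pb (mk t b l r \<sigma>) = b" "pl (mk t b l r \<sigma>) = l" "pr (mk t b l r \<sigma>) = r" "ps (mk t b l r \<sigma>) = \<sigma>"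
  by (simp_all add: mk_def pt_def pb_def pl_def pr_def ps_def inv_f_f[OF cd])

definition psq :: "'u \<Rightarrow> 'u \<Rightarrow> 'u \<Rightarrow> 'u \<Rightarrow> 'u \<Rightarrow> bool" where
  "psq t b l r \<sigma> \<longleftrightarrow> t \<in> Ar H \<and> b \<in> Ar H \<and> l \<in> Ar V \<and> r \<in> Ar V \<and> Dm V l = Dm H t \<and> Dm V r = Cd H t \<and>
     Cd V l = Dm H b \<and> Cd V r = Cd H b \<and> sq C \<sigma> (eH t) (eH b) (eV l) (eV r)"

definition PS :: "'u set" where "PS = {\<alpha>. \<exists>t b l r \<sigma>. \<alpha> = mk t b l r \<sigma> \<and> psq t b l r \<sigma>}"

definition pdbl :: "'u dblcat" where
  "pdbl = \<lparr> HC = H, VC = V,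
     HS = \<lparr> Ob = Ar V, Ar = PS, Dm = pl, Cd = pr,
       Idn = (\<lambda>u. mk (Idn H (Dm V u)) (Idn H (Cd V u)) u u (idsq C (eV u))),
       Cmp = (\<lambda>\<alpha> \<beta>. mk (Cmp H (pt \<alpha>) (pt \<beta>)) (Cmp H (pb \<alpha>) (pb \<beta>)) (pl \<alpha>) (pr \<beta>) (beside C (ps \<alpha>) (ps \<beta>))) \<rparr>,
     VS = \<lparr> Ob = Ar H, Ar = PS, Dm = pt, Cd = pb,
       Idn = (\<lambda>f. mk f f (Idn V (Dm H f)) (Idn V (Cd H f)) (esq C (eH f))),
       Cmp = (\<lambda>\<alpha> \<beta>. mk (pt \<alpha>) (pb \<beta>) (Cmp V (pl \<alpha>) (pl \<beta>)) (Cmp V (pr \<alpha>) (pr \<beta>)) (above C (ps \<alpha>) (ps \<beta>))) \<rparr> \<rparr>"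

lemma pdbl_HV [simp]: "HC pdbl = H" "VC pdbl = V" by (simp_all add: pdbl_def)

lemma pdbl_sel [simp]: 
  "Ob (HS pdbl) = Ar V" "Sq pdbl = PS" "lft pdbl = pl" "rgt pdbl = pr"
  "idsq pdbl u = mk (Idn H (Dm V u)) (Idn H (Cd V u)) u u (idsq C (eV u))"
  "beside pdbl \<alpha> \<beta> = mk (Cmp H (pt \<alpha>) (pt \<beta>)) (Cmp H (pb \<alpha>) (pb \<beta>)) (pl \<alpha>) (pr \<beta>) (beside C (ps \<alpha>) (ps \<beta>))"
  "Ob (VS pdbl) = Ar H" "Ar (VS pdbl) = PS" "tp pdbl = pt" "bt pdbl = pb"
  "esq pdbl f = mk f f (Idn V (Dm H f)) (Idn V (Cd H f)) (esq C (eH f))"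
  "above pdbl \<alpha> \<beta> = mk (pt \<alpha>) (pb \<beta>) (Cmp V (pl \<alpha>) (pl \<beta>)) (Cmp V (pr \<alpha>) (pr \<beta>)) (above C (ps \<alpha>) (ps \<beta>))"
  by (simp_all add: pdbl_def)

lemma PS_E: assumes "\<alpha> \<in> PS" obtains t b l r \<sigma> where "\<alpha> = mk t b l r \<sigma>" "psq t b l r \<sigma>"
  using assms by (auto simp: PS_def)

lemma mk_PS [simp]: "mk t b l r \<sigma> \<in> PS \<longleftrightarrow> psq t b l r \<sigma>"
  by (auto simp: PS_def mk_def inj_eq[OF cd])

lemma eH': "x \<in> Ob H \<Longrightarrow> eH (Idn H x) = Idn (HC C) (eo x)" "f \<in> Ar H \<Longrightarrow> harr C (eH f) (eo (Dm H f)) (eo (Cd H f))"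
  "f \<in> Ar H \<Longrightarrow> g \<in> Ar H \<Longrightarrow> Cd H f = Dm H g \<Longrightarrow> eH (Cmp H f g) = Cmp (HC C) (eH f) (eH g)"
  using eH by (auto simp: is_functor_def harr_def)

lemma eV': "x \<in> Ob H \<Longrightarrow> eV (Idn V x) = Idn (VC C) (eo x)" "f \<in> Ar V \<Longrightarrow> varr C (eV f) (eo (Dm V f)) (eo (Cd V f))"
  "f \<in> Ar V \<Longrightarrow> g \<in> Ar V \<Longrightarrow> Cd V f = Dm V g \<Longrightarrow> eV (Cmp V f g) = Cmp (VC C) (eV f) (eV g)"
  using eV by (auto simp: is_functor_def varr_def obV)

lemma psq_idsq: assumes u: "u \<in> Ar V" shows "psq (Idn H (Dm V u)) (Idn H (Cd V u)) u u (idsq C (eV u))"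
  using u category_Dm_Cd[OF V u] category_Idn[OF H] C.sq_idsq[OF eV'(2)[OF u]] by (simp add: psq_def obV eH')

lemma psq_beside: assumes "psq t b l m \<sigma>" "psq t' b' m r \<tau>"
  shows "psq (Cmp H t t') (Cmp H b b') l r (beside C \<sigma> \<tau>)"
  using assms category_Cmp[OF H] by (auto simp: psq_def eH' intro: C.sq_beside)

lemma category_HS: "category (HS pdbl)"
  unfolding category_def
proof (intro conjI ballI impI)
  fix \<alpha> assume "\<alpha> \<in> Sq pdbl" then obtain t b l r \<sigma> where a: "\<alpha> = mk t b l r \<sigma>" "psq t b l r \<sigma>" by (auto elim: PS_E)
  show "lft pdbl \<alpha> \<in> Ob (HS pdbl)" "rgt pdbl \<alpha> \<in> Ob (HS pdbl)" using a by (auto simp: psq_def)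
  have s: "sq C \<sigma> (eH t) (eH b) (eV l) (eV r)" using a by (simp add: psq_def)
  show "beside pdbl (idsq pdbl (lft pdbl \<alpha>)) \<alpha> = \<alpha>" "beside pdbl \<alpha> (idsq pdbl (rgt pdbl \<alpha>)) = \<alpha>"
    using a C.idsq_beside[OF s] C.beside_idsq[OF s] category_unit[OF H] by (simp_all add: psq_def)
  fix \<beta> assume "\<beta> \<in> Sq pdbl" and "rgt pdbl \<alpha> = lft pdbl \<beta>" then obtain t' b' r' \<tau> where b: "\<beta> = mk t' b' r r' \<tau>" "psq t' b' r r' \<tau>"
    using a by (auto elim!: PS_E)
  show "beside pdbl \<alpha> \<beta> \<in> Sq pdbl" "lft pdbl (beside pdbl \<alpha> \<beta>) = lft pdbl \<alpha>" "rgt pdbl (beside pdbl \<alpha> \<beta>) = rgt pdbl \<beta>"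
    using psq_beside[OF a(2) b(2)] by (simp_all add: a(1) b(1))
  fix \<gamma> assume "\<gamma> \<in> Sq pdbl" and "rgt pdbl \<beta> = lft pdbl \<gamma>" then obtain t'' b'' r'' \<upsilon> where c: "\<gamma> = mk t'' b'' r' r'' \<upsilon>" "psq t'' b'' r' r'' \<upsilon>"
    using b by (auto elim!: PS_E)
  have s': "sq C \<tau> (eH t') (eH b') (eV r) (eV r')" "sq C \<upsilon> (eH t'') (eH b'') (eV r') (eV r'')" using b c by (simp_all add: psq_def)
  show "beside pdbl (beside pdbl \<alpha> \<beta>) \<gamma> = beside pdbl \<alpha> (beside pdbl \<beta> \<gamma>)"
    using a b c C.beside_assoc[OF s s'] category_assoc[OF H] by (simp add: psq_def)
next
  fix u assume "u \<in> Ob (HS pdbl)"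
  then show "idsq pdbl u \<in> Sq pdbl" "lft pdbl (idsq pdbl u) = u" "rgt pdbl (idsq pdbl u) = u" using psq_idsq[of u] by simp_all
qed

text \<open>Permuting the entries of the code makes the squares of the transposed construction
  literally those of the original one.\<close>

lemma pullback_transpose: "pullback (transpose C) V H eo eV eH (\<lambda>(t, b, l, r, \<sigma>). cd (l, r, t, b, \<sigma>))"
  by unfold_locales (auto simp: C.double_category_transpose H V obV eH eV inj_def dest: injD[OF cd])

lemma category_VS: "category (VS pdbl)"
proof -
  interpret T: pullback "transpose C" V H eo eV eH "\<lambda>(t, b, l, r, \<sigma>). cd (l, r, t, b, \<sigma>)"
    by (rule pullback_transpose)
  have T_mk: "T.mk t b l r \<sigma> = mk l r t b \<sigma>" for t b l r \<sigma>
    by (simp add: T.mk_def mk_def)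
  have T_psq: "T.psq t b l r \<sigma> \<longleftrightarrow> psq l r t b \<sigma>" for t b l r \<sigma>
    using sq_transpose[OF C.dc] by (auto simp: T.psq_def psq_def)
  have T_PS: "T.PS = PS"
    unfolding T.PS_def PS_def T_mk T_psq by blast
  \<comment> \<open>The projections are known to agree only on coded squares, since
    \<open>inv\<close> is arbitrary elsewhere; \<open>category_cong\<close> asks for no
    more.\<close>
  have T_proj: "T.pt \<alpha> = pl \<alpha>" "T.pb \<alpha> = pr \<alpha>" "T.pl \<alpha> = pt \<alpha>" "T.pr \<alpha> = pb \<alpha>" "T.ps \<alpha> = ps \<alpha>" if m: "\<alpha> \<in> PS" for \<alpha>
  proof -
    obtain t b l r \<sigma> where a: "\<alpha> = mk t b l r \<sigma>" using m unfolding PS_def by blast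
    then show "T.pt \<alpha> = pl \<alpha>" "T.pb \<alpha> = pr \<alpha>" "T.pl \<alpha> = pt \<alpha>" "T.pr \<alpha> = pb \<alpha>" "T.ps \<alpha> = ps \<alpha>"
      using T.proj[of l r t b \<sigma>] a by (simp_all add: T_mk)
  qed
  have k: "Idn (HS T.pdbl) = Idn (VS pdbl)" by (simp add: fun_eq_iff T_mk)
  have c: "Cmp (HS T.pdbl) \<alpha> \<beta> = Cmp (VS pdbl) \<alpha> \<beta>" if "\<alpha> \<in> PS" "\<beta> \<in> PS" for \<alpha> \<beta>
    using that by (simp add: T_mk T_proj)
  have ob: "Ob (HS T.pdbl) = Ob (VS pdbl)" "Ar (HS T.pdbl) = Ar (VS pdbl)" by (simp_all add: T_PS)
  have dm: "Dm (HS T.pdbl) \<alpha> = Dm (VS pdbl) \<alpha>" "Cd (HS T.pdbl) \<alpha> = Cd (VS pdbl) \<alpha>" if "\<alpha> \<in> PS" for \<alpha>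
    using that by (simp_all add: T_proj)
  show ?thesis
    by (rule category_cong[OF T.category_HS ob _ _ k])
      (use dm c in \<open>simp_all add: T_PS del: pdbl_sel(10-12) T.pdbl_sel(3-6)\<close>)
qed

lemma double_category_pdbl: "double_category pdbl"
  unfolding double_category_def pdbl_HV
proof (intro conjI H V obV category_HS category_VS)
  show "Ob (HS pdbl) = Ar V" "Ob (VS pdbl) = Ar H" "Ar (VS pdbl) = Sq pdbl" by simp_all
  show "is_functor (VS pdbl) V (Dm H) (lft pdbl)"
    using category_Dm_Cd[OF H] category_Idn[OF V] by (auto simp: is_functor_def obV psq_def elim!: PS_E)
  show "is_functor (VS pdbl) V (Cd H) (rgt pdbl)"
    using category_Dm_Cd[OF H] category_Idn[OF V] by (auto simp: is_functor_def obV psq_def elim!: PS_E)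
  have io: "esq C (Idn (HC C) (eo a)) = idsq C (Idn (VC C) (eo a))" if "a \<in> Ob H" for a
    using C.esq_Idn that eH by (simp add: is_functor_def)
  have ic: "idsq C (Cmp (VC C) (eV f) (eV g)) = above C (idsq C (eV f)) (idsq C (eV g))"
    if "f \<in> Ar V" "g \<in> Ar V" "Cd V f = Dm V g" for f g
    using C.idsq_comp[OF eV'(2)[OF that(1)]] eV'(2)[OF that(2)] that(3) by simp
  show "is_functor V (VS pdbl) (Idn H) (idsq pdbl)"
    using category_Idn[OF H] category_Idn[OF V] psq_idsq eH'(1) eV'(1,3) io ic category_Cmp[OF V]
    by (auto simp: is_functor_def obV category_Dm_Cd[OF V])
  show "\<forall>\<alpha>\<in>Sq pdbl. \<forall>\<beta>\<in>Sq pdbl. rgt pdbl \<alpha> = lft pdbl \<beta> \<longrightarrow>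
      tp pdbl (beside pdbl \<alpha> \<beta>) = Cmp H (tp pdbl \<alpha>) (tp pdbl \<beta>) \<and>
      bt pdbl (beside pdbl \<alpha> \<beta>) = Cmp H (bt pdbl \<alpha>) (bt pdbl \<beta>)" by simp
  have ec: "esq C (Cmp (HC C) (eH f) (eH g)) = beside C (esq C (eH f)) (esq C (eH g))"
    if "f \<in> Ar H" "g \<in> Ar H" "Cd H f = Dm H g" for f g
    using C.esq_comp[OF eH'(2)[OF that(1)]] eH'(2)[OF that(2)] that(3) by simp
  show "\<forall>f\<in>Ar H. \<forall>g\<in>Ar H. Cd H f = Dm H g \<longrightarrow> esq pdbl (Cmp H f g) = beside pdbl (esq pdbl f) (esq pdbl g)"
    using category_Cmp[OF H] eH'(3) ec category_unit[OF V] category_Idn[OF V] category_Dm_Cd[OF H] by (auto simp: obV)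
  show "\<forall>\<alpha>\<in>Sq pdbl. \<forall>\<beta>\<in>Sq pdbl. \<forall>\<gamma>\<in>Sq pdbl. \<forall>\<delta>\<in>Sq pdbl.
       rgt pdbl \<alpha> = lft pdbl \<beta> \<longrightarrow> rgt pdbl \<gamma> = lft pdbl \<delta> \<longrightarrow> bt pdbl \<alpha> = tp pdbl \<gamma> \<longrightarrow> bt pdbl \<beta> = tp pdbl \<delta> \<longrightarrow>
       above pdbl (beside pdbl \<alpha> \<beta>) (beside pdbl \<gamma> \<delta>) = beside pdbl (above pdbl \<alpha> \<gamma>) (above pdbl \<beta> \<delta>)"
    by (auto elim!: PS_E simp: psq_def intro!: arg_cong[of _ _ "mk _ _ _ _"] intro: C.interchange)
qed

definition pmap :: "'u cellmap" where
  "pmap = \<lparr> mo = eo, mh = eH, mv = eV, ms = ps \<rparr>"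

lemma pmap_sel [simp]: "mo pmap = eo" "mh pmap = eH" "mv pmap = eV" "ms pmap = ps"
  by (simp_all add: pmap_def)

lemma dfun_pmap: "dfun pdbl C pmap"
  unfolding dfun_def pdbl_HV pmap_sel
proof (intro conjI double_category_pdbl C.dc eH eV)
  show "is_functor (HS pdbl) (HS C) eV ps"
    using eV'(2) by (auto simp: is_functor_def psq_def sq_def varr_def C.obs elim!: PS_E)
  show "is_functor (VS pdbl) (VS C) eH ps"
    using eH'(2) by (auto simp: is_functor_def psq_def sq_def harr_def C.obs elim!: PS_E)
qed

lemma sq_pdbl: "sq pdbl \<alpha> t b l r \<longleftrightarrow> (\<exists>\<sigma>. \<alpha> = mk t b l r \<sigma> \<and> psq t b l r \<sigma>)"
  by (auto simp: sq_def elim!: PS_E)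

text \<open>Full faithfulness on squares is built in: once the boundary is fixed, a square is just a
  square of \<open>C\<close>. The hypotheses therefore concern objects and arrows only.\<close>

lemma dctf_pmap:
  assumes o: "\<And>c. c \<in> Ob (HC C) \<Longrightarrow> \<exists>x\<in>Ob H. eo x = c"
    and h: "\<And>x y g. x \<in> Ob H \<Longrightarrow> y \<in> Ob H \<Longrightarrow> harr C g (eo x) (eo y) \<Longrightarrow> \<exists>f\<in>Ar H. Dm H f = x \<and> Cd H f = y \<and> eH f = g"
    and v: "\<And>x y g. x \<in> Ob H \<Longrightarrow> y \<in> Ob H \<Longrightarrow> varr C g (eo x) (eo y) \<Longrightarrow> \<exists>f\<in>Ar V. Dm V f = x \<and> Cd V f = y \<and> eV f = g"
  shows "dctf pdbl C pmap"
  unfolding dctf_def pdbl_HV pmap_sel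
proof (intro conjI dfun_pmap ballI allI impI o)
  show "\<exists>f. harr pdbl f x y \<and> eH f = g" if "x \<in> Ob H" "y \<in> Ob H" "harr C g (eo x) (eo y)" for x y g
    using h[OF that] unfolding harr_def pdbl_HV by blast
  show "\<exists>f. varr pdbl f x y \<and> eV f = g" if "x \<in> Ob H" "y \<in> Ob H" "varr C g (eo x) (eo y)" for x y g
    using v[OF that] unfolding varr_def pdbl_HV by blast
  show "\<exists>!\<alpha>. sq pdbl \<alpha> t b l r \<and> ps \<alpha> = \<sigma>"
    if "harr pdbl t x y" "harr pdbl b x' y'" "varr pdbl l x x'" "varr pdbl r y y'" "sq C \<sigma> (eH t) (eH b) (eV l) (eV r)" for x y x' y' t b l r \<sigma>
    using that unfolding sq_pdbl by (intro ex1I[of _ "mk t b l r \<sigma>"]) (auto simp: psq_def harr_def varr_def)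
qed

end

section \<open>Categories of coded words\<close>

primrec wdom :: "('o, 'm) category \<Rightarrow> ('m, 'g) word \<Rightarrow> 'o" where
  "wdom C (End m) = Dm C m"
| "wdom C (Step m g w) = Dm C m"

primrec wcod :: "('o, 'm) category \<Rightarrow> ('m, 'g) word \<Rightarrow> 'o" where
  "wcod C (End m) = Cd C m"
| "wcod C (Step m g w) = wcod C w"

lemma vword_dom_cod: "vword C G gd gc w x y \<Longrightarrow> wdom C w = x \<and> wcod C w = y"
  by (induction w arbitrary: x) auto

text \<open>A well-typed word determines its ends through its first and last letters, so coding the
  word alone is enough.\<close>

definition wcat :: "('o, 'm) category \<Rightarrow> 'g set \<Rightarrow> ('g \<Rightarrow> 'o) \<Rightarrow> ('g \<Rightarrow> 'o) \<Rightarrow> (('m, 'g) word \<Rightarrow> 'n) \<Rightarrow> ('o, 'n) category" where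
  "wcat C G gd gc enc = \<lparr> Ob = Ob C, Ar = {enc w |w. \<exists>x y. vword C G gd gc w x y},
     Dm = (\<lambda>f. wdom C (inv enc f)), Cd = (\<lambda>f. wcod C (inv enc f)), Idn = (\<lambda>x. enc (End (Idn C x))),
     Cmp = (\<lambda>f g. enc (jn (Cmp C) (inv enc f) (inv enc g))) \<rparr>"

context
  fixes C :: "('o, 'm) category" and G :: "'g set" and gd gc :: "'g \<Rightarrow> 'o" and enc :: "('m, 'g) word \<Rightarrow> 'n"
  assumes enc: "inj enc"
begin

lemma wcat_sel [simp]:
  "Ob (wcat C G gd gc enc) = Ob C" "Idn (wcat C G gd gc enc) x = enc (End (Idn C x))"
  "Dm (wcat C G gd gc enc) (enc w) = wdom C w" "Cd (wcat C G gd gc enc) (enc w) = wcod C w"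
  "Cmp (wcat C G gd gc enc) (enc w) (enc w') = enc (jn (Cmp C) w w')"
  by (simp_all add: wcat_def inv_f_f[OF enc])

lemma wcat_Ar: "f \<in> Ar (wcat C G gd gc enc) \<longleftrightarrow> (\<exists>w. f = enc w \<and> vword C G gd gc w (wdom C w) (wcod C w))"
  using vword_dom_cod by (fastforce simp: wcat_def)

lemma wcat_hom: "f \<in> Ar (wcat C G gd gc enc) \<and> Dm (wcat C G gd gc enc) f = x \<and> Cd (wcat C G gd gc enc) f = y \<longleftrightarrow>
    (\<exists>w. f = enc w \<and> vword C G gd gc w x y)"
  unfolding wcat_Ar using vword_dom_cod by fastforce

lemma wcat_category:
  assumes C: "category C" shows "category (wcat C G gd gc enc)"
  unfolding category_def
proof (intro conjI ballI impI)
  let ?W = "wcat C G gd gc enc"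
  fix f assume "f \<in> Ar ?W" then obtain w where f: "f = enc w" "vword C G gd gc w (wdom C w) (wcod C w)" by (auto simp: wcat_Ar)
  show "Dm ?W f \<in> Ob ?W" "Cd ?W f \<in> Ob ?W" using vword_ob[OF C f(2)] f(1) by auto
  show "Cmp ?W (Idn ?W (Dm ?W f)) f = f" "Cmp ?W f (Idn ?W (Cd ?W f)) = f"
    using jn_unit[OF C f(2)] f(1) by auto
  fix g assume "g \<in> Ar ?W" and fg: "Cd ?W f = Dm ?W g"
  then obtain v where g: "g = enc v" "vword C G gd gc v (wcod C w) (wcod C v)" using f(1) by (auto simp: wcat_Ar)
  have j: "vword C G gd gc (jn (Cmp C) w v) (wdom C w) (wcod C v)" by (rule vword_jn[OF C f(2) g(2)])
  then show "Cmp ?W f g \<in> Ar ?W" "Dm ?W (Cmp ?W f g) = Dm ?W f" "Cd ?W (Cmp ?W f g) = Cd ?W g"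
    using vword_dom_cod[OF j] f(1) g(1) by (auto simp: wcat_Ar)
  fix h assume "h \<in> Ar ?W" and gh: "Cd ?W g = Dm ?W h"
  then obtain u where h: "h = enc u" "vword C G gd gc u (wcod C v) (wcod C u)" using g(1) by (auto simp: wcat_Ar)
  show "Cmp ?W (Cmp ?W f g) h = Cmp ?W f (Cmp ?W g h)"
    using jn_assoc[OF C f(2) g(2) h(2)] f g h by simp
next
  let ?W = "wcat C G gd gc enc"
  fix a assume "a \<in> Ob ?W" then have "Idn C a \<in> Ar C \<and> Dm C (Idn C a) = a \<and> Cd C (Idn C a) = a" using category_Idn[OF C] by simp
  then show "Idn ?W a \<in> Ar ?W" "Dm ?W (Idn ?W a) = a" "Cd ?W (Idn ?W a) = a" by (auto simp: wcat_Ar)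
qed

lemma wcat_functor:
  assumes C: "category C" and D: "category D" and i: "is_functor C D io i"
    and gv: "\<And>g. g \<in> G \<Longrightarrow> gv g \<in> Ar D \<and> Dm D (gv g) = io (gd g) \<and> Cd D (gv g) = io (gc g)"
  shows "is_functor (wcat C G gd gc enc) D io (\<lambda>f. evw (Cmp D) i gv (inv enc f))"
  unfolding is_functor_def
proof (intro conjI ballI impI)
  let ?W = "wcat C G gd gc enc"
  fix f assume "f \<in> Ar ?W" then obtain w where f: "f = enc w" "vword C G gd gc w (wdom C w) (wcod C w)" by (auto simp: wcat_Ar)
  have u: "vword C G gd gc (End (Idn C (wcod C w))) (wcod C w) (wcod C w)"
    using category_Idn[OF C] vword_ob[OF C f(2)] by simp
  show "evw (Cmp D) i gv (inv enc f) \<in> Ar D" "Dm D (evw (Cmp D) i gv (inv enc f)) = io (Dm ?W f)"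
    "Cd D (evw (Cmp D) i gv (inv enc f)) = io (Cd ?W f)"
    using evw_jn(2)[where io=io, OF f(2) u C D i gv] f(1) by (auto simp: inv_f_f[OF enc])
  fix g assume "g \<in> Ar ?W" and fg: "Cd ?W f = Dm ?W g"
  then obtain v where g: "g = enc v" "vword C G gd gc v (wcod C w) (wcod C v)" using f(1) by (auto simp: wcat_Ar)
  show "evw (Cmp D) i gv (inv enc (Cmp ?W f g)) = Cmp D (evw (Cmp D) i gv (inv enc f)) (evw (Cmp D) i gv (inv enc g))"
    using evw_jn(1)[where io=io, OF f(2) g(2) C D i gv] f(1) g(1) by (simp add: inv_f_f[OF enc])
qed (use i in \<open>auto simp: is_functor_def inv_f_f[OF enc]\<close>)

lemma wcat_End_functor: "category C \<Longrightarrow> is_functor C (wcat C G gd gc enc) (\<lambda>x. x) (\<lambda>m. enc (End m))"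
  by (auto simp: is_functor_def wcat_Ar)

definition wgen :: "'g \<Rightarrow> 'n" where
  "wgen g = enc (Step (Idn C (gd g)) g (End (Idn C (gc g))))"

lemma wcat_gen:
  assumes "category C" "g \<in> G" "gd g \<in> Ob C" "gc g \<in> Ob C"
  shows "wgen g \<in> Ar (wcat C G gd gc enc) \<and> Dm (wcat C G gd gc enc) (wgen g) = gd g \<and> Cd (wcat C G gd gc enc) (wgen g) = gc g"
  unfolding wcat_hom using assms category_Idn[OF assms(1)]
  by (intro exI[of _ "Step (Idn C (gd g)) g (End (Idn C (gc g)))"]) (simp add: wgen_def)

text \<open>In the category of words, evaluation returns the code of the word itself. Freeness thus
  reduces to injectivity of \<open>enc\<close>.\<close>

lemma evw_wcat:
  assumes C: "category C" and g: "\<And>g. g \<in> G \<Longrightarrow> gd g \<in> Ob C \<and> gc g \<in> Ob C" and "vword C G gd gc w x y"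
  shows "evw (Cmp (wcat C G gd gc enc)) (\<lambda>m. enc (End m)) wgen w = enc w"
  using assms(3)
proof (induction w arbitrary: x)
  case (Step m k w)
  then have w: "vword C G gd gc w (gc k) y" and k: "k \<in> G" and m: "m \<in> Ar C" "Cd C m = gd k" by auto
  have "lmult (Cmp C) (Idn C (gc k)) w = w" using jn_unit(1)[OF C w] by simp
  moreover have "Cmp C m (Idn C (gd k)) = m" using category_unit[OF C m(1)] m(2) by simp
  ultimately show ?case using Step.IH[OF w] by (simp add: wgen_def)
qed simp

lemma wcat_free:
  assumes C: "category C" and g: "\<And>g. g \<in> G \<Longrightarrow> gd g \<in> Ob C \<and> gc g \<in> Ob C"
    and f: "f \<in> Ar (wcat C G gd gc enc)" "Dm (wcat C G gd gc enc) f = x" "Cd (wcat C G gd gc enc) f = y"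
  shows "\<exists>!w. vword C G gd gc w x y \<and> evw (Cmp (wcat C G gd gc enc)) (\<lambda>m. enc (End m)) wgen w = f"
proof -
  obtain w where w: "f = enc w" "vword C G gd gc w x y" using f wcat_hom by metis
  then show ?thesis using evw_wcat[OF C g] injD[OF enc] by metis
qed

end

section \<open>Adjoining discrete objects\<close>

definition pcase :: "('a + 'b \<Rightarrow> 'c) \<Rightarrow> ('a \<Rightarrow> 'd) \<Rightarrow> ('b \<Rightarrow> 'd) \<Rightarrow> 'c \<Rightarrow> 'd" where
  "pcase e f g z = case_sum f g (inv e z)"

lemma pcase [simp]: "inj e \<Longrightarrow> pcase e f g (e (Inl x)) = f x" "inj e \<Longrightarrow> pcase e f g (e (Inr y)) = g y"
  by (simp_all add: pcase_def)

text \<open>One element \<open>e (Inr x)\<close> serves as object, identity arrow and identity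
  square of an isolated point. The four categories of a double category can therefore all receive
  the same summand \<open>X\<close>.\<close>

definition pcat :: "('u + 'u \<Rightarrow> 'u) \<Rightarrow> 'u set \<Rightarrow> ('u, 'u) category \<Rightarrow> ('u, 'u) category" where
  "pcat e X C = \<lparr> Ob = e ` (Inl ` Ob C \<union> Inr ` X), Ar = e ` (Inl ` Ar C \<union> Inr ` X),
     Dm = pcase e (\<lambda>m. e (Inl (Dm C m))) (\<lambda>x. e (Inr x)), Cd = pcase e (\<lambda>m. e (Inl (Cd C m))) (\<lambda>x. e (Inr x)),
     Idn = pcase e (\<lambda>m. e (Inl (Idn C m))) (\<lambda>x. e (Inr x)),
     Cmp = (\<lambda>f g. pcase e (\<lambda>m. pcase e (\<lambda>n. e (Inl (Cmp C m n))) (\<lambda>y. e (Inr y)) g) (\<lambda>x. e (Inr x)) f) \<rparr>"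

definition padd :: "('u + 'u \<Rightarrow> 'u) \<Rightarrow> ('u \<Rightarrow> 'u) \<Rightarrow> 'u \<Rightarrow> 'u" where
  "padd e f = pcase e (\<lambda>m. e (Inl (f m))) (\<lambda>x. e (Inr x))"

definition pdc :: "('u + 'u \<Rightarrow> 'u) \<Rightarrow> 'u set \<Rightarrow> 'u dblcat \<Rightarrow> 'u dblcat" where
  "pdc e X A = \<lparr> HC = pcat e X (HC A), VC = pcat e X (VC A), HS = pcat e X (HS A), VS = pcat e X (VS A) \<rparr>"

lemma pdc_sel [simp]: "HC (pdc e X A) = pcat e X (HC A)" "VC (pdc e X A) = pcat e X (VC A)"
  "HS (pdc e X A) = pcat e X (HS A)" "VS (pdc e X A) = pcat e X (VS A)"
  by (simp_all add: pdc_def)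

context
  fixes e :: "'u + 'u \<Rightarrow> 'u" assumes e: "inj e"
begin

lemma pcat_sel: 
  "Ob (pcat e X C) = e ` (Inl ` Ob C \<union> Inr ` X)" "Ar (pcat e X C) = e ` (Inl ` Ar C \<union> Inr ` X)"
  by (simp_all add: pcat_def)

lemma pcat_mem [simp]:
  "e (Inl x) \<in> Ob (pcat e X C) \<longleftrightarrow> x \<in> Ob C" "e (Inr x) \<in> Ob (pcat e X C) \<longleftrightarrow> x \<in> X"
  "e (Inl x) \<in> Ar (pcat e X C) \<longleftrightarrow> x \<in> Ar C" "e (Inr x) \<in> Ar (pcat e X C) \<longleftrightarrow> x \<in> X"
  by (auto simp: pcat_def inj_eq[OF e])

lemma pcat_ops [simp]:
  "Dm (pcat e X C) (e (Inl m)) = e (Inl (Dm C m))" "Dm (pcat e X C) (e (Inr x)) = e (Inr x)"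
  "Cd (pcat e X C) (e (Inl m)) = e (Inl (Cd C m))" "Cd (pcat e X C) (e (Inr x)) = e (Inr x)"
  "Idn (pcat e X C) (e (Inl m)) = e (Inl (Idn C m))" "Idn (pcat e X C) (e (Inr x)) = e (Inr x)"
  "Cmp (pcat e X C) (e (Inl m)) (e (Inl n)) = e (Inl (Cmp C m n))" "Cmp (pcat e X C) (e (Inr x)) g = e (Inr x)"
  by (simp_all add: pcat_def e)

lemma padd_simps [simp]: "padd e f (e (Inl x)) = e (Inl (f x))" "padd e f (e (Inr x)) = e (Inr x)"
  by (simp_all add: padd_def e)

lemma pcat_Ob_cases: "z \<in> Ob (pcat e X C) \<longleftrightarrow> (\<exists>x\<in>Ob C. z = e (Inl x)) \<or> (\<exists>x\<in>X. z = e (Inr x))"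
  by (auto simp: pcat_def)

lemma pcat_Ar_cases: "z \<in> Ar (pcat e X C) \<longleftrightarrow> (\<exists>x\<in>Ar C. z = e (Inl x)) \<or> (\<exists>x\<in>X. z = e (Inr x))"
  by (auto simp: pcat_def)

lemma ball_pcat [simp]:
  "(\<forall>z\<in>Ob (pcat e X C). P z) \<longleftrightarrow> (\<forall>x\<in>Ob C. P (e (Inl x))) \<and> (\<forall>x\<in>X. P (e (Inr x)))"
  "(\<forall>z\<in>Ar (pcat e X C). P z) \<longleftrightarrow> (\<forall>x\<in>Ar C. P (e (Inl x))) \<and> (\<forall>x\<in>X. P (e (Inr x)))"
  by (auto simp: pcat_def)

lemma inj_e [simp]: "e x = e y \<longleftrightarrow> x = y"
  by (rule inj_eq[OF e])

lemma pcat_category: "category C \<Longrightarrow> category (pcat e X C)"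
  unfolding category_def by simp

lemma pcat_functor: "is_functor C D Fo Fm \<Longrightarrow> is_functor (pcat e X C) (pcat e X D) (padd e Fo) (padd e Fm)"
  by (simp add: is_functor_def)

text \<open>Source, target and identity maps have the shape of maps induced by functors, so
  \<open>pcat_functor\<close> yields the functor axioms for \<open>pdc\<close>.\<close>

lemma pcat_padd: "Dm (pcat e X C) = padd e (Dm C)" "Cd (pcat e X C) = padd e (Cd C)" "Idn (pcat e X C) = padd e (Idn C)"
  by (simp_all add: pcat_def padd_def)

lemma double_category_pdc:
  assumes "double_category A" shows "double_category (pdc e X A)"
proof -
  interpret A: dcat A using assms by (simp add: dcat_def)
  have ob: "Ob (pcat e X C) = Ob (pcat e X D)" if "Ob C = Ob D" for C D using that by (simp add: pcat_sel)
  have oa: "Ob (pcat e X C) = Ar (pcat e X D)" if "Ob C = Ar D" for C D using that by (simp add: pcat_sel)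
  have aa: "Ar (pcat e X C) = Ar (pcat e X D)" if "Ar C = Ar D" for C D using that by (simp add: pcat_sel)
  show ?thesis
    unfolding double_category_def pdc_sel
  proof (intro conjI pcat_category A.cats)
    show "is_functor (pcat e X (VS A)) (pcat e X (VC A)) (Dm (pcat e X (HC A))) (Dm (pcat e X (HS A)))"
      "is_functor (pcat e X (VS A)) (pcat e X (VC A)) (Cd (pcat e X (HC A))) (Cd (pcat e X (HS A)))"
      "is_functor (pcat e X (VC A)) (pcat e X (VS A)) (Idn (pcat e X (HC A))) (Idn (pcat e X (HS A)))"
      unfolding pcat_padd by (intro pcat_functor A.functors)+
  qed (use A.obs A.beside_sides A.esq_comp A.interchange[unfolded sq_def] in
      \<open>simp_all add: ob[of "VC A" "HC A"] oa[of "HS A" "VC A"] oa[of "VS A" "HC A"] aa[of "VS A" "HS A"] harr_def\<close>)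
qed

lemma harr_pdc: "harr (pdc e X A) f x y \<longleftrightarrow> (\<exists>f' x' y'. f = e (Inl f') \<and> x = e (Inl x') \<and> y = e (Inl y') \<and> harr A f' x' y') \<or>
    (\<exists>c\<in>X. f = e (Inr c) \<and> x = e (Inr c) \<and> y = e (Inr c))"
  by (auto simp: harr_def pcat_Ar_cases)

lemma varr_pdc: "varr (pdc e X A) f x y \<longleftrightarrow> (\<exists>f' x' y'. f = e (Inl f') \<and> x = e (Inl x') \<and> y = e (Inl y') \<and> varr A f' x' y') \<or>
    (\<exists>c\<in>X. f = e (Inr c) \<and> x = e (Inr c) \<and> y = e (Inr c))"
  by (auto simp: varr_def pcat_Ar_cases)

lemma sq_pdc: "double_category A \<Longrightarrow> sq (pdc e X A) \<alpha> t b l r \<longleftrightarrow>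
    (\<exists>\<alpha>' t' b' l' r'. \<alpha> = e (Inl \<alpha>') \<and> t = e (Inl t') \<and> b = e (Inl b') \<and> l = e (Inl l') \<and> r = e (Inl r') \<and> sq A \<alpha>' t' b' l' r') \<or>
    (\<exists>c\<in>X. \<alpha> = e (Inr c) \<and> t = e (Inr c) \<and> b = e (Inr c) \<and> l = e (Inr c) \<and> r = e (Inr c))"
  by (auto simp: sq_def pcat_Ar_cases)

definition pmadd :: "'u cellmap \<Rightarrow> 'u cellmap" where
  "pmadd m = \<lparr> mo = padd e (mo m), mh = padd e (mh m), mv = padd e (mv m), ms = padd e (ms m) \<rparr>"

lemma pmadd_sel [simp]: "mo (pmadd m) = padd e (mo m)" "mh (pmadd m) = padd e (mh m)" "mv (pmadd m) = padd e (mv m)" "ms (pmadd m) = padd e (ms m)"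
  by (simp_all add: pmadd_def)

lemma dfun_pmadd: "dfun A B m \<Longrightarrow> dfun (pdc e X A) (pdc e X B) (pmadd m)"
  by (simp add: dfun_def double_category_pdc pcat_functor)

text \<open>No arrow or square joins the two summands, so every boundary lies in one of them; on the
  discrete summand the map is the identity.\<close>

lemma dctf_pmadd:
  assumes F: "dctf A B m" shows "dctf (pdc e X A) (pdc e X B) (pmadd m)"
proof -
  have dc: "double_category A" "double_category B" using dfun_dc[OF dctf_dfun[OF F]] .
  have sqq: "\<exists>!\<alpha>. sq (pdc e X A) \<alpha> t b l r \<and> padd e (ms m) \<alpha> = \<sigma>"
    if h: "harr (pdc e X A) t x y" "harr (pdc e X A) b x' y'" "varr (pdc e X A) l x x'" "varr (pdc e X A) r y y'"
      and s: "sq (pdc e X B) \<sigma> (padd e (mh m) t) (padd e (mh m) b) (padd e (mv m) l) (padd e (mv m) r)" for x y x' y' t b l r \<sigma>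
    using h(1) unfolding harr_pdc
  proof (elim disjE exE bexE conjE)
    fix t1 x1 y1 assume t1: "t = e (Inl t1)" "x = e (Inl x1)" "y = e (Inl y1)" "harr A t1 x1 y1"
    obtain b1 x1' y1' where b1: "b = e (Inl b1)" "x' = e (Inl x1')" "y' = e (Inl y1')" "harr A b1 x1' y1'"
      using h(2,3) t1 unfolding harr_pdc varr_pdc by (auto simp: inj_eq[OF e])
    obtain l1 where l1: "l = e (Inl l1)" "varr A l1 x1 x1'" using h(3) t1 b1 unfolding varr_pdc by (auto simp: inj_eq[OF e])
    obtain r1 where r1: "r = e (Inl r1)" "varr A r1 y1 y1'" using h(4) t1 b1 unfolding varr_pdc by (auto simp: inj_eq[OF e])
    obtain s1 where s1: "\<sigma> = e (Inl s1)" "sq B s1 (mh m t1) (mh m b1) (mv m l1) (mv m r1)"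
      using s t1 b1 l1 r1 unfolding sq_pdc[OF dc(2)] by (auto simp: inj_eq[OF e])
    have "\<exists>!\<alpha>. sq A \<alpha> t1 b1 l1 r1 \<and> ms m \<alpha> = s1" by (rule dctf_sq_ex1[OF F s1(2) t1(4) b1(4) l1(2) r1(2)])
    then obtain a where a: "sq A a t1 b1 l1 r1 \<and> ms m a = s1" and u: "\<And>a'. sq A a' t1 b1 l1 r1 \<and> ms m a' = s1 \<Longrightarrow> a' = a" by blast
    show ?thesis
    proof (rule ex1I[of _ "e (Inl a)"])
      show "sq (pdc e X A) (e (Inl a)) t b l r \<and> padd e (ms m) (e (Inl a)) = \<sigma>"
        using a by (simp add: sq_pdc[OF dc(1)] t1(1) b1(1) l1(1) r1(1) s1(1))
      fix \<beta> assume \<beta>: "sq (pdc e X A) \<beta> t b l r \<and> padd e (ms m) \<beta> = \<sigma>"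
      then obtain a' where a': "\<beta> = e (Inl a')" "sq A a' t1 b1 l1 r1"
        unfolding sq_pdc[OF dc(1)] t1(1) b1(1) l1(1) r1(1) by auto
      then have "ms m a' = s1" using \<beta> by (simp add: s1(1))
      then show "\<beta> = e (Inl a)" using a' u by simp
    qed
  next
    fix c assume c: "c \<in> X" "t = e (Inr c)" "x = e (Inr c)" "y = e (Inr c)"
    then have o: "l = e (Inr c)" "r = e (Inr c)" "x' = e (Inr c)" "y' = e (Inr c)" using h(3,4) unfolding varr_pdc by (auto simp: inj_eq[OF e])
    then have "b = e (Inr c)" using h(2) unfolding harr_pdc by (auto simp: inj_eq[OF e])
    then show ?thesis
      using s c o by (intro ex1I[of _ "e (Inr c)"]) (auto simp: sq_pdc[OF dc(1)] sq_pdc[OF dc(2)] inj_eq[OF e])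
  qed
  show ?thesis
    unfolding dctf_def pmadd_sel
  proof (intro conjI ballI allI impI dfun_pmadd[OF dctf_dfun[OF F]] sqq)
    fix y assume "y \<in> Ob (HC (pdc e X B))"
    then have "(\<exists>b\<in>Ob (HC B). y = e (Inl b)) \<or> (\<exists>c\<in>X. y = e (Inr c))" by (simp add: pcat_Ob_cases)
    then show "\<exists>x\<in>Ob (HC (pdc e X A)). padd e (mo m) x = y"
    proof (elim disjE bexE)
      fix b assume b: "b \<in> Ob (HC B)" "y = e (Inl b)"
      obtain a where "a \<in> Ob (HC A)" "mo m a = b" using dctf_ob[OF F b(1)] .
      then show ?thesis using b by (intro bexI[of _ "e (Inl a)"]) auto
    next
      fix c assume "c \<in> X" "y = e (Inr c)"
      then show ?thesis by (intro bexI[of _ "e (Inr c)"]) auto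
    qed
  next
    fix x y g assume "x \<in> Ob (HC (pdc e X A))" "y \<in> Ob (HC (pdc e X A))" and "harr (pdc e X B) g (padd e (mo m) x) (padd e (mo m) y)"
    then show "\<exists>f. harr (pdc e X A) f x y \<and> padd e (mh m) f = g"
      unfolding pdc_sel pcat_Ob_cases
    proof (elim disjE bexE)
      fix a b assume ab: "a \<in> Ob (HC A)" "x = e (Inl a)" "b \<in> Ob (HC A)" "y = e (Inl b)"
        and g: "harr (pdc e X B) g (padd e (mo m) x) (padd e (mo m) y)"
      obtain g' where g': "g = e (Inl g')" "harr B g' (mo m a) (mo m b)" using g ab by (auto simp: harr_pdc)
      obtain f where "harr A f a b" "mh m f = g'" using dctf_h[OF F g'(2) ab(1,3)] .
      then show ?thesis using ab g' by (intro exI[of _ "e (Inl f)"]) (simp add: harr_pdc)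
    qed (auto simp: harr_pdc)
  next
    fix x y g assume "x \<in> Ob (HC (pdc e X A))" "y \<in> Ob (HC (pdc e X A))" and "varr (pdc e X B) g (padd e (mo m) x) (padd e (mo m) y)"
    then show "\<exists>f. varr (pdc e X A) f x y \<and> padd e (mv m) f = g"
      unfolding pdc_sel pcat_Ob_cases
    proof (elim disjE bexE)
      fix a b assume ab: "a \<in> Ob (HC A)" "x = e (Inl a)" "b \<in> Ob (HC A)" "y = e (Inl b)"
        and g: "varr (pdc e X B) g (padd e (mo m) x) (padd e (mo m) y)"
      obtain g' where g': "g = e (Inl g')" "varr B g' (mo m a) (mo m b)" using g ab by (auto simp: varr_pdc)
      obtain f where "varr A f a b" "mv m f = g'" using dctf_v[OF F g'(2) ab(1,3)] .
      then show ?thesis using ab g' by (intro exI[of _ "e (Inl f)"]) (simp add: varr_pdc)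
    qed (auto simp: varr_pdc)
  qed assumption+
qed

definition pinl :: "'u cellmap" where
  "pinl = \<lparr> mo = (\<lambda>x. e (Inl x)), mh = (\<lambda>x. e (Inl x)), mv = (\<lambda>x. e (Inl x)), ms = (\<lambda>x. e (Inl x)) \<rparr>"

lemma pinl_sel [simp]: "mo pinl x = e (Inl x)" "mh pinl x = e (Inl x)" "mv pinl x = e (Inl x)" "ms pinl x = e (Inl x)"
  by (simp_all add: pinl_def)

lemma dfun_pinl: "double_category A \<Longrightarrow> dfun A (pdc e X A) pinl"
  by (simp add: dfun_def double_category_pdc) (simp add: is_functor_def)

text \<open>The points adjoined are meant to be objects of \<open>C\<close>, each sent to itself;
  with all of them the extension is surjective on objects.\<close>

definition pext :: "'u dblcat \<Rightarrow> 'u cellmap \<Rightarrow> 'u cellmap" where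
  "pext C m = \<lparr> mo = pcase e (mo m) (\<lambda>x. x), mh = pcase e (mh m) (Idn (HC C)), mv = pcase e (mv m) (Idn (VC C)),
     ms = pcase e (ms m) (\<lambda>x. esq C (Idn (HC C) x)) \<rparr>"

lemma pext_sel [simp]:
  "mo (pext C m) (e (Inl x)) = mo m x" "mo (pext C m) (e (Inr x)) = x"
  "mh (pext C m) (e (Inl x)) = mh m x" "mh (pext C m) (e (Inr x)) = Idn (HC C) x"
  "mv (pext C m) (e (Inl x)) = mv m x" "mv (pext C m) (e (Inr x)) = Idn (VC C) x"
  "ms (pext C m) (e (Inl x)) = ms m x" "ms (pext C m) (e (Inr x)) = esq C (Idn (HC C) x)"
  by (simp_all add: pext_def e)

lemma is_functor_pcat_ext:
  assumes F: "is_functor K L Io Im" and L: "category L" and o: "\<And>x. Jo (e (Inl x)) = Io x" and m: "\<And>x. Jm (e (Inl x)) = Im x"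
    and x: "\<And>x. x \<in> X \<Longrightarrow> Jo (e (Inr x)) \<in> Ob L" and i: "\<And>x. x \<in> X \<Longrightarrow> Jm (e (Inr x)) = Idn L (Jo (e (Inr x)))"
  shows "is_functor (pcat e X K) L Jo Jm"
proof -
  have u: "Cmp L (Idn L a) (Idn L a) = Idn L a" if "a \<in> Ob L" for a
    using category_unit[OF L, of "Idn L a"] category_Idn[OF L that] by simp
  show ?thesis
    using F o m x i category_Idn[OF L] u by (simp add: is_functor_def)
qed

lemma dfun_pext:
  assumes m: "dfun A C m" shows "dfun (pdc e (Ob (HC C)) A) C (pext C m)"
proof -
  interpret C: dcat C using dfun_dcat(2)[OF m] .
  note h = C.harr_id C.varr_id C.esq_Idn
  have "is_functor (pcat e (Ob (HC C)) (HC A)) (HC C) (mo (pext C m)) (mh (pext C m))"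
    by (rule is_functor_pcat_ext[where Io="mo m" and Im="mh m"]) (use m C.cats in \<open>simp_all add: dfun_def\<close>)
  moreover have "is_functor (pcat e (Ob (HC C)) (VC A)) (VC C) (mo (pext C m)) (mv (pext C m))"
    by (rule is_functor_pcat_ext[where Io="mo m" and Im="mv m"]) (use m C.cats in \<open>simp_all add: dfun_def C.obs\<close>)
  moreover have "is_functor (pcat e (Ob (HC C)) (HS A)) (HS C) (mv (pext C m)) (ms (pext C m))"
    by (rule is_functor_pcat_ext[where Io="mv m" and Im="ms m"]) (use m C.cats h in \<open>simp_all add: dfun_def C.obs varr_def\<close>)
  moreover have "is_functor (pcat e (Ob (HC C)) (VS A)) (VS C) (mh (pext C m)) (ms (pext C m))"
    by (rule is_functor_pcat_ext[where Io="mh m" and Im="ms m"]) (use m C.cats h in \<open>simp_all add: dfun_def C.obs harr_def\<close>)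
  ultimately show ?thesis using m by (simp add: dfun_def double_category_pdc)
qed

end

lemma inj_pairs:
  assumes "infinite (UNIV :: 'u set)" obtains f :: "'u \<times> 'u \<Rightarrow> 'u" where "inj f"
proof -
  obtain f :: "'u \<times> 'u \<Rightarrow> 'u" where "bij_betw f (UNIV \<times> UNIV) UNIV"
    using iffD2[OF card_of_ordIso card_of_Times_same_infinite[OF assms]] by blast
  then show ?thesis using that by (auto simp: bij_betw_def)
qed

text \<open>All cells live in the single type \<open>'u\<close>. Its infinity is what allows sums,
  quintuples and words over it to be coded in it again.\<close>

lemma inj_codes:
  assumes "infinite (UNIV :: 'u set)"
  obtains e :: "'u + 'u \<Rightarrow> 'u" and enc :: "('u, 'u \<times> 'u \<times> 'u) word \<Rightarrow> 'u" and cd :: "'u \<times> 'u \<times> 'u \<times> 'u \<times> 'u \<Rightarrow> 'u"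
  where "inj e" "inj enc" "inj cd"
proof -
  obtain p :: "'u \<times> 'u \<Rightarrow> 'u" where p: "inj p" using inj_pairs[OF assms] .
  have p': "p (a, b) = p (c, d) \<longleftrightarrow> a = c \<and> b = d" for a b c d by (simp add: inj_eq[OF p])
  obtain u v :: 'u where uv: "u \<noteq> v"
    using assms by (metis ex_new_if_finite finite.emptyI finite.insertI insertI1)
  \<comment> \<open>The distinct elements \<open>u\<close> and \<open>v\<close> act as tags, here
    for the two summands and below for the two constructors of words.\<close>
  define e :: "'u + 'u \<Rightarrow> 'u" where "e = case_sum (\<lambda>x. p (u, x)) (\<lambda>x. p (v, x))"
  define enc :: "('u, 'u \<times> 'u \<times> 'u) word \<Rightarrow> 'u" where
    "enc = rec_word (\<lambda>m. p (u, m)) (\<lambda>m g w r. p (v, p (m, p (fst g, p (fst (snd g), p (snd (snd g), r))))))"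
  have enc: "enc (End m) = p (u, m)" "enc (Step m g w) = p (v, p (m, p (fst g, p (fst (snd g), p (snd (snd g), enc w)))))" for m g w
    by (simp_all add: enc_def)
  have "w = w'" if "enc w = enc w'" for w w'
    using that
  proof (induction w arbitrary: w')
    case (End m) then show ?case using uv by (cases w') (auto simp: enc p')
  next
    case (Step m g w) then show ?case using uv by (cases w') (auto simp: enc p' prod_eq_iff)
  qed
  then have "inj enc" by (simp add: inj_def)
  moreover have "inj e" unfolding inj_def e_def using uv by (auto simp: p' split: sum.splits)
  moreover have "inj (\<lambda>(t, b, l, r, s). p (t, p (b, p (l, p (r, s)))))" by (auto simp: inj_def p')
  ultimately show ?thesis using that by blast
qed

section \<open>Pushouts of canonical trivial fibrations along free extensions\<close>

context word_data
begin

lemma nV_I: assumes k: "varr A k p q" shows "N.nV (mv I k) = mv I (Cmp (VC A) (Cmp (VC A) (l p) k) (l' q))"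
proof -
  note pq = F.varr_ob[OF k]
  have ik: "varr Z (mv I k) p q" using dfun_varr[OF I k] I_ob pq by simp
  show ?thesis
    unfolding N.nV_eq[OF ik] dfun_vcomp[OF I F.varr_comp[OF l(1)[OF pq(1)] k] l'(1)[OF pq(2)]]
      dfun_vcomp[OF I l(1)[OF pq(1)] k] ..
qed

text \<open>By \<open>V\<close>, vertical arrows with the same ends and image are already identified
  by \<open>I\<close>. If the ends differ, conjugation moves both arrows to the same pair of
  representatives, where \<open>V\<close> applies; squares follow by
  \<open>nS_I_const\<close>.\<close>

lemma mconst_N:
  assumes n: "\<And>x y. x \<in> Ob (HC A) \<Longrightarrow> y \<in> Ob (HC A) \<Longrightarrow> mo F x = mo F y \<Longrightarrow> n0 x = n0 y"
    and V: "\<And>u u' x y. varr A u x y \<Longrightarrow> varr A u' x y \<Longrightarrow> mv F u = mv F u' \<Longrightarrow> mv I u = mv I u'"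
  shows "mconst A F (mcomp I N.conjmap)"
proof -
  have h: "n0 x = n0 x'" "n0 y = n0 y'" if "harr A f x y" "harr A f' x' y'" "mh F f = mh F f'" for f x y f' x' y'
  proof -
    have "mo F x = mo F x'" "mo F y = mo F y'"
      using dfun_harr[OF dF that(1)] dfun_harr[OF dF that(2)] that(3) by (auto simp: harr_def)
    then show "n0 x = n0 x'" "n0 y = n0 y'"
      using n F.harr_ob[OF that(1)] F.harr_ob[OF that(2)] by blast+
  qed
  have v: "n0 x = n0 x'" "n0 y = n0 y'" if "varr A f x y" "varr A f' x' y'" "mv F f = mv F f'" for f x y f' x' y'
  proof -
    have "mo F x = mo F x'" "mo F y = mo F y'"
      using dfun_varr[OF dF that(1)] dfun_varr[OF dF that(2)] that(3) by (auto simp: varr_def)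
    then show "n0 x = n0 x'" "n0 y = n0 y'"
      using n F.varr_ob[OF that(1)] F.varr_ob[OF that(2)] by blast+
  qed
  have Fv: "mv F (Cmp (VC A) (Cmp (VC A) (l p) k) (l' q)) = mv F k" if k: "varr A k p q" for k p q
  proof -
    note o = F.varr_ob[OF k]
    note fk = dfun_varr[OF dF k]
    show ?thesis
      using dfun_vcomp[OF dF F.varr_comp[OF l(1)[OF o(1)] k] l'(1)[OF o(2)]] dfun_vcomp[OF dF l(1)[OF o(1)] k]
        dcat.varr_idl[OF B fk] dcat.varr_idr[OF B fk] l(2)[OF o(1)] l'(2)[OF o(2)] by simp
  qed
  have nV: "N.nV (mv I k) = N.nV (mv I k')" if k: "varr A k p q" "varr A k' p' q'" "mv F k = mv F k'" for k p q k' p' q'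
  proof -
    note o = F.varr_ob[OF k(1)] F.varr_ob[OF k(2)]
    have 1: "varr A (Cmp (VC A) (Cmp (VC A) (l p) k) (l' q)) (n0 p) (n0 q)"
      by (rule F.varr_comp[OF F.varr_comp[OF l(1)[OF o(1)] k(1)] l'(1)[OF o(2)]])
    have 2: "varr A (Cmp (VC A) (Cmp (VC A) (l p') k') (l' q')) (n0 p) (n0 q)"
      using F.varr_comp[OF F.varr_comp[OF l(1)[OF o(3)] k(2)] l'(1)[OF o(4)]] v[OF k] by simp
    show ?thesis unfolding nV_I[OF k(1)] nV_I[OF k(2)]
      by (rule V[OF 1 2]) (simp add: Fv[OF k(1)] Fv[OF k(2)] k(3))
  qed
  show ?thesis
    unfolding mconst_def mcomp_sel N.conjmap_sel
  proof (intro conjI ballI impI)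
    fix x y assume "x \<in> Ob (HC A)" "y \<in> Ob (HC A)" "mo F x = mo F y"
    then show "n0 (mo I x) = n0 (mo I y)" using n[of x y] I_ob by simp
  next
    fix f f' assume "f \<in> Ar (HC A)" "f' \<in> Ar (HC A)" and e: "mh F f = mh F f'"
    then have f: "harr A f (Dm (HC A) f) (Cd (HC A) f)" "harr A f' (Dm (HC A) f') (Cd (HC A) f')" by (simp_all add: harr_def)
    show "wH (mh I f) = wH (mh I f')" by (rule wH_I_const[OF f e h[OF f e]])
  next
    fix f f' assume "f \<in> Ar (VC A)" "f' \<in> Ar (VC A)" and e: "mv F f = mv F f'"
    then have f: "varr A f (Dm (VC A) f) (Cd (VC A) f)" "varr A f' (Dm (VC A) f') (Cd (VC A) f')" by (simp_all add: varr_def)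
    show "N.nV (mv I f) = N.nV (mv I f')" by (rule nV[OF f e])
  next
    fix \<alpha> \<beta> assume "\<alpha> \<in> Sq A" "\<beta> \<in> Sq A" and e: "ms F \<alpha> = ms F \<beta>"
    then have a: "sq A \<alpha> (tp A \<alpha>) (bt A \<alpha>) (lft A \<alpha>) (rgt A \<alpha>)" and b: "sq A \<beta> (tp A \<beta>) (bt A \<beta>) (lft A \<beta>) (rgt A \<beta>)"
      by (simp_all add: sq_def)
    note ca = F.sq_corners[OF a] and cb = F.sq_corners[OF b]
    have f: "mh F (tp A \<alpha>) = mh F (tp A \<beta>)" "mh F (bt A \<alpha>) = mh F (bt A \<beta>)" "mv F (lft A \<alpha>) = mv F (lft A \<beta>)" "mv F (rgt A \<alpha>) = mv F (rgt A \<beta>)"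
      using dfun_sq[OF dF a] dfun_sq[OF dF b] e by (auto simp: sq_def)
    show "N.nS (ms I \<alpha>) = N.nS (ms I \<beta>)"
      by (rule nS_I_const[OF a ca(1,2) b cb(1,2) e h[OF ca(1) cb(1) f(1)] h[OF ca(2) cb(2) f(2)] nV[OF ca(3) cb(3) f(3)] nV[OF ca(4) cb(4) f(4)]])
  qed
qed

end

definition free_over :: "'u dblcat \<Rightarrow> 'u dblcat \<Rightarrow> 'u cellmap \<Rightarrow> 'g set \<Rightarrow> ('g \<Rightarrow> 'u) \<Rightarrow> ('g \<Rightarrow> 'u) \<Rightarrow> ('g \<Rightarrow> 'u) \<Rightarrow> bool" where
  "free_over A Z I G gd gc gv \<longleftrightarrow> (\<forall>g\<in>G. gd g \<in> Ob (HC A) \<and> gc g \<in> Ob (HC A) \<and> harr Z (gv g) (gd g) (gc g)) \<and>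
     (\<forall>f x y. harr Z f x y \<longrightarrow> (\<exists>!w. vword (HC A) G gd gc w x y \<and> evw (Cmp (HC Z)) (mh I) gv w = f))"

text \<open>\<open>Z\<close> is \<open>C\<close> with its squares pulled back to free extensions of
  the two arrow categories of \<open>A\<close>. A generator \<open>(a, b, f)\<close> is added even
  when \<open>f\<close> comes from an arrow of \<open>A\<close>: fullness asks only for some lift,
  and freeness forbids the relation.\<close>

lemma free_extension:
  fixes A C :: "'u dblcat"
  assumes J: "dfun A C J" and surj: "\<And>c. c \<in> Ob (HC C) \<Longrightarrow> \<exists>a\<in>Ob (HC A). mo J a = c"
    and enc: "inj (enc :: ('u, 'u \<times> 'u \<times> 'u) word \<Rightarrow> 'u)" and cd: "inj (cd :: 'u \<times> 'u \<times> 'u \<times> 'u \<times> 'u \<Rightarrow> 'u)"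
  obtains Z I r and GH GV :: "('u \<times> 'u \<times> 'u) set" and gd gc gh gv
  where "dctf Z C r" "dfun A Z I" "Ob (HC Z) = Ob (HC A)" "\<And>a. mo I a = a" "meq A (mcomp I r) J" "inj (mh I)" "inj (mv I)"
    "free_over A Z I GH gd gc gh" "free_over (transpose A) (transpose Z) (mtranspose I) GV gd gc gv"
proof -
  interpret A: dcat A using dfun_dcat(1)[OF J] .
  interpret C: dcat C using dfun_dcat(2)[OF J] .
  define gd :: "'u \<times> 'u \<times> 'u \<Rightarrow> 'u" where "gd = fst"
  define gc :: "'u \<times> 'u \<times> 'u \<Rightarrow> 'u" where "gc = (\<lambda>g. fst (snd g))"
  define gs :: "'u \<times> 'u \<times> 'u \<Rightarrow> 'u" where "gs = (\<lambda>g. snd (snd g))"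
  have g [simp]: "gd (a, b, f) = a" "gc (a, b, f) = b" "gs (a, b, f) = f" for a b f by (simp_all add: gd_def gc_def gs_def)
  define GH where "GH = {(a, b, f). a \<in> Ob (HC A) \<and> b \<in> Ob (HC A) \<and> harr C f (mo J a) (mo J b)}"
  define GV where "GV = {(a, b, f). a \<in> Ob (HC A) \<and> b \<in> Ob (HC A) \<and> varr C f (mo J a) (mo J b)}"
  define H where "H = wcat (HC A) GH gd gc enc"
  define V where "V = wcat (VC A) GV gd gc enc"
  define eH where "eH = (\<lambda>f. evw (Cmp (HC C)) (mh J) gs (inv enc f))"
  define eV where "eV = (\<lambda>f. evw (Cmp (VC C)) (mv J) gs (inv enc f))"
  have fJ: "is_functor (HC A) (HC C) (mo J) (mh J)" "is_functor (VC A) (VC C) (mo J) (mv J)"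
    using J by (simp_all add: dfun_def)
  have H: "category H" and V: "category V" unfolding H_def V_def by (rule wcat_category[OF enc A.cats(1)] wcat_category[OF enc A.cats(2)])+
  have oH: "Ob H = Ob (HC A)" "Ob V = Ob (HC A)" by (simp_all add: H_def V_def wcat_sel(1)[OF enc] A.obs)
  have feH: "is_functor H (HC C) (mo J) eH" unfolding H_def eH_def
    by (rule wcat_functor[OF enc A.cats(1) C.cats(1) fJ(1)]) (auto simp: GH_def harr_def)
  have feV: "is_functor V (VC C) (mo J) eV" unfolding V_def eV_def
    by (rule wcat_functor[OF enc A.cats(2) C.cats(2) fJ(2)]) (auto simp: GV_def varr_def)
  interpret P: pullback C H V "mo J" eH eV cd
    by unfold_locales (use H V oH feH feV cd in auto)
  let ?Z = "P.pdbl"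
  define I where "I = \<lparr> mo = (\<lambda>x. x), mh = (\<lambda>m. enc (End m)), mv = (\<lambda>m. enc (End m)),
     ms = (\<lambda>\<alpha>. P.mk (enc (End (tp A \<alpha>))) (enc (End (bt A \<alpha>))) (enc (End (lft A \<alpha>))) (enc (End (rgt A \<alpha>))) (ms J \<alpha>)) \<rparr>"
  have I [simp]: "mo I a = a" "mh I m = enc (End m)" "mv I m = enc (End m)"
    "ms I \<alpha> = P.mk (enc (End (tp A \<alpha>))) (enc (End (bt A \<alpha>))) (enc (End (lft A \<alpha>))) (enc (End (rgt A \<alpha>))) (ms J \<alpha>)" for a m \<alpha>
    by (simp_all add: I_def)
  have eE [simp]: "eH (enc (End m)) = mh J m" "eV (enc (End m)) = mv J m" for m by (simp_all add: eH_def eV_def inv_f_f[OF enc])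
  have iH: "is_functor (HC A) H (\<lambda>x. x) (\<lambda>m. enc (End m))" unfolding H_def by (rule wcat_End_functor[OF enc A.cats(1)])
  have iV: "is_functor (VC A) V (\<lambda>x. x) (\<lambda>m. enc (End m))" unfolding V_def by (rule wcat_End_functor[OF enc A.cats(2)])
  have h: "enc (End f) \<in> Ar H" "Dm H (enc (End f)) = Dm (HC A) f" "Cd H (enc (End f)) = Cd (HC A) f" if "f \<in> Ar (HC A)" for f
    using iH that by (auto simp: is_functor_def)
  have v: "enc (End f) \<in> Ar V" "Dm V (enc (End f)) = Dm (VC A) f" "Cd V (enc (End f)) = Cd (VC A) f" if "f \<in> Ar (VC A)" for f
    using iV that by (auto simp: is_functor_def)
  have hi: "Idn H x = enc (End (Idn (HC A) x))" "Idn V x = enc (End (Idn (VC A) x))" for x by (simp_all add: H_def V_def wcat_sel[OF enc])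
  have hc: "Cmp H (enc (End f)) (enc (End f')) = enc (End (Cmp (HC A) f f'))" "Cmp V (enc (End f)) (enc (End f')) = enc (End (Cmp (VC A) f f'))" for f f'
    by (simp_all add: H_def V_def wcat_sel[OF enc])
  have ps: "P.psq (enc (End t)) (enc (End b)) (enc (End l)) (enc (End r)) (ms J \<alpha>)" if s: "sq A \<alpha> t b l r" for \<alpha> t b l r
    using A.corners[of \<alpha>] s h v dfun_sq[OF J s] by (auto simp: P.psq_def sq_def)
  have dI: "dfun A ?Z I"
    unfolding dfun_def P.pdbl_HV
  proof (intro conjI A.dc P.double_category_pdbl)
    show "is_functor (HC A) H (mo I) (mh I)" "is_functor (VC A) V (mo I) (mv I)" using iH iV by (simp_all add: I_def)
    show "is_functor (HS A) (HS ?Z) (mv I) (ms I)"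
      unfolding is_functor_def
    proof (intro conjI ballI impI)
      fix u assume "u \<in> Ob (HS A)" then have u: "u \<in> Ar (VC A)" "varr A u (Dm (VC A) u) (Cd (VC A) u)" by (simp_all add: A.obs varr_def)
      then show "mv I u \<in> Ob (HS ?Z)" using v by simp
      show "ms I (idsq A u) = idsq ?Z (mv I u)"
        using v[OF u(1)] dfun_idsq[OF J u(2)] A.sq_idsq[OF u(2)] by (simp add: sq_def hi)
    next
      fix \<alpha> assume "\<alpha> \<in> Sq A" then have s: "sq A \<alpha> (tp A \<alpha>) (bt A \<alpha>) (lft A \<alpha>) (rgt A \<alpha>)" by (simp add: sq_def)
      show "ms I \<alpha> \<in> Sq ?Z" using ps[OF s] by simp
      fix \<beta> assume "\<beta> \<in> Sq A" "rgt A \<alpha> = lft A \<beta>" then have s': "sq A \<beta> (tp A \<beta>) (bt A \<beta>) (rgt A \<alpha>) (rgt A \<beta>)" by (simp add: sq_def)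
      show "ms I (beside A \<alpha> \<beta>) = beside ?Z (ms I \<alpha>) (ms I \<beta>)"
        using A.sq_beside[OF s s'] dfun_beside[OF J s s'] by (simp add: sq_def hc)
    qed simp_all
    show "is_functor (VS A) (VS ?Z) (mh I) (ms I)"
      unfolding is_functor_def
    proof (intro conjI ballI impI)
      fix f assume "f \<in> Ob (VS A)" then have f: "f \<in> Ar (HC A)" "harr A f (Dm (HC A) f) (Cd (HC A) f)" by (simp_all add: A.obs harr_def)
      then show "mh I f \<in> Ob (VS ?Z)" using h by simp
      show "ms I (esq A f) = esq ?Z (mh I f)"
        using h[OF f(1)] dfun_esq[OF J f(2)] A.sq_esq[OF f(2)] by (simp add: sq_def hi)
    next
      fix \<alpha> assume "\<alpha> \<in> Ar (VS A)" then have s: "sq A \<alpha> (tp A \<alpha>) (bt A \<alpha>) (lft A \<alpha>) (rgt A \<alpha>)" by (simp add: sq_def A.obs)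
      show "ms I \<alpha> \<in> Ar (VS ?Z)" using ps[OF s] by simp
      fix \<beta> assume "\<beta> \<in> Ar (VS A)" "bt A \<alpha> = tp A \<beta>" then have s': "sq A \<beta> (bt A \<alpha>) (bt A \<beta>) (lft A \<beta>) (rgt A \<beta>)" by (simp add: sq_def A.obs)
      show "ms I (above A \<alpha> \<beta>) = above ?Z (ms I \<alpha>) (ms I \<beta>)"
        using A.sq_above[OF s s'] dfun_above[OF J s s'] by (simp add: sq_def hc)
    qed simp_all
  qed
  have r: "dctf ?Z C P.pmap"
  proof (rule P.dctf_pmap)
    show "\<exists>x\<in>Ob H. mo J x = c" if "c \<in> Ob (HC C)" for c using surj[OF that] oH by simp
    show "\<exists>f\<in>Ar H. Dm H f = x \<and> Cd H f = y \<and> eH f = k" if "x \<in> Ob H" "y \<in> Ob H" "harr C k (mo J x) (mo J y)" for x y k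
    proof -
      have o: "x \<in> Ob (HC A)" "y \<in> Ob (HC A)" using that oH by auto
      \<comment> \<open>A lone generator padded with identity letters is a lift of
        \<open>k\<close>.\<close>
      let ?w = "Step (Idn (HC A) x) (x, y, k) (End (Idn (HC A) y))"
      have "(x, y, k) \<in> GH" using that o by (simp add: GH_def)
      then have "vword (HC A) GH gd gc ?w x y" using category_Idn[OF A.cats(1)] o by simp
      then have "enc ?w \<in> Ar H \<and> Dm H (enc ?w) = x \<and> Cd H (enc ?w) = y" unfolding H_def wcat_hom[OF enc] by blast
      moreover have "eH (enc ?w) = k" using dfun_hid[OF J] o C.harr_idl[OF that(3)] C.harr_idr[OF that(3)] by (simp add: eH_def inv_f_f[OF enc])
      ultimately show ?thesis by blast
    qed
    show "\<exists>f\<in>Ar V. Dm V f = x \<and> Cd V f = y \<and> eV f = k" if "x \<in> Ob H" "y \<in> Ob H" "varr C k (mo J x) (mo J y)" for x y k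
    proof -
      have o: "x \<in> Ob (HC A)" "y \<in> Ob (HC A)" using that oH by auto
      let ?w = "Step (Idn (VC A) x) (x, y, k) (End (Idn (VC A) y))"
      have "(x, y, k) \<in> GV" using that o by (simp add: GV_def)
      then have "vword (VC A) GV gd gc ?w x y" using category_Idn[OF A.cats(2)] o A.obs by simp
      then have "enc ?w \<in> Ar V \<and> Dm V (enc ?w) = x \<and> Cd V (enc ?w) = y" unfolding V_def wcat_hom[OF enc] by blast
      moreover have "eV (enc ?w) = k" using dfun_vid[OF J] o C.varr_idl[OF that(3)] C.varr_idr[OF that(3)] by (simp add: eV_def inv_f_f[OF enc])
      ultimately show ?thesis by blast
    qed
  qed
  have m: "meq A (mcomp I P.pmap) J" by (simp add: meq_def)
  have GH: "gd g \<in> Ob (HC A) \<and> gc g \<in> Ob (HC A)" if "g \<in> GH" for g using that by (auto simp: GH_def)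
  have GV: "gd g \<in> Ob (VC A) \<and> gc g \<in> Ob (VC A)" if "g \<in> GV" for g using that by (auto simp: GV_def A.obs)
  have mI: "mh I = (\<lambda>m. enc (End m))" "mv I = (\<lambda>m. enc (End m))" by (simp_all add: I_def)
  have fH: "free_over A ?Z I GH gd gc (wgen (HC A) gd gc enc)"
    unfolding free_over_def mI harr_def P.pdbl_HV unfolding H_def
  proof (intro conjI ballI allI impI)
    fix g assume g: "g \<in> GH"
    show "gd g \<in> Ob (HC A)" "gc g \<in> Ob (HC A)" using GH[OF g] by auto
    then show "wgen (HC A) gd gc enc g \<in> Ar (wcat (HC A) GH gd gc enc)" "Dm (wcat (HC A) GH gd gc enc) (wgen (HC A) gd gc enc g) = gd g"
      "Cd (wcat (HC A) GH gd gc enc) (wgen (HC A) gd gc enc g) = gc g"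
      using wcat_gen[OF enc A.cats(1) g] by auto
  next
    fix f x y assume f: "f \<in> Ar (wcat (HC A) GH gd gc enc) \<and> Dm (wcat (HC A) GH gd gc enc) f = x \<and> Cd (wcat (HC A) GH gd gc enc) f = y"
    show "\<exists>!w. vword (HC A) GH gd gc w x y \<and> evw (Cmp (wcat (HC A) GH gd gc enc)) (\<lambda>m. enc (End m)) (wgen (HC A) gd gc enc) w = f"
      by (rule wcat_free[OF enc A.cats(1) GH]) (use f in auto)
  qed
  have fV: "free_over (transpose A) (transpose ?Z) (mtranspose I) GV gd gc (wgen (VC A) gd gc enc)"
    unfolding free_over_def mtranspose_sel mI harr_transpose varr_def transpose_sel P.pdbl_HV unfolding V_def
  proof (intro conjI ballI allI impI)
    fix g assume g: "g \<in> GV"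
    show "gd g \<in> Ob (VC A)" "gc g \<in> Ob (VC A)" using GV[OF g] by auto
    then show "wgen (VC A) gd gc enc g \<in> Ar (wcat (VC A) GV gd gc enc)" "Dm (wcat (VC A) GV gd gc enc) (wgen (VC A) gd gc enc g) = gd g"
      "Cd (wcat (VC A) GV gd gc enc) (wgen (VC A) gd gc enc g) = gc g"
      using wcat_gen[OF enc A.cats(2) g] by auto
  next
    fix f x y assume f: "f \<in> Ar (wcat (VC A) GV gd gc enc) \<and> Dm (wcat (VC A) GV gd gc enc) f = x \<and> Cd (wcat (VC A) GV gd gc enc) f = y"
    show "\<exists>!w. vword (VC A) GV gd gc w x y \<and> evw (Cmp (wcat (VC A) GV gd gc enc)) (\<lambda>m. enc (End m)) (wgen (VC A) gd gc enc) w = f"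
      by (rule wcat_free[OF enc A.cats(2) GV]) (use f in auto)
  qed
  have inj: "inj (mh I)" "inj (mv I)" unfolding mI using injD[OF enc] by (auto simp: inj_def)
  show ?thesis
    by (rule that[OF r dI _ I(1) m inj fH fV]) (simp add: oH)
qed

lemma dfun_cells:
  assumes "dfun A B m"
  shows "x \<in> Ob (HC A) \<Longrightarrow> mo m x \<in> Ob (HC B)" "x \<in> Ar (HC A) \<Longrightarrow> mh m x \<in> Ar (HC B)"
    "x \<in> Ar (VC A) \<Longrightarrow> mv m x \<in> Ar (VC B)" "x \<in> Sq A \<Longrightarrow> ms m x \<in> Sq B"
  using assms by (auto simp: dfun_def is_functor_def)

lemma mcomp_assoc: "mcomp (mcomp a b) c = mcomp a (mcomp b c)"
  by (simp add: mcomp_def)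

lemma meq_sym: "meq A m n \<Longrightarrow> meq A n m"
  by (simp add: meq_def)

lemma meq_trans: "meq A m n \<Longrightarrow> meq A n k \<Longrightarrow> meq A m k"
  by (simp add: meq_def)

lemma meq_mcomp_left: "meq A m n \<Longrightarrow> meq A (mcomp m k) (mcomp n k)"
  by (simp add: meq_def)

lemma meq_mcomp_right: "dfun A B m \<Longrightarrow> meq B n k \<Longrightarrow> meq A (mcomp m n) (mcomp m k)"
  using dfun_cells[of A B m] by (simp add: meq_def)

lemma mconst_meq: assumes "meq A m n" "mconst A F n" shows "mconst A F m"
proof -
  have e: "\<And>x. x \<in> Ob (HC A) \<Longrightarrow> mo m x = mo n x" "\<And>x. x \<in> Ar (HC A) \<Longrightarrow> mh m x = mh n x"
    "\<And>x. x \<in> Ar (VC A) \<Longrightarrow> mv m x = mv n x" "\<And>x. x \<in> Sq A \<Longrightarrow> ms m x = ms n x"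
    using assms(1) by (auto simp: meq_def)
  show ?thesis
    unfolding mconst_def by (intro conjI ballI impI; (simp only: e)?) (blast intro: mconst_D[OF assms(2)])+
qed

lemma dctf_meq_cancel:
  assumes F: "dctf A B F" and e: "meq A (mcomp F m) (mcomp F n)" shows "meq B m n"
proof -
  have "mo m y = mo n y" if "y \<in> Ob (HC B)" for y
    using dctf_ob[OF F that] e unfolding meq_def mcomp_sel by metis
  then show ?thesis
    using dctf_lifts[OF F] e unfolding meq_def mcomp_sel by metis
qed

section \<open>The two normalisations, and the mapping property of the result\<close>

lemma normalized_extension:
  fixes A B C :: "'u dblcat"
  assumes F: "dctf A B F" and J: "dfun A C J" and surj: "\<And>c. c \<in> Ob (HC C) \<Longrightarrow> \<exists>a\<in>Ob (HC A). mo J a = c"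
    and enc: "inj (enc :: ('u, 'u \<times> 'u \<times> 'u) word \<Rightarrow> 'u)" and cd: "inj (cd :: 'u \<times> 'u \<times> 'u \<times> 'u \<times> 'u \<Rightarrow> 'u)"
  obtains Z W r I G where "dctf Z C r" "dfun A Z I" "meq A (mcomp I r) J" "dctf Z W G" "mconst A F (mcomp I G)"
    "\<And>Y K. dfun Z Y K \<Longrightarrow> mconst A F (mcomp I K) \<Longrightarrow> dfun W Y K \<and> meq Z (mcomp G K) K"
proof -
  obtain Z I r and GH GV :: "('u \<times> 'u \<times> 'u) set" and gd gc gh gv where
    r: "dctf Z C r" and I: "dfun A Z I" and ob: "Ob (HC Z) = Ob (HC A)" "\<And>a. mo I a = a" and Ir: "meq A (mcomp I r) J"
    and inj: "inj (mh I)" "inj (mv I)" and fH: "free_over A Z I GH gd gc gh"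
    and fV: "free_over (transpose A) (transpose Z) (mtranspose I) GV gd gc gv"
    by (rule free_extension[OF J _ enc cd]; (erule surj | (rule that; assumption)))
  note dF = dctf_dfun[OF F]
  interpret A: dcat A using dfun_dcat(1)[OF dF] .
  interpret B: dcat B using dfun_dcat(2)[OF dF] .
  interpret Z: dcat Z using dfun_dcat(2)[OF I] .
  interpret tA: dcat "transpose A" using A.double_category_transpose by (simp add: dcat_def)
  interpret tZ: dcat "transpose Z" using Z.double_category_transpose by (simp add: dcat_def)
  \<comment> \<open>No object moves at this stage: \<open>n0\<close> is the identity and the
    connecting arrows are horizontal identities. Hence horizontal arrows stay as they are and only
    the letters of vertical words are rewritten.\<close>
  interpret S1: word_data "transpose A" "transpose Z" "transpose B" "mtranspose F" "mtranspose I" GV gd gc gv "\<lambda>x. x" "Idn (HC A)" "Idn (HC A)"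
  proof
    show "dctf (transpose A) (transpose B) (mtranspose F)" by (rule dctf_transpose[OF F])
    show "dfun (transpose A) (transpose Z) (mtranspose I)" by (rule dfun_transpose[OF I])
    show "Ob (HC (transpose Z)) = Ob (HC (transpose A))" by (simp add: A.obs Z.obs ob)
    show "mo (mtranspose I) a = a" for a by (simp add: ob)
    show "gd g \<in> Ob (HC (transpose A))" "gc g \<in> Ob (HC (transpose A))" "harr (transpose Z) (gv g) (gd g) (gc g)" if "g \<in> GV" for g
      using fV that unfolding free_over_def by blast+
    show "\<exists>!w. vword (HC (transpose A)) GV gd gc w x y \<and> evw (Cmp (HC (transpose Z))) (mh (mtranspose I)) gv w = f"
      if "harr (transpose Z) f x y" for f x y
      using fV that unfolding free_over_def by blast
    show "ms (mtranspose I) \<alpha> = ms (mtranspose I) \<beta>" if s: "sq (transpose A) \<alpha> t b u v" "sq (transpose A) \<beta> t b u' v'"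
      "ms (mtranspose F) \<alpha> = ms (mtranspose F) \<beta>" "mv (mtranspose I) u = mv (mtranspose I) u'" "mv (mtranspose I) v = mv (mtranspose I) v'" for \<alpha> \<beta> t b u v u' v'
    proof -
      have "u' = u" "v' = v" using s(4,5) injD[OF inj(1)] by simp_all
      then have "\<alpha> = \<beta>" using dctf_sq_inj[OF dctf_transpose[OF F] s(1) _ s(3)] s(2) by simp
      then show ?thesis by simp
    qed
    fix x assume "x \<in> Ob (HC (transpose A))" then have x: "x \<in> Ob (HC A)" by (simp add: A.obs)
    have i: "Cmp (HC Z) (Idn (HC Z) x) (Idn (HC Z) x) = Idn (HC Z) x" using Z.harr_idl[OF Z.harr_id] x ob by simp
    show "varr (transpose A) (Idn (HC A) x) x x" using A.harr_id[OF x] by simp_all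
    show "mv (mtranspose F) (Idn (HC A) x) = Idn (VC (transpose B)) (mo (mtranspose F) x)"
      using dfun_hid[OF dF x] by simp_all
    show "Idn (HC A) x = Idn (VC (transpose A)) x" by simp
    show "Cmp (VC (transpose Z)) (mv (mtranspose I) (Idn (HC A) x)) (mv (mtranspose I) (Idn (HC A) x)) = Idn (VC (transpose Z)) x"
      using dfun_hid[OF I x] i ob by simp_all
  qed simp_all
  define cm where "cm = S1.N.conjmap"
  have cm: "mo cm = (\<lambda>x. x)" "mh cm = S1.wH" "mv cm = S1.N.nV" "ms cm = S1.N.nS"
    unfolding cm_def by (rule S1.N.conjmap_sel)+
  define N1 where "N1 = mtranspose cm"
  define W1 where "W1 = fixdbl Z N1"
  have N1: "normalizer Z N1" using normalizer_transpose[OF S1.N.normalizer[folded cm_def]] by (simp add: N1_def)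
  have "transpose (fixdbl (transpose Z) cm) = W1"
    unfolding W1_def N1_def using fixdbl_transpose[of "transpose Z" cm] by simp
  then have G1: "dctf Z W1 N1" using dctf_transpose[OF S1.dctf_N[folded cm_def]] by (simp add: N1_def)
  have N1o: "mo N1 x = x" for x by (simp add: N1_def cm)
  have N1v: "mv N1 u = S1.wH u" for u unfolding N1_def mtranspose_sel(3) cm ..
  have N1h: "mh N1 f = f" if f: "harr Z f x y" for f x y
  proof -
    have o: "x \<in> Ob (HC A)" "y \<in> Ob (HC A)" using Z.harr_ob[OF f] ob by auto
    have ft: "varr (transpose Z) f x y" using f by simp
    have "mh N1 f = S1.N.nV f" unfolding N1_def mtranspose_sel(2) cm ..
    then show ?thesis
      using S1.N.nV_eq[OF ft] dfun_hid[OF I o(1)] dfun_hid[OF I o(2)] Z.harr_idl[OF f] Z.harr_idr[OF f] by (simp add: ob)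
  qed
  define I1 where "I1 = mcomp I N1"
  have I1: "dfun A W1 I1" unfolding I1_def by (rule dfun_mcomp[OF I dctf_dfun[OF G1]])
  interpret W1: dcat W1 using dfun_dcat(2)[OF I1] .
  have I1o: "mo I1 a = a" for a by (simp add: I1_def ob N1o)
  have obW: "Ob (HC W1) = Ob (HC A)" by (auto simp: W1_def N1o ob)
  have harrW: "harr W1 f x y \<longleftrightarrow> harr Z f x y" for f x y
  proof -
    have "mh N1 f = f" if "f \<in> Ar (HC Z)" for f using N1h[of f] that by (simp add: harr_def)
    then have "mh N1 ` Ar (HC Z) = Ar (HC Z)" by (simp add: image_def)
    then show ?thesis by (simp add: harr_def W1_def)
  qed
  have I1h: "mh I1 f = mh I f" if "harr A f x y" for f x y
    using N1h[OF dfun_harr[OF I that]] by (simp add: I1_def)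
  have cmpW: "Cmp (HC W1) f g = Cmp (HC Z) f g" if "harr Z f x y" "harr Z g y z" for f g x y z
    using N1h[OF Z.harr_comp[OF that]] by (simp add: W1_def)
  \<comment> \<open>The gain of the first stage. Equality of the ends is still required, since
    objects have not been merged.\<close>
  have EV: "mv I1 u = mv I1 u'" if "varr A u x y" "varr A u' x y" "mv F u = mv F u'" for u u' x y
    unfolding I1_def mcomp_sel N1v using S1.wH_I_const[of u x y u' x y] that by simp
  \<comment> \<open>The squares share \<open>t\<close> and \<open>b\<close>, so in the transpose
    their sides agree outright, while the images of \<open>u\<close> and \<open>u'\<close>, and of
    \<open>v\<close> and \<open>v'\<close>, agree because the squares have the same image under
    \<open>F\<close>.\<close>
  have collapse: "ms I1 \<alpha> = ms I1 \<beta>" if a: "sq A \<alpha> t b u v" "sq A \<beta> t b u' v'" "ms F \<alpha> = ms F \<beta>" for \<alpha> \<beta> t b u v u' v'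
  proof -
    note c = A.sq_corners[OF a(1)] A.sq_corners[OF a(2)]
    have "S1.N.nS (ms (mtranspose I) \<alpha>) = S1.N.nS (ms (mtranspose I) \<beta>)"
      by (rule S1.nS_I_const[of \<alpha> u v t b _ _ _ _ \<beta> u' v' t b]) (use a c in \<open>simp_all add: sq_transpose[OF A.dc]\<close>)
    moreover have "ms I1 \<gamma> = S1.N.nS (ms (mtranspose I) \<gamma>)" for \<gamma>
      unfolding I1_def mcomp_sel N1_def mtranspose_sel(4) cm ..
    ultimately show ?thesis by simp
  qed
  \<comment> \<open>The first stage leaves horizontal arrows and their composition untouched, so the
    words that describe them in \<open>Z\<close> still do so in \<open>W1\<close>.\<close>
  have freeW: "\<exists>!w. vword (HC A) GH gd gc w x y \<and> evw (Cmp (HC W1)) (mh I1) gh w = f" if f: "harr W1 f x y" for f x y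
  proof -
    have gen: "\<And>g. g \<in> GH \<Longrightarrow> harr Z (gh g) (gd g) (gc g)" using fH unfolding free_over_def by blast
    have e: "evw (Cmp (HC W1)) (mh I1) gh w = evw (Cmp (HC Z)) (mh I) gh w \<and> harr Z (evw (Cmp (HC Z)) (mh I) gh w) x y"
      if "vword (HC A) GH gd gc w x y" for w x
      using that
    proof (induction w arbitrary: x)
      case (End m)
      then have m: "harr A m x y" by (simp add: harr_def)
      show ?case using I1h[OF m] dfun_harr[OF I m] ob by simp
    next
      case (Step m g w)
      then have m: "harr A m x (gd g)" and g: "g \<in> GH" and w: "vword (HC A) GH gd gc w (gc g) y" by (auto simp: harr_def)
      have m': "harr Z (mh I m) x (gd g)" using dfun_harr[OF I m] ob by simp
      note ih = Step.IH[OF w]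
      note gw = Z.harr_comp[OF gen[OF g] conjunct2[OF ih]]
      show ?case
        using ih I1h[OF m] cmpW[OF gen[OF g] conjunct2[OF ih]] cmpW[OF m' gw] Z.harr_comp[OF m' gw] by simp
    qed
    have "\<exists>!w. vword (HC A) GH gd gc w x y \<and> evw (Cmp (HC Z)) (mh I) gh w = f"
      using fH f unfolding harrW free_over_def by blast
    then show ?thesis using e by metis
  qed
  \<comment> \<open>The choice depends on \<open>mo F x\<close> alone, which gives both idempotence
    and equality on fibres.\<close>
  define n0 where "n0 = (\<lambda>x. SOME y. y \<in> Ob (HC A) \<and> mo F y = mo F x)"
  have n0: "n0 x \<in> Ob (HC A)" "mo F (n0 x) = mo F x" if "x \<in> Ob (HC A)" for x
  proof -
    have "n0 x \<in> Ob (HC A) \<and> mo F (n0 x) = mo F x" unfolding n0_def by (rule someI[of _ x]) (use that in simp)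
    then show "n0 x \<in> Ob (HC A)" "mo F (n0 x) = mo F x" by auto
  qed
  have n0eq: "n0 x = n0 y" if "mo F x = mo F y" for x y using that by (simp add: n0_def)
  \<comment> \<open>Separating the case \<open>x = y\<close> makes the connecting arrow of a
    representative an identity, as \<open>lam_n0\<close> demands.\<close>
  define lv where "lv = (\<lambda>x y. if x = y then Idn (VC A) x else SOME u. varr A u x y \<and> mv F u = Idn (VC B) (mo F x))"
  have lv: "varr A (lv x y) x y" "mv F (lv x y) = Idn (VC B) (mo F x)" if o: "x \<in> Ob (HC A)" "y \<in> Ob (HC A)" "mo F x = mo F y" for x y
  proof -
    have "varr B (Idn (VC B) (mo F x)) (mo F x) (mo F y)" using B.varr_id[OF dfun_ob[OF dF o(1)]] o(3) by simp
    then obtain u where "varr A u x y \<and> mv F u = Idn (VC B) (mo F x)" using dctf_v[OF F _ o(1,2)] by metis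
    then have "varr A (SOME u. varr A u x y \<and> mv F u = Idn (VC B) (mo F x)) x y \<and>
       mv F (SOME u. varr A u x y \<and> mv F u = Idn (VC B) (mo F x)) = Idn (VC B) (mo F x)" by (rule someI)
    then show "varr A (lv x y) x y" "mv F (lv x y) = Idn (VC B) (mo F x)"
      using A.varr_id[OF o(1)] dfun_vid[OF dF o(1)] by (auto simp: lv_def)
  qed
  \<comment> \<open>The round trip is a loop at \<open>x\<close> over an identity, so
    \<open>EV\<close> identifies it with the identity at \<open>x\<close>.\<close>
  have lvc: "Cmp (VC W1) (mv I1 (lv x y)) (mv I1 (lv y x)) = Idn (VC W1) x" if o: "x \<in> Ob (HC A)" "y \<in> Ob (HC A)" "mo F x = mo F y" for x y
  proof -
    note a = lv(1)[OF o] lv(1)[OF o(2,1) o(3)[symmetric]]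
    have "mv F (Cmp (VC A) (lv x y) (lv y x)) = Idn (VC B) (mo F x)"
      using dfun_vcomp[OF dF a] lv(2)[OF o] lv(2)[OF o(2,1) o(3)[symmetric]] o(3) B.varr_idl[OF B.varr_id[OF dfun_ob[OF dF o(2)]]] by simp
    then have "mv I1 (Cmp (VC A) (lv x y) (lv y x)) = mv I1 (Idn (VC A) x)"
      using EV[OF A.varr_comp[OF a] A.varr_id[OF o(1)]] dfun_vid[OF dF o(1)] by simp
    then show ?thesis using dfun_vcomp[OF I1 a] dfun_vid[OF I1 o(1)] by (simp add: I1o)
  qed
  interpret S2: word_data A W1 B F I1 GH gd gc gh n0 "\<lambda>x. lv (n0 x) x" "\<lambda>x. lv x (n0 x)"
  proof
    show "dctf A B F" "dfun A W1 I1" "Ob (HC W1) = Ob (HC A)" by (rule F I1 obW)+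
    show "mo I1 a = a" for a by (rule I1o)
    show "gd g \<in> Ob (HC A)" "gc g \<in> Ob (HC A)" "harr W1 (gh g) (gd g) (gc g)" if "g \<in> GH" for g
      using fH that unfolding free_over_def harrW by blast+
    show "\<exists>!w. vword (HC A) GH gd gc w x y \<and> evw (Cmp (HC W1)) (mh I1) gh w = f" if "harr W1 f x y" for f x y
      by (rule freeW[OF that])
    show "ms I1 \<alpha> = ms I1 \<beta>" if "sq A \<alpha> t b u v" "sq A \<beta> t b u' v'" "ms F \<alpha> = ms F \<beta>" for \<alpha> \<beta> t b u v u' v'
      by (rule collapse[OF that])
    fix x assume x: "x \<in> Ob (HC A)"
    show "n0 x \<in> Ob (HC A)" "mo F (n0 x) = mo F x" "n0 (n0 x) = n0 x"
      by (rule n0[OF x] n0eq[OF n0(2)[OF x]])+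
    note o = n0(1)[OF x] x n0(2)[OF x]
    show "varr A (lv (n0 x) x) (n0 x) x" "mv F (lv (n0 x) x) = Idn (VC B) (mo F x)" using lv[OF o] o(3) by simp_all
    show "varr A (lv x (n0 x)) x (n0 x)" "mv F (lv x (n0 x)) = Idn (VC B) (mo F x)" using lv[OF o(2,1) o(3)[symmetric]] by simp_all
    show "lv (n0 (n0 x)) (n0 x) = Idn (VC A) (n0 x)" using n0eq[OF n0(2)[OF x]] by (simp add: lv_def)
    show "Cmp (VC W1) (mv I1 (lv (n0 x) x)) (mv I1 (lv x (n0 x))) = Idn (VC W1) (n0 x)" by (rule lvc[OF o])
    show "Cmp (VC W1) (mv I1 (lv x (n0 x))) (mv I1 (lv (n0 x) x)) = Idn (VC W1) x" by (rule lvc[OF o(2,1) o(3)[symmetric]])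
  qed
  define N2 where "N2 = S2.N.conjmap"
  define W2 where "W2 = fixdbl W1 N2"
  have G2: "dctf W1 W2 N2" unfolding W2_def N2_def by (rule S2.dctf_N)
  have c2: "mconst A F (mcomp I1 N2)" unfolding N2_def by (rule S2.mconst_N; (erule n0eq | (rule EV; assumption)))
  define G where "G = mcomp N1 N2"
  have G: "dctf Z W2 G" unfolding G_def by (rule dctf_mcomp[OF G1 G2])
  have c: "mconst A F (mcomp I G)" using c2 unfolding I1_def G_def mcomp_assoc .
  \<comment> \<open>\<open>K\<close> is invariant under each stage in turn, so it induces itself on
    the cells that remain.\<close>
  have u: "dfun W2 Y K \<and> meq Z (mcomp G K) K" if K: "dfun Z Y K" and k: "mconst A F (mcomp I K)" for Y K
  proof -
    have "meq (transpose Z) (mcomp cm (mtranspose K)) (mtranspose K)"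
      unfolding cm_def
    proof (rule S1.meq_conjmap[OF dfun_transpose[OF K]])
      show "mconst (transpose A) (mtranspose F) (mcomp (mtranspose I) (mtranspose K))"
        using k unfolding mconst_def mcomp_sel mtranspose_sel transpose_sel A.obs by (elim conjE) (intro conjI; assumption)
    qed
    then have e1: "meq Z (mcomp N1 K) K" by (simp add: meq_def N1_def Z.obs)
    have K1: "dfun W1 Y K" unfolding W1_def by (rule dfun_from_fixdbl[OF N1 K e1])
    have "mconst A F (mcomp I1 K)"
    proof -
      have "meq A (mcomp I1 K) (mcomp I K)"
        unfolding I1_def mcomp_assoc by (rule meq_mcomp_right[OF I e1])
      then show ?thesis using mconst_meq k by blast
    qed
    then have e2: "meq W1 (mcomp N2 K) K" unfolding N2_def by (rule S2.meq_conjmap[OF K1])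
    have "normalizer W1 N2" unfolding N2_def by (rule S2.N.normalizer)
    then have K2: "dfun W2 Y K" unfolding W2_def by (rule dfun_from_fixdbl[OF _ K1 e2])
    have "meq Z (mcomp G K) K"
      unfolding G_def mcomp_assoc by (rule meq_trans[OF meq_mcomp_right[OF dctf_dfun[OF G1] e2] e1])
    then show ?thesis using K2 by blast
  qed
  show ?thesis by (rule that[OF r I Ir G c u])
qed

text \<open>Adjoining the objects of \<open>C\<close> as isolated points to \<open>A\<close> and to
  \<open>B\<close> makes the map to \<open>C\<close> surjective on objects. Every map is afterwards
  restricted to the original summands; as the points are identified with nothing, they impose no
  condition on maps out of \<open>W\<close>.\<close>

lemma pushout_approximation:
  fixes A B C :: "'u dblcat"
  assumes inf: "infinite (UNIV :: 'u set)" and F: "dctf A B F" and J: "dfun A C J"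
  obtains Z W r I G j where "dctf Z C r" "dfun A Z I" "meq A (mcomp I r) J" "dctf Z W G" "dfun B W j"
    "meq A (mcomp I G) (mcomp F j)"
    "\<And>Y K k. dfun Z Y K \<Longrightarrow> dfun B Y k \<Longrightarrow> meq A (mcomp I K) (mcomp F k) \<Longrightarrow>
       dfun W Y K \<and> meq Z (mcomp G K) K \<and> meq B (mcomp j K) k"
proof -
  obtain e :: "'u + 'u \<Rightarrow> 'u" and enc :: "('u, 'u \<times> 'u \<times> 'u) word \<Rightarrow> 'u" and cd :: "'u \<times> 'u \<times> 'u \<times> 'u \<times> 'u \<Rightarrow> 'u"
    where e: "inj e" and enc: "inj enc" and cd: "inj cd" using inj_codes[OF inf] .
  interpret C: dcat C using dfun_dcat(2)[OF J] .
  note dF = dctf_dfun[OF F]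
  let ?X = "Ob (HC C)"
  let ?A = "pdc e ?X A" and ?B = "pdc e ?X B" and ?F = "pmadd e F" and ?i = "pinl e"
  have FF: "dctf ?A ?B ?F" by (rule dctf_pmadd[OF e F])
  have JJ: "dfun ?A C (pext e C J)" by (rule dfun_pext[OF e J])
  have su: "\<exists>a\<in>Ob (HC ?A). mo (pext e C J) a = c" if "c \<in> Ob (HC C)" for c
    by (rule bexI[of _ "e (Inr c)"]) (use that in \<open>simp_all add: pext_sel[OF e] pcat_mem[OF e]\<close>)
  obtain Z W r I G where r: "dctf Z C r" and I: "dfun ?A Z I" and Ir: "meq ?A (mcomp I r) (pext e C J)"
    and G: "dctf Z W G" and c: "mconst ?A ?F (mcomp I G)"
    and u: "\<And>Y K. dfun Z Y K \<Longrightarrow> mconst ?A ?F (mcomp I K) \<Longrightarrow> dfun W Y K \<and> meq Z (mcomp G K) K"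
    by (rule normalized_extension[OF FF JJ _ enc cd]; (erule su | (rule that; assumption)))
  obtain j where j: "dfun ?B W j" "meq ?A (mcomp ?F j) (mcomp I G)"
    using dctf_descend[OF FF dfun_mcomp[OF I dctf_dfun[OF G]] c] .
  have iA: "dfun A ?A ?i" and iB: "dfun B ?B ?i" using dfun_pinl[OF e] dfun_dc[OF dF] by auto
  let ?I = "mcomp ?i I" and ?j = "mcomp ?i j"
  have 1: "dfun A Z ?I" "dfun B W ?j" using dfun_mcomp[OF iA I] dfun_mcomp[OF iB j(1)] by auto
  have 2: "meq A (mcomp ?I r) J"
    using Ir unfolding meq_def by (simp add: pinl_sel[OF e] pext_sel[OF e] ball_pcat[OF e])
  have 3: "meq A (mcomp ?I G) (mcomp F ?j)"
    using j(2) unfolding meq_def by (simp add: pinl_sel[OF e] pmadd_sel[OF e] padd_simps[OF e] ball_pcat[OF e])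
  have 4: "dfun W Y K \<and> meq Z (mcomp G K) K \<and> meq B (mcomp ?j K) k"
    if K: "dfun Z Y K" and k: "dfun B Y k" and m: "meq A (mcomp ?I K) (mcomp F k)" for Y K k
  proof -
    \<comment> \<open>On the original summand \<open>K\<close> after \<open>I\<close> factors as
      \<open>F\<close> followed by \<open>k\<close>; on the isolated points \<open>?F\<close> is
      injective.\<close>
    have "mconst ?A ?F (mcomp I K)"
      using m unfolding mconst_def meq_def
      by (simp add: pinl_sel[OF e] pmadd_sel[OF e] padd_simps[OF e] ball_pcat[OF e] inj_eq[OF e])
    note v = u[OF K this]
    have "meq A (mcomp F (mcomp ?j K)) (mcomp (mcomp ?I G) K)"
      using meq_mcomp_left[OF meq_sym[OF 3], of K] by (simp only: mcomp_assoc)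
    moreover have "meq A (mcomp (mcomp ?I G) K) (mcomp ?I K)"
      using meq_mcomp_right[OF 1(1), of "mcomp G K" K] v by (simp only: mcomp_assoc)
    ultimately have "meq B (mcomp ?j K) k"
      using dctf_meq_cancel[OF F] m meq_trans by metis
    then show ?thesis using v by blast
  qed
  show ?thesis by (rule that[OF r 1(1) 2 G 1(2) 3 4])
qed

section \<open>Left properness\<close>

lemma hom_comp: "category C \<Longrightarrow> f \<in> hom C a b \<Longrightarrow> g \<in> hom C b c \<Longrightarrow> Cmp C f g \<in> hom C a c"
  using category_Cmp[of C f g] by (auto simp: hom_def)

lemma hom_assoc: "category C \<Longrightarrow> f \<in> hom C a b \<Longrightarrow> g \<in> hom C b c \<Longrightarrow> h \<in> hom C c d \<Longrightarrow>
   Cmp C (Cmp C f g) h = Cmp C f (Cmp C g h)"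
  using category_assoc[of C f g h] by (auto simp: hom_def)

lemma hom_id: "category C \<Longrightarrow> a \<in> Ob C \<Longrightarrow> Idn C a \<in> hom C a a"
  using category_Idn[of C a] by (auto simp: hom_def)

lemma hom_unit: "category C \<Longrightarrow> f \<in> hom C a b \<Longrightarrow> Cmp C (Idn C a) f = f \<and> Cmp C f (Idn C b) = f"
  using category_unit[of C f] by (auto simp: hom_def)

lemma hom_ob: "category C \<Longrightarrow> f \<in> hom C a b \<Longrightarrow> a \<in> Ob C \<and> b \<in> Ob C"
  using category_Dm_Cd[of C f] by (auto simp: hom_def)

lemma lifts_againstD:
  assumes "lifts_against C i p" "i \<in> hom C a b" "p \<in> hom C x y" "u \<in> hom C a x" "v \<in> hom C b y" "Cmp C u p = Cmp C i v"
  obtains h where "h \<in> hom C b x" "Cmp C i h = u" "Cmp C h p = v"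
proof -
  have "Dm C i = a" "Cd C i = b" "Dm C p = x" "Cd C p = y" using assms(2,3) by (auto simp: hom_def)
  then show ?thesis using assms that unfolding lifts_against_def by blast
qed

text \<open>Maps out of \<open>W\<close> need only exist: \<open>t\<close> serves as a retraction,
  and the uniqueness that makes it one comes from the given pushout.\<close>

lemma left_proper_criterion:
  assumes C: "category C" and M: "model_structure C M"
    and approx: "\<And>p h A B X. p \<in> Fib M \<inter> Weq M \<Longrightarrow> p \<in> hom C A B \<Longrightarrow> h \<in> hom C A X \<Longrightarrow>
      \<exists>Z W. \<exists>r\<in>Fib M \<inter> Weq M \<inter> hom C Z X. \<exists>I\<in>hom C A Z. \<exists>G\<in>Weq M \<inter> hom C Z W. \<exists>j\<in>hom C B W.
        Cmp C I r = h \<and> Cmp C I G = Cmp C p j \<and>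
        (\<forall>Y. \<forall>K\<in>hom C Z Y. \<forall>k\<in>hom C B Y. Cmp C I K = Cmp C p k \<longrightarrow>
          (\<exists>t\<in>hom C W Y. Cmp C G t = K \<and> Cmp C j t = k))"
  shows "left_proper C M"
  unfolding left_proper_def
proof (intro allI impI)
  fix f i f' i' assume f: "f \<in> Weq M" and i: "i \<in> Cof M" and po: "is_pushout C f i f' i'"
  have sub: "Weq M \<subseteq> Ar C" "Cof M \<subseteq> Ar C" "Fib M \<subseteq> Ar C"
    and two: "\<forall>f\<in>Ar C. \<forall>g\<in>Ar C. Cd C f = Dm C g \<longrightarrow>
        (f \<in> Weq M \<and> g \<in> Weq M \<longrightarrow> Cmp C f g \<in> Weq M) \<and>
        (f \<in> Weq M \<and> Cmp C f g \<in> Weq M \<longrightarrow> g \<in> Weq M) \<and>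
        (g \<in> Weq M \<and> Cmp C f g \<in> Weq M \<longrightarrow> f \<in> Weq M)"
    and ret: "\<forall>X\<in>{Weq M, Cof M, Fib M}. \<forall>f\<in>Ar C. \<forall>g\<in>X. retract_of C f g \<longrightarrow> f \<in> X"
    and lft: "\<forall>i\<in>Cof M. \<forall>p\<in>Fib M. i \<in> Weq M \<or> p \<in> Weq M \<longrightarrow> lifts_against C i p"
    and fct: "\<forall>f\<in>Ar C.
        (\<exists>i\<in>Cof M. \<exists>p\<in>Fib M \<inter> Weq M. Cd C i = Dm C p \<and> f = Cmp C i p) \<and>
        (\<exists>i\<in>Cof M \<inter> Weq M. \<exists>p\<in>Fib M. Cd C i = Dm C p \<and> f = Cmp C i p)"
    using M unfolding model_structure_def by - (elim conjE, assumption)+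
  have w2: "g \<in> Weq M" if "f \<in> Weq M" "Cmp C f g \<in> Weq M" "f \<in> hom C a b" "g \<in> hom C b c" for f g a b c
  proof -
    have "f \<in> Ar C" "g \<in> Ar C" "Cd C f = Dm C g" using that by (auto simp: hom_def)
    then show ?thesis using two that(1,2) by blast
  qed
  have w3: "f \<in> Weq M" if "g \<in> Weq M" "Cmp C f g \<in> Weq M" "f \<in> hom C a b" "g \<in> hom C b c" for f g a b c
  proof -
    have "f \<in> Ar C" "g \<in> Ar C" "Cd C f = Dm C g" using that by (auto simp: hom_def)
    then show ?thesis using two that(1,2) by blast
  qed
  have w1: "Cmp C f g \<in> Weq M" if "f \<in> Weq M" "g \<in> Weq M" "f \<in> hom C a b" "g \<in> hom C b c" for f g a b c
  proof -
    have "f \<in> Ar C" "g \<in> Ar C" "Cd C f = Dm C g" using that by (auto simp: hom_def)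
    then show ?thesis using two that(1,2) by blast
  qed
  have fac: "\<exists>i\<in>Cof M. \<exists>p\<in>Fib M \<inter> Weq M. \<exists>e. i \<in> hom C a e \<and> p \<in> hom C e b \<and> f = Cmp C i p"
    "\<exists>i\<in>Cof M \<inter> Weq M. \<exists>p\<in>Fib M. \<exists>e. i \<in> hom C a e \<and> p \<in> hom C e b \<and> f = Cmp C i p" if "f \<in> hom C a b" for f a b
  proof -
    have fa: "f \<in> Ar C" "Dm C f = a" "Cd C f = b" using that by (auto simp: hom_def)
    have tys: "i \<in> hom C a (Cd C i) \<and> p \<in> hom C (Cd C i) b" if "i \<in> Ar C" "p \<in> Ar C" "Cd C i = Dm C p" "f = Cmp C i p" for i p
      using category_Cmp[OF C that(1-3)] that fa by (auto simp: hom_def)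
    have "\<exists>i\<in>Cof M. \<exists>p\<in>Fib M \<inter> Weq M. Cd C i = Dm C p \<and> f = Cmp C i p" using fct fa(1) by blast
    then show "\<exists>i\<in>Cof M. \<exists>p\<in>Fib M \<inter> Weq M. \<exists>e. i \<in> hom C a e \<and> p \<in> hom C e b \<and> f = Cmp C i p"
      using tys sub by blast
    have "\<exists>i\<in>Cof M \<inter> Weq M. \<exists>p\<in>Fib M. Cd C i = Dm C p \<and> f = Cmp C i p" using fct fa(1) by blast
    then show "\<exists>i\<in>Cof M \<inter> Weq M. \<exists>p\<in>Fib M. \<exists>e. i \<in> hom C a e \<and> p \<in> hom C e b \<and> f = Cmp C i p"
      using tys sub by blast
  qed
  have lift: "lifts_against C i p" if "i \<in> Cof M" "p \<in> Fib M" "i \<in> Weq M \<or> p \<in> Weq M" for i p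
    using lft that by blast
  define A where "A = Dm C f"
  define B where "B = Cd C f"
  define X where "X = Cd C i"
  define P where "P = Cd C f'"
  have H: "f \<in> hom C A B" "i \<in> hom C A X" "f' \<in> hom C X P" "i' \<in> hom C B P" and sq: "Cmp C f i' = Cmp C i f'"
    using po by (auto simp: is_pushout_def hom_def A_def B_def X_def P_def)
  have univ: "\<exists>!d. d \<in> hom C P T \<and> Cmp C i' d = b \<and> Cmp C f' d = c"
    if "T \<in> Ob C" "b \<in> hom C B T" "c \<in> hom C X T" "Cmp C f b = Cmp C i c" for T b c
    using po that unfolding is_pushout_def B_def X_def P_def by blast
  obtain k p E where k: "k \<in> Cof M" "k \<in> hom C A E" and p: "p \<in> Fib M \<inter> Weq M" "p \<in> hom C E B" and fkp: "f = Cmp C k p"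
    using fac(1)[OF H(1)] by blast
  have kW: "k \<in> Weq M" using w3[OF _ _ k(2) p(2)] p(1) f fkp by blast
  obtain c d R0 where c: "c \<in> Cof M \<inter> Weq M" "c \<in> hom C X R0" and d: "d \<in> Fib M" "d \<in> hom C R0 P" and cd: "f' = Cmp C c d"
    using fac(2)[OF H(3)] by blast
  have pj: "Cmp C p i' \<in> hom C E P" and ic: "Cmp C i c \<in> hom C A R0"
    using hom_comp[OF C p(2) H(4)] hom_comp[OF C H(2) c(2)] .
  have "Cmp C (Cmp C i c) d = Cmp C k (Cmp C p i')"
    using hom_assoc[OF C H(2) c(2) d(2)] hom_assoc[OF C k(2) p(2) H(4)] sq fkp cd by simp
  then obtain h where h: "h \<in> hom C E R0" "Cmp C k h = Cmp C i c" "Cmp C h d = Cmp C p i'"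
    using lifts_againstD[OF lift[OF k(1) d(1)] k(2) d(2) ic pj] kW by blast
  \<comment> \<open>\<open>h\<close> is replaced by a cofibration \<open>h'\<close>, so that the
    later trivial fibration \<open>r\<close> acquires a section under \<open>E\<close>.\<close>
  obtain h' e R' where h': "h' \<in> Cof M" "h' \<in> hom C E R'" and e: "e \<in> Fib M \<inter> Weq M" "e \<in> hom C R' R0" and he: "h = Cmp C h' e"
    using fac(1)[OF h(1)] by blast
  have kh: "Cmp C k h' \<in> hom C A R'" using hom_comp[OF C k(2) h'(2)] .
  have "Cmp C (Cmp C k h') e = Cmp C i c" using hom_assoc[OF C k(2) h'(2) e(2)] he h(2) by simp
  \<comment> \<open>The cofibration hypothesis on \<open>i\<close> enters here: \<open>c\<close> is
    lifted to the new middle object, compatibly with \<open>k\<close> followed by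
    \<open>h'\<close>.\<close>
  then obtain c' where c': "c' \<in> hom C X R'" "Cmp C i c' = Cmp C k h'" "Cmp C c' e = c"
    using lifts_againstD[OF lift[OF i] H(2) e(2) kh c(2)] e(1) by blast
  have c'W: "c' \<in> Weq M" using w3[OF _ _ c'(1) e(2)] e(1) c'(3) c(1) by blast
  obtain Z W r I G j where r: "r \<in> Fib M \<inter> Weq M" "r \<in> hom C Z R'" and I: "I \<in> hom C E Z" and G: "G \<in> Weq M" "G \<in> hom C Z W"
    and j: "j \<in> hom C B W" and Ir: "Cmp C I r = h'" and IG: "Cmp C I G = Cmp C p j"
    and u: "\<And>Y K k. K \<in> hom C Z Y \<Longrightarrow> k \<in> hom C B Y \<Longrightarrow> Cmp C I K = Cmp C p k \<Longrightarrow>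
          (\<exists>t\<in>hom C W Y. Cmp C G t = K \<and> Cmp C j t = k)"
    using approx[OF p h'(2)] by blast
  have oR: "R' \<in> Ob C" "Z \<in> Ob C" using hom_ob[OF C r(2)] by auto
  have oP: "P \<in> Ob C" "X \<in> Ob C" using hom_ob[OF C H(3)] by auto
  have "Cmp C I r = Cmp C h' (Idn C R')" using Ir hom_unit[OF C h'(2)] by simp
  \<comment> \<open>The square being filled has \<open>I\<close> on top and the identity of
    \<open>R'\<close> below, so the filler is a section of \<open>r\<close> that carries
    \<open>h'\<close> to \<open>I\<close>.\<close>
  then obtain s where s: "s \<in> hom C R' Z" "Cmp C h' s = I" "Cmp C s r = Idn C R'"
    using lifts_againstD[OF lift[OF h'(1)] h'(2) r(2) I hom_id[OF C oR(1)]] r(1) by blast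
  \<comment> \<open>Two-out-of-three for \<open>r\<close> followed by the identity.\<close>
  have "Idn C R' \<in> Weq M" using w2[OF _ _ r(2) hom_id[OF C oR(1)]] r hom_unit[OF C r(2)] by simp
  then have sW: "s \<in> Weq M" using w3[OF _ _ s(1) r(2)] r(1) s(3) by auto
  define q where "q = Cmp C c' (Cmp C s G)"
  have sG: "Cmp C s G \<in> hom C R' W" using hom_comp[OF C s(1) G(2)] .
  have q: "q \<in> hom C X W" unfolding q_def using hom_comp[OF C c'(1) sG] .
  have qW: "q \<in> Weq M" unfolding q_def by (rule w1[OF c'W w1[OF sW G(1) s(1) G(2)] c'(1) sG])
  have fj: "Cmp C f j = Cmp C i q"
  proof -
    have "Cmp C i q = Cmp C (Cmp C k h') (Cmp C s G)" unfolding q_def using hom_assoc[OF C H(2) c'(1) sG] c'(2) by simp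
    also have "\<dots> = Cmp C k (Cmp C (Cmp C h' s) G)" using hom_assoc[OF C k(2) h'(2) sG] hom_assoc[OF C h'(2) s(1) G(2)] by simp
    also have "\<dots> = Cmp C f j" using s(2) IG hom_assoc[OF C k(2) p(2) j] fkp by simp
    finally show ?thesis ..
  qed
  obtain y where y: "y \<in> hom C P W" "Cmp C i' y = j" "Cmp C f' y = q"
    using univ[OF _ j q fj] hom_ob[OF C j] by blast
  \<comment> \<open>The way back to the pushout. Along \<open>I\<close> it restricts to
    \<open>p\<close> followed by \<open>i'\<close>, which is the condition for extending it over
    \<open>W\<close>.\<close>
  define K where "K = Cmp C r (Cmp C e d)"
  have ed: "Cmp C e d \<in> hom C R' P" using hom_comp[OF C e(2) d(2)] .
  have K: "K \<in> hom C Z P" unfolding K_def using hom_comp[OF C r(2) ed] .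
  have "Cmp C I K = Cmp C h' (Cmp C e d)" unfolding K_def using hom_assoc[OF C I r(2) ed] Ir by simp
  then have "Cmp C I K = Cmp C p i'" using hom_assoc[OF C h'(2) e(2) d(2)] he h(3) by simp
  then obtain t where t: "t \<in> hom C W P" "Cmp C G t = K" "Cmp C j t = i'" using u[OF K H(4)] by blast
  have qt: "Cmp C q t = f'"
  proof -
    have "Cmp C q t = Cmp C c' (Cmp C s K)"
      unfolding q_def using hom_assoc[OF C c'(1) sG t(1)] hom_assoc[OF C s(1) G(2) t(1)] t(2) by simp
    also have "Cmp C s K = Cmp C e d"
      unfolding K_def using hom_assoc[OF C s(1) r(2) ed] s(3) hom_unit[OF C ed] by simp
    also have "Cmp C c' (Cmp C e d) = f'" using hom_assoc[OF C c'(1) e(2) d(2)] c'(3) cd by simp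
    finally show ?thesis .
  qed
  \<comment> \<open>The endomorphism fixes both legs of the pushout, as the identity does.\<close>
  have yt: "Cmp C y t = Idn C P"
  proof -
    have 1: "Cmp C y t \<in> hom C P P" "Cmp C i' (Cmp C y t) = i'" "Cmp C f' (Cmp C y t) = f'"
      using hom_comp[OF C y(1) t(1)] hom_assoc[OF C H(4) y(1) t(1)] hom_assoc[OF C H(3) y(1) t(1)] y t qt by auto
    have 2: "Idn C P \<in> hom C P P" "Cmp C i' (Idn C P) = i'" "Cmp C f' (Idn C P) = f'"
      using hom_id[OF C oP(1)] hom_unit[OF C H(4)] hom_unit[OF C H(3)] by auto
    show ?thesis using univ[OF oP(1) H(4,3) sq] 1 2 by blast
  qed
  have "retract_of C f' q"
    unfolding retract_of_def
  proof (intro bexI conjI)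
    have dm: "Dm C f' = X" "Cd C f' = P" "Dm C q = X" "Cd C q = W" using H(3) q by (auto simp: hom_def)
    show "Idn C X \<in> hom C (Dm C f') (Dm C q)" "Idn C X \<in> hom C (Dm C q) (Dm C f')" using hom_id[OF C oP(2)] dm by auto
    show "y \<in> hom C (Cd C f') (Cd C q)" "t \<in> hom C (Cd C q) (Cd C f')" using y t dm by auto
    show "Cmp C (Idn C X) q = Cmp C f' y" using hom_unit[OF C q] y by simp
    show "Cmp C (Idn C X) f' = Cmp C q t" using hom_unit[OF C H(3)] qt by simp
    show "Cmp C (Idn C X) (Idn C X) = Idn C (Dm C f')" using hom_unit[OF C hom_id[OF C oP(2)]] dm by simp
    show "Cmp C y t = Idn C (Cd C f')" using yt dm by simp
  qed
  moreover have "f' \<in> Ar C" using H(3) by (simp add: hom_def)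
  ultimately show "f' \<in> Weq M" using ret qW by blast
qed

section \<open>Translation between cell maps and the arrows of \<open>DblCat\<close>\<close>

definition cells :: "'u dblfun \<Rightarrow> 'u cellmap" where
  "cells F = \<lparr> mo = FO F, mh = FH F, mv = FV F, ms = FS F \<rparr>"

definition ext :: "'u dblcat \<Rightarrow> 'u dblcat \<Rightarrow> 'u cellmap \<Rightarrow> 'u dblfun" where
  "ext A B m = \<lparr> Src = A, Tgt = B, FO = restrict (mo m) (Ob (HC A)), FH = restrict (mh m) (Ar (HC A)),
     FV = restrict (mv m) (Ar (VC A)), FS = restrict (ms m) (Sq A) \<rparr>"

lemma cells_sel [simp]: "mo (cells F) = FO F" "mh (cells F) = FH F" "mv (cells F) = FV F" "ms (cells F) = FS F"
  by (simp_all add: cells_def)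

lemma ext_sel [simp]: "Src (ext A B m) = A" "Tgt (ext A B m) = B"
  by (simp_all add: ext_def)

lemma meq_cells_ext: "meq A (cells (ext A B m)) m"
  by (simp add: meq_def ext_def)

lemma dfun_cells_of: "double_functor F \<Longrightarrow> dfun (Src F) (Tgt F) (cells F)"
  by (simp add: double_functor_def dfun_def)

lemma double_functor_ext: assumes "dfun A B m" shows "double_functor (ext A B m)"
proof -
  have "dfun A B (cells (ext A B m))" by (rule dfun_meq[OF assms meq_sym[OF meq_cells_ext]])
  then show ?thesis by (simp add: dfun_def double_functor_def) (simp add: ext_def)
qed

lemma ext_cells: assumes "double_functor F" shows "ext (Src F) (Tgt F) (cells F) = F"
  using assms by (simp add: ext_def double_functor_def extensional_restrict)

lemma ext_cong: "meq A m n \<Longrightarrow> ext A B m = ext A B n"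
  by (auto simp: ext_def meq_def intro!: restrict_ext)

lemma meq_of_ext: "ext A B m = ext A B n \<Longrightarrow> meq A m n"
  using meq_trans[OF meq_sym[OF meq_cells_ext[of A B m]], of n] meq_cells_ext[of A B n] by simp

lemma dblfun_comp_ext: "dblfun_comp F G = ext (Src F) (Tgt G) (mcomp (cells F) (cells G))"
  by (simp add: dblfun_comp_def ext_def compose_def restrict_def cong: if_cong)

lemma comp_ext: assumes "dfun A B m" shows "dblfun_comp (ext A B m) (ext B C n) = ext A C (mcomp m n)"
proof -
  have "meq A (mcomp (cells (ext A B m)) (cells (ext B C n))) (mcomp m (cells (ext B C n)))"
    by (rule meq_mcomp_left[OF meq_cells_ext])
  moreover have "meq A (mcomp m (cells (ext B C n))) (mcomp m n)"
    by (rule meq_mcomp_right[OF assms meq_cells_ext])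
  ultimately show ?thesis unfolding dblfun_comp_ext ext_sel by (intro ext_cong) (rule meq_trans)
qed

definition idmap :: "'u cellmap" where
  "idmap = \<lparr> mo = (\<lambda>x. x), mh = (\<lambda>x. x), mv = (\<lambda>x. x), ms = (\<lambda>x. x) \<rparr>"

lemma dblfun_id_ext: "dblfun_id A = ext A A idmap"
  by (simp add: dblfun_id_def ext_def idmap_def)

lemma dfun_idmap: "double_category A \<Longrightarrow> dfun A A idmap"
  by (auto simp: dfun_def idmap_def is_functor_def double_category_def category_def)

lemma DblCat_sel [simp]: "Ob DblCat = {A. double_category A}" "Ar DblCat = {F. double_functor F}" "Dm DblCat = Src" "Cd DblCat = Tgt"
  "Idn DblCat = dblfun_id" "Cmp DblCat = dblfun_comp"
  by (simp_all add: DblCat_def)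

text \<open>Extensional double functors are restrictions of cell maps, so equations between them can
  be checked by \<open>meq\<close>.\<close>

lemma hom_DblCat: "F \<in> hom DblCat A B \<longleftrightarrow> (\<exists>m. dfun A B m \<and> F = ext A B m)"
proof
  assume "F \<in> hom DblCat A B"
  then have "double_functor F" "Src F = A" "Tgt F = B" by (auto simp: hom_def)
  then show "\<exists>m. dfun A B m \<and> F = ext A B m" using dfun_cells_of ext_cells by metis
next
  assume "\<exists>m. dfun A B m \<and> F = ext A B m"
  then show "F \<in> hom DblCat A B" using double_functor_ext by (auto simp: hom_def)
qed

lemma category_DblCat: "category DblCat"
proof -
  have E: "\<exists>A B m. dfun A B m \<and> F = ext A B m" if "double_functor F" for F :: "'a dblfun"
    using dfun_cells_of[OF that] ext_cells[OF that] by metis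
  have id: "mcomp idmap m = m" "mcomp m idmap = m" for m :: "'a cellmap" by (simp_all add: mcomp_def idmap_def)
  show ?thesis
    unfolding category_def DblCat_sel
  proof (intro conjI ballI impI)
    fix F :: "'a dblfun" assume "F \<in> {F. double_functor F}" then have F: "double_functor F" by simp
    show "Src F \<in> {A. double_category A}" "Tgt F \<in> {A. double_category A}" using F by (simp_all add: double_functor_def)
    obtain A B m where m: "dfun A B m" "F = ext A B m" using E[OF F] by blast
    show "dblfun_comp (dblfun_id (Src F)) F = F" "dblfun_comp F (dblfun_id (Tgt F)) = F"
      unfolding dblfun_id_ext m(2) ext_sel comp_ext[OF dfun_idmap[OF dfun_dc(1)[OF m(1)]]] comp_ext[OF m(1)] id by simp_all
    fix G :: "'a dblfun" assume "G \<in> {F. double_functor F}" and FG: "Tgt F = Src G" then have G: "double_functor G" by simp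
    obtain C n where n: "dfun B C n" "G = ext B C n" using E[OF G] FG m(2) by (metis ext_sel)
    show "dblfun_comp F G \<in> {F. double_functor F}" "Src (dblfun_comp F G) = Src F" "Tgt (dblfun_comp F G) = Tgt G"
      unfolding m(2) n(2) comp_ext[OF m(1)] using double_functor_ext[OF dfun_mcomp[OF m(1) n(1)]] by simp_all
    fix H :: "'a dblfun" assume "H \<in> {F. double_functor F}" and GH: "Tgt G = Src H" then have H: "double_functor H" by simp
    obtain D l where l: "dfun C D l" "H = ext C D l" using E[OF H] GH n(2) by (metis ext_sel)
    show "dblfun_comp (dblfun_comp F G) H = dblfun_comp F (dblfun_comp G H)"
      unfolding m(2) n(2) l(2) comp_ext[OF m(1)] comp_ext[OF n(1)] comp_ext[OF dfun_mcomp[OF m(1) n(1)]] mcomp_assoc ..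
  next
    fix A :: "'a dblcat" assume "A \<in> {A. double_category A}" then have A: "double_category A" by simp
    show "dblfun_id A \<in> {F. double_functor F}" "Src (dblfun_id A) = A" "Tgt (dblfun_id A) = A"
      unfolding dblfun_id_ext using double_functor_ext[OF dfun_idmap[OF A]] by simp_all
  qed
qed

lemma dctf_meq:
  assumes "dctf A B m" "meq A m n" shows "dctf A B n"
proof -
  have d: "dfun A B n" by (rule dfun_meq[OF dctf_dfun[OF assms(1)] assms(2)])
  have e: "\<And>x. x \<in> Ob (HC A) \<Longrightarrow> mo m x = mo n x" "\<And>f x y. harr A f x y \<Longrightarrow> mh m f = mh n f"
    "\<And>f x y. varr A f x y \<Longrightarrow> mv m f = mv n f" "\<And>\<alpha> t b l r. sq A \<alpha> t b l r \<Longrightarrow> ms m \<alpha> = ms n \<alpha>"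
    using assms(2) by (auto simp: meq_def harr_def varr_def sq_def)
  have s: "\<exists>!\<alpha>. sq A \<alpha> t b l r \<and> ms n \<alpha> = \<sigma>"
    if h: "harr A t x y" "harr A b x' y'" "varr A l x x'" "varr A r y y'" and s: "sq B \<sigma> (mh n t) (mh n b) (mv n l) (mv n r)" for x y x' y' t b l r \<sigma>
  proof -
    have "\<exists>!\<alpha>. sq A \<alpha> t b l r \<and> ms m \<alpha> = \<sigma>"
      by (rule dctf_sq_ex1[OF assms(1) _ h]) (use s e(2)[OF h(1)] e(2)[OF h(2)] e(3)[OF h(3)] e(3)[OF h(4)] in simp)
    then show ?thesis using e(4) by (metis (no_types))
  qed
  show ?thesis
    unfolding dctf_def
  proof (intro conjI d ballI allI impI)
    show "\<exists>x\<in>Ob (HC A). mo n x = y" if "y \<in> Ob (HC B)" for y using dctf_ob[OF assms(1) that] e(1) by metis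
    show "\<exists>f. harr A f x y \<and> mh n f = g" if "x \<in> Ob (HC A)" "y \<in> Ob (HC A)" "harr B g (mo n x) (mo n y)" for x y g
      using dctf_h[OF assms(1), of g x y] that e(1)[OF that(1)] e(1)[OF that(2)] e(2) by metis
    show "\<exists>f. varr A f x y \<and> mv n f = g" if "x \<in> Ob (HC A)" "y \<in> Ob (HC A)" "varr B g (mo n x) (mo n y)" for x y g
      using dctf_v[OF assms(1), of g x y] that e(1)[OF that(1)] e(1)[OF that(2)] e(3) by metis
  qed (rule s)
qed

text \<open>A double functor maps cells with a given boundary into cells with the image boundary, so
  each equality of sets reduces to one inclusion and bijectivity on squares to unique
  lifting.\<close>

lemma canonical_trivial_fibration_iff:
  "canonical_trivial_fibration F \<longleftrightarrow> double_functor F \<and> dctf (Src F) (Tgt F) (cells F)"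
proof (cases "double_functor F")
  case True
  define A where "A = Src F"
  define B where "B = Tgt F"
  have d: "dfun A B (cells F)" using dfun_cells_of[OF True] by (simp add: A_def B_def)
  have ob: "Ob (VC A) = Ob (HC A)" using dcat.obs(1)[OF dfun_dcat(1)[OF d]] .
  interpret A: dcat A using dfun_dcat(1)[OF d] .
  have 1: "FO F ` Ob (HC A) = Ob (HC B) \<longleftrightarrow> (\<forall>y\<in>Ob (HC B). \<exists>x\<in>Ob (HC A). FO F x = y)"
    unfolding set_eq_iff image_iff using dfun_ob[OF d, unfolded cells_sel] by metis
  have 2: "FH F ` hom (HC A) x y = hom (HC B) (FO F x) (FO F y) \<longleftrightarrow> (\<forall>g. harr B g (FO F x) (FO F y) \<longrightarrow> (\<exists>f. harr A f x y \<and> FH F f = g))" for x y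
    unfolding set_eq_iff image_iff Bex_def in_hom_HC using dfun_harr[OF d, unfolded cells_sel] by metis
  have 3: "FV F ` hom (VC A) x y = hom (VC B) (FO F x) (FO F y) \<longleftrightarrow> (\<forall>g. varr B g (FO F x) (FO F y) \<longrightarrow> (\<exists>f. varr A f x y \<and> FV F f = g))" for x y
    unfolding set_eq_iff image_iff Bex_def in_hom_VC using dfun_varr[OF d, unfolded cells_sel] by metis
  have 4: "bij_betw (FS F) (squares A t b l r) (squares B (FH F t) (FH F b) (FV F l) (FV F r)) \<longleftrightarrow>
     (\<forall>\<sigma>. sq B \<sigma> (FH F t) (FH F b) (FV F l) (FV F r) \<longrightarrow> (\<exists>!\<alpha>. sq A \<alpha> t b l r \<and> FS F \<alpha> = \<sigma>))" (is "?L = ?R") for t b l r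
  proof -
    have *: "sq B (FS F \<alpha>) (FH F t) (FH F b) (FV F l) (FV F r)" if "sq A \<alpha> t b l r" for \<alpha> using dfun_sq[OF d that] by simp
    show ?thesis
    proof
      assume L: ?L
      show ?R
      proof (intro allI impI)
        fix \<sigma> assume s: "sq B \<sigma> (FH F t) (FH F b) (FV F l) (FV F r)"
        have "\<sigma> \<in> FS F ` squares A t b l r" using L s by (simp add: bij_betw_def)
        then obtain \<alpha> where "sq A \<alpha> t b l r" "FS F \<alpha> = \<sigma>" by auto
        moreover have "inj_on (FS F) (squares A t b l r)" using L by (simp add: bij_betw_def)
        ultimately show "\<exists>!\<alpha>. sq A \<alpha> t b l r \<and> FS F \<alpha> = \<sigma>" by (metis in_squares inj_onD)
      qed
    next
      assume R: ?R
      have "inj_on (FS F) (squares A t b l r)" unfolding inj_on_def using R * by (metis in_squares)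
      moreover have "FS F ` squares A t b l r = squares B (FH F t) (FH F b) (FV F l) (FV F r)"
      proof (intro subset_antisym subsetI)
        fix \<sigma> assume "\<sigma> \<in> squares B (FH F t) (FH F b) (FV F l) (FV F r)"
        then obtain \<alpha> where "sq A \<alpha> t b l r" "FS F \<alpha> = \<sigma>" using R unfolding in_squares by blast
        then show "\<sigma> \<in> FS F ` squares A t b l r" by auto
      qed (use * in auto)
      ultimately show ?L by (simp add: bij_betw_def)
    qed
  qed
  have 5: "fully_faithful_on_squares F \<longleftrightarrow> (\<forall>x y x' y' t b l r \<sigma>. harr A t x y \<longrightarrow> harr A b x' y' \<longrightarrow> varr A l x x' \<longrightarrow> varr A r y y' \<longrightarrow>
        sq B \<sigma> (FH F t) (FH F b) (FV F l) (FV F r) \<longrightarrow> (\<exists>!\<alpha>. sq A \<alpha> t b l r \<and> FS F \<alpha> = \<sigma>))"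
    (is "?L \<longleftrightarrow> ?R")
  proof
    assume ?L
    note L = this[unfolded fully_faithful_on_squares_def A_def[symmetric] B_def[symmetric] in_hom_HC in_hom_VC Ball_def 4, rule_format]
    show ?R
    proof (intro allI impI)
      fix x y x' y' t b l r \<sigma> assume h: "harr A t x y" "harr A b x' y'" "varr A l x x'" "varr A r y y'"
        and s: "sq B \<sigma> (FH F t) (FH F b) (FV F l) (FV F r)"
      show "\<exists>!\<alpha>. sq A \<alpha> t b l r \<and> FS F \<alpha> = \<sigma>"
        by (rule L[OF A.harr_ob[OF h(1)] A.harr_ob[OF h(2)] h s])
    qed
  next
    assume R: ?R
    show ?L
      unfolding fully_faithful_on_squares_def A_def[symmetric] B_def[symmetric] in_hom_HC in_hom_VC Ball_def 4
      by (intro allI impI) (rule R[rule_format])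
  qed
  show ?thesis
    unfolding canonical_trivial_fibration_def dctf_def A_def[symmetric] B_def[symmetric] 1 2 3 5 ob cells_sel
    using True d by simp
qed (simp add: canonical_trivial_fibration_def)

theorem theorem5p30:
  fixes M :: "'u dblfun model"
  assumes "infinite (UNIV :: 'u set)"
    and "gregarious_model_structure M"
  shows "left_proper DblCat M"
proof (rule left_proper_criterion[OF category_DblCat])
  show "model_structure DblCat M"
    using assms(2) by (simp add: gregarious_model_structure_def)
  have ctf: "Fib M \<inter> Weq M = {F. canonical_trivial_fibration F}"
    using assms(2) unfolding gregarious_model_structure_def by blast
  have ext_ctf: "ext A B m \<in> Fib M \<inter> Weq M \<inter> hom DblCat A B" if "dctf A B m" for A B m
    using dctf_dfun[OF that] dctf_meq[OF that meq_sym[OF meq_cells_ext]] double_functor_ext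
    by (auto simp: ctf canonical_trivial_fibration_iff hom_DblCat)
  fix p h :: "'u dblfun" and A B X :: "'u dblcat"
  assume p: "p \<in> Fib M \<inter> Weq M" "p \<in> hom DblCat A B" and h: "h \<in> hom DblCat A X"
  obtain F where F: "dfun A B F" "p = ext A B F" using p(2) hom_DblCat by blast
  obtain J where J: "dfun A X J" "h = ext A X J" using h hom_DblCat by blast
  have "dctf A B (cells p)" using p(1) F(2) by (simp add: ctf canonical_trivial_fibration_iff)
  then have F': "dctf A B F" by (rule dctf_meq) (simp add: F(2) meq_cells_ext)
  obtain Z W r I G j where r: "dctf Z X r" and I: "dfun A Z I" and Ir: "meq A (mcomp I r) J" and G: "dctf Z W G"
    and j: "dfun B W j" and sq: "meq A (mcomp I G) (mcomp F j)"
    and u: "\<And>Y K k. dfun Z Y K \<Longrightarrow> dfun B Y k \<Longrightarrow> meq A (mcomp I K) (mcomp F k) \<Longrightarrow>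
       dfun W Y K \<and> meq Z (mcomp G K) K \<and> meq B (mcomp j K) k"
    by (rule pushout_approximation[OF assms(1) F' J(1)]) (rule that)
  show "\<exists>Z W. \<exists>r\<in>Fib M \<inter> Weq M \<inter> hom DblCat Z X. \<exists>I\<in>hom DblCat A Z. \<exists>G\<in>Weq M \<inter> hom DblCat Z W. \<exists>j\<in>hom DblCat B W.
        Cmp DblCat I r = h \<and> Cmp DblCat I G = Cmp DblCat p j \<and>
        (\<forall>Y. \<forall>K\<in>hom DblCat Z Y. \<forall>k\<in>hom DblCat B Y. Cmp DblCat I K = Cmp DblCat p k \<longrightarrow>
          (\<exists>t\<in>hom DblCat W Y. Cmp DblCat G t = K \<and> Cmp DblCat j t = k))"
  proof (intro exI bexI conjI)
    show "ext Z X r \<in> Fib M \<inter> Weq M \<inter> hom DblCat Z X" by (rule ext_ctf[OF r])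
    show "ext A Z I \<in> hom DblCat A Z" "ext B W j \<in> hom DblCat B W" using I j hom_DblCat by blast+
    show "ext Z W G \<in> Weq M \<inter> hom DblCat Z W" using ext_ctf[OF G] by simp
    show "Cmp DblCat (ext A Z I) (ext Z X r) = h"
      unfolding DblCat_sel comp_ext[OF I] J(2) by (rule ext_cong[OF Ir])
    show "Cmp DblCat (ext A Z I) (ext Z W G) = Cmp DblCat p (ext B W j)"
      unfolding DblCat_sel comp_ext[OF I] F(2) comp_ext[OF F(1)] by (rule ext_cong[OF sq])
    show "\<forall>Y. \<forall>K\<in>hom DblCat Z Y. \<forall>k\<in>hom DblCat B Y. Cmp DblCat (ext A Z I) K = Cmp DblCat p k \<longrightarrow>
          (\<exists>t\<in>hom DblCat W Y. Cmp DblCat (ext Z W G) t = K \<and> Cmp DblCat (ext B W j) t = k)"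
    proof (intro allI ballI impI)
      fix Y :: "'u dblcat" and K k assume K: "K \<in> hom DblCat Z Y" and k: "k \<in> hom DblCat B Y"
        and e: "Cmp DblCat (ext A Z I) K = Cmp DblCat p k"
      obtain K' where K': "dfun Z Y K'" "K = ext Z Y K'" using K hom_DblCat by blast
      obtain k' where k': "dfun B Y k'" "k = ext B Y k'" using k hom_DblCat by blast
      have "meq A (mcomp I K') (mcomp F k')"
        using e unfolding DblCat_sel K'(2) k'(2) F(2) comp_ext[OF I] comp_ext[OF F(1)] by (rule meq_of_ext)
      \<comment> \<open>The mediating map is \<open>K'\<close> itself, now read as a map out of
        \<open>W\<close>.\<close>
      note t = u[OF K'(1) k'(1) this]
      have Gt: "dblfun_comp (ext Z W G) (ext W Y K') = K"
        unfolding comp_ext[OF dctf_dfun[OF G]] K'(2) using t ext_cong by blast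
      have jt: "dblfun_comp (ext B W j) (ext W Y K') = k"
        unfolding comp_ext[OF j] k'(2) using t ext_cong by blast
      have "ext W Y K' \<in> hom DblCat W Y" using t hom_DblCat by blast
      then show "\<exists>t\<in>hom DblCat W Y. Cmp DblCat (ext Z W G) t = K \<and> Cmp DblCat (ext B W j) t = k"
        using Gt jt by auto
    qed
  qed
qed

end
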